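(* Let $(X,Y)$, $q\ge 2$, $f$, $\epsilon$, $(a_j)_{j=1,\dots,q}$, $(\lambda_j)_{j=1,\dots,q}$, $\Gamma_X$, $\Gamma_{E(X|Y)}$, $\Gamma_X^N$, $\Gamma^N_{E(X|Y)}$, $\mathcal{S}$, $[\cdot,\cdot]$, $\alpha=\alpha_N$ and $\gamma^N$ be as described in the context, and assume: (A1) writing $A=(\langle X,a_1\rangle,\dots,\langle X,a_q\rangle)^T$, for all $u\in L^2(\mathcal{T})$ there exists $v\in\mathbb{R}^q$ such that $E(\langle u,X\rangle\mid A)=v^TA$; (A2) $E(\|X\|^4)<+\infty$; (A3) for all $\alpha>0$, $\inf_{\|a\|=1,\ a\in\mathcal{S}} Q_\alpha(a,a)=\rho_\alpha>0$, where $Q_\alpha(f,g)=\langle\Gamma_X f,g\rangle+\alpha[f,g]$ for $f,g\in\mathcal{S}$; (A4) $\Gamma^N_{E(X|Y)}$ is a continuous operator which converges in probability to $\Gamma_{E(X|Y)}$ with $\sqrt{N}$ rate; (A5) $\lim_{N\to+\infty}\alpha_N=0$ and $\lim_{N\to+\infty}\sqrt{N}\,\alpha_N=+\infty$; (A6) $a_1,\dots,a_q$ belong to $\mathcal{S}$ and, for all $u$ such that $\langle\Gamma_X u,a_1\rangle=0$ and $\langle\Gamma_X u,u\rangle=1$, one has $\langle\Gamma_{E(X|Y)}u,u\rangle\le\langle\Gamma_{E(X|Y)}a_2,a_2\rangle=\lambda_2<\lambda_1$. Then, with probability converging to $1$ as $N\to+\infty$, the function $\gamma^N$ reaches its maximum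 on $\mathcal{S}$. In this case, let $a_1^N$ be a vector of $\mathcal{S}$ at which $\gamma^N$ is maximum and which is such that $\langle\Gamma_X a_1^N,a_1\rangle=1$. Then $$\langle\Gamma_X(a_1^N-a_1),\,a_1^N-a_1\rangle\to 0\quad\text{in probability}$$ as $N\to+\infty$.
   Context: $\mathcal{T}\subset\mathbb{R}$ is a compact interval and $L^2(\mathcal{T})$ is the real Hilbert space of square integrable functions on $\mathcal{T}$ with $\langle f,g\rangle=\int_{\mathcal{T}}f(t)g(t)\,dt$ and norm $\|\cdot\|$. $X$ is a centered random variable with values in $L^2(\mathcal{T})$ and $Y$ is a real random variable. For $x\in L^2(\mathcal{T})$, $x\otimes x$ is the operator $f\mapsto\langle f,x\rangle x$. $\Gamma_X=E(X\otimes X)$ is the covariance operator of $X$, assumed positive definite, with eigenvalues $(\delta_i)_{i\ge1}$ and orthonormal eigenvectors $(u_i)_{i\ge1}$; $\Gamma_{E(X|Y)}=\mathrm{Var}(E(X|Y))=E\big(E(X|Y)\otimes E(X|Y)\big)$. $\Gamma_X^{-1}=\sum_i(1/\delta_i)\,u_i\otimes u_i$ is the (unbounded) inverse of $\Gamma_X$, defined on the image of $\Gamma_X$. Model: $Y=f(\langle X,a_1\rangle,\dots,\langle X,a_q\rangle,\epsilon)$, where $f$ is an unknown function, $\epsilon$ is a centered random variable independent of $X$, and $a_1,\dots,a_q$ are linearly independent elements of $L^2(\mathcal{T})$. Writing $X=\sum_i\zeta_iu_i$ for the Karhunen–Loève decomposition, it is assumed that $\sum_i\sum_j\frac{1}{\delta_i\delta_j}\big(E[E(\zeta_i|Y)E(\zeta_j|Y)]\big)^2<+\infty$.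 The vectors $a_1,\dots,a_q$ are taken to be the $\Gamma_X$-orthonormal eigenvectors ($\langle\Gamma_Xa_i,a_j\rangle=\delta_{ij}$, the Kronecker symbol) of $\Gamma_X^{-1}\Gamma_{E(X|Y)}$ associated with its $q$ positive eigenvalues $\lambda_1\ge\lambda_2\ge\dots\ge\lambda_q>0$, i.e. $\Gamma_{E(X|Y)}a_j=\lambda_j\Gamma_Xa_j$. $(X^n,Y^n)_{n\ge1}$ is an i.i.d. sequence of copies of $(X,Y)$. For sample size $N$, $\overline{X}=\frac1N\sum_{n=1}^NX^n$ and $\Gamma_X^N=\frac1N\sum_{n=1}^NX^n\otimes X^n-\overline{X}\otimes\overline{X}$. $\Gamma^N_{E(X|Y)}$ is an estimator of $\Gamma_{E(X|Y)}$ built from $(X^n,Y^n)_{n\le N}$; "converges in probability with $\sqrt N$ rate" means that the operator norm of $\Gamma^N_{E(X|Y)}-\Gamma_{E(X|Y)}$ is $O_P(N^{-1/2})$. $\mathcal{S}$ is the subspace of $L^2(\mathcal{T})$ of functions with a square integrable second derivative, and $[f,g]=\int_{\mathcal{T}}D^2f(t)\,D^2g(t)\,dt$ for $f,g\in\mathcal{S}$, where $D^2$ is the second derivative. The regularization parameter $\alpha=\alpha_N>0$ is deterministic and depends on $N$. For nonzero $a\in\mathcal{S}$, $$\gamma^N(a)=\frac{\langle\Gamma^N_{E(X|Y)}a,a\rangle}{\langle\Gamma^N_Xa,a\rangle+\alpha_N[a,a]}.$$ The vector $a_1^N$ is considered on events whose probability tends to $1$; its values elsewhere are irrelevant for convergence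 in probability. *)

theory Defs
  imports "HOL-Probability.Probability"
begin

definition sq_int :: "(real \<Rightarrow> real) \<Rightarrow> bool" where
  "sq_int f \<longleftrightarrow> f \<in> borel_measurable lborel \<and> integrable lborel (\<lambda>t. (f t)\<^sup>2)"

lemma sq_int_mult:
  assumes "sq_int f" "sq_int g" shows "integrable lborel (\<lambda>t. f t * g t)"
proof (rule Bochner_Integration.integrable_bound)
  show "integrable lborel (\<lambda>t. (f t)\<^sup>2 + (g t)\<^sup>2)" using assms by (auto simp: sq_int_def)
  show "(\<lambda>t. f t * g t) \<in> borel_measurable lborel"
    using assms by (auto simp: sq_int_def)
  have "\<bar>x * y\<bar> \<le> x\<^sup>2 + y\<^sup>2" for x y :: real
  proof -
    have "2 * (\<bar>x\<bar> * \<bar>y\<bar>) \<le> x\<^sup>2 + y\<^sup>2" using sum_squares_bound[of "\<bar>x\<bar>" "\<bar>y\<bar>"] by simp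
    moreover have "0 \<le> \<bar>x\<bar> * \<bar>y\<bar>" by simp
    ultimately show ?thesis unfolding abs_mult by linarith
  qed
  then show "AE t in lborel. norm (f t * g t) \<le> norm ((f t)\<^sup>2 + (g t)\<^sup>2)" by auto
qed

lemma sq_int_zero: "sq_int (\<lambda>_. 0)"
  by (simp add: sq_int_def)

lemma sq_int_scale: "sq_int f \<Longrightarrow> sq_int (\<lambda>t. c * f t)"
  by (auto simp: sq_int_def power_mult_distrib)

lemma sq_int_add: assumes "sq_int f" "sq_int g" shows "sq_int (\<lambda>t. f t + g t)"
proof -
  have "integrable lborel (\<lambda>t. (f t)\<^sup>2 + (g t)\<^sup>2 + 2 * (f t * g t))"
    using assms sq_int_mult[OF assms] by (auto simp: sq_int_def)
  then show ?thesis using assms by (auto simp: sq_int_def power2_sum mult.assoc)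
qed

lemma sq_int_uminus: "sq_int f \<Longrightarrow> sq_int (\<lambda>t. - f t)"
  by (auto simp: sq_int_def)

lemma sq_int_diff: assumes "sq_int f" "sq_int g" shows "sq_int (\<lambda>t. f t - g t)"
  using sq_int_add[OF assms(1) sq_int_uminus[OF assms(2)]] by simp

text \<open>
  \<open>l2\<close> is the real Hilbert space of square integrable functions on the line, modulo
  almost everywhere equality. The instance proofs below make the Bochner integral and the Borel
  sigma-algebra of the library available on it.
\<close>

definition l2_eq :: "(real \<Rightarrow> real) \<Rightarrow> (real \<Rightarrow> real) \<Rightarrow> bool" where
  "l2_eq f g \<longleftrightarrow> sq_int f \<and> sq_int g \<and> (AE t in lborel. f t = g t)"

quotient_type l2 = "real \<Rightarrow> real" / partial: l2_eq
proof (rule part_equivpI)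
  show "\<exists>f. l2_eq f f" using sq_int_zero by (auto simp: l2_eq_def)
  show "symp l2_eq" by (auto simp: l2_eq_def symp_def)
  show "transp l2_eq" by (auto simp: l2_eq_def transp_def)
qed

instantiation l2 :: real_inner
begin

lift_definition zero_l2 :: l2 is "\<lambda>_. 0" by (simp add: l2_eq_def sq_int_zero)

lift_definition plus_l2 :: "l2 \<Rightarrow> l2 \<Rightarrow> l2" is "\<lambda>f g t. f t + g t"
  by (auto simp: l2_eq_def intro: sq_int_add)

lift_definition uminus_l2 :: "l2 \<Rightarrow> l2" is "\<lambda>f t. - f t"
  by (auto simp: l2_eq_def intro: sq_int_uminus)

lift_definition minus_l2 :: "l2 \<Rightarrow> l2 \<Rightarrow> l2" is "\<lambda>f g t. f t - g t"
  by (auto simp: l2_eq_def intro: sq_int_diff)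

lift_definition scaleR_l2 :: "real \<Rightarrow> l2 \<Rightarrow> l2" is "\<lambda>c f t. c * f t"
  by (auto simp: l2_eq_def intro: sq_int_scale)

lift_definition inner_l2 :: "l2 \<Rightarrow> l2 \<Rightarrow> real" is "\<lambda>f g. \<integral>t. f t * g t \<partial>lborel"
proof -
  fix f f' g g' :: "real \<Rightarrow> real" assume a: "l2_eq f f'" "l2_eq g g'"
  then have "AE t in lborel. f t * g t = f' t * g' t"
    by (auto simp: l2_eq_def)
  then show "(\<integral>t. f t * g t \<partial>lborel) = (\<integral>t. f' t * g' t \<partial>lborel)"
    using a by (intro integral_cong_AE) (auto simp: l2_eq_def sq_int_def)
qed

definition norm_l2 :: "l2 \<Rightarrow> real" where "norm_l2 x = sqrt (inner x x)"
definition dist_l2 :: "l2 \<Rightarrow> l2 \<Rightarrow> real" where "dist_l2 x y = norm (x - y)"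
definition sgn_l2 :: "l2 \<Rightarrow> l2" where "sgn_l2 x = inverse (norm x) *\<^sub>R x"
definition uniformity_l2 :: "(l2 \<times> l2) filter" where
  "uniformity_l2 = (INF e\<in>{0<..}. principal {(x, y). dist x y < e})"
definition open_l2 :: "l2 set \<Rightarrow> bool" where
  "open_l2 U = (\<forall>x\<in>U. eventually (\<lambda>(x', y). x' = x \<longrightarrow> y \<in> U) uniformity)"

instance
proof
  fix x y z :: l2 and a b :: real
  show "x + y + z = x + (y + z)"
    by transfer (auto simp: l2_eq_def add.assoc intro: sq_int_add)
  show "x + y = y + x"
    by transfer (auto simp: l2_eq_def add.commute intro: sq_int_add)
  show "0 + x = x" by transfer (auto simp: l2_eq_def)
  show "- x + x = 0" by transfer (auto simp: l2_eq_def sq_int_zero)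
  show "x - y = x + - y" by transfer (auto simp: l2_eq_def intro: sq_int_diff)
  show "a *\<^sub>R (x + y) = a *\<^sub>R x + a *\<^sub>R y"
    by transfer (auto simp: l2_eq_def distrib_left intro: sq_int_add sq_int_scale)
  show "(a + b) *\<^sub>R x = a *\<^sub>R x + b *\<^sub>R x"
    by transfer (auto simp: l2_eq_def distrib_right intro: sq_int_add sq_int_scale)
  show "a *\<^sub>R b *\<^sub>R x = (a * b) *\<^sub>R x"
    by transfer (auto simp: l2_eq_def mult.assoc intro: sq_int_scale)
  show "1 *\<^sub>R x = x" by transfer (auto simp: l2_eq_def)
  show "dist x y = norm (x - y)" by (rule dist_l2_def)
  show "sgn x = inverse (norm x) *\<^sub>R x" by (rule sgn_l2_def)
  show "uniformity = (INF e\<in>{0<..}. principal {(x, y). dist x (y::l2) < e})"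
    by (rule uniformity_l2_def)
  show "open U = (\<forall>x\<in>U. eventually (\<lambda>(x', y). x' = x \<longrightarrow> y \<in> U) uniformity)" for U :: "l2 set"
    by (rule open_l2_def)
  show "inner x y = inner y x" by transfer (simp add: mult.commute)
  show "inner (x + y) z = inner x z + inner y z"
    by transfer (auto simp: l2_eq_def distrib_right sq_int_mult)
  show "inner (a *\<^sub>R x) y = a * inner x y"
    by transfer (auto simp: l2_eq_def mult.assoc)
  show "0 \<le> inner x x" by transfer (simp add: l2_eq_def)
  show "(inner x x = 0) = (x = 0)"
  proof transfer
    fix f assume f: "l2_eq f f"
    then have "integrable lborel (\<lambda>t. f t * f t)" by (auto simp: l2_eq_def sq_int_mult)
    then have "(\<integral>t. f t * f t \<partial>lborel) = 0 \<longleftrightarrow> (AE t in lborel. f t * f t = 0)"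
      by (intro integral_nonneg_eq_0_iff_AE) auto
    then show "(\<integral>t. f t * f t \<partial>lborel) = 0 \<longleftrightarrow> l2_eq f (\<lambda>_. 0)"
      using f by (simp add: l2_eq_def sq_int_zero)
  qed
  show "norm x = sqrt (inner x x)" by (rule norm_l2_def)
qed

end

lemma sq_int_rep: "sq_int (rep_l2 x)"
  using Quotient3_rel_rep[OF Quotient3_l2] Quotient3_rep_reflp[OF Quotient3_l2, of x]
  by (auto simp: l2_eq_def)

lemma abs_rep_l2: "abs_l2 (rep_l2 x) = x"
  by (rule Quotient3_abs_rep[OF Quotient3_l2])

lemma abs_l2_eq_iff: "sq_int f \<Longrightarrow> sq_int g \<Longrightarrow> abs_l2 f = abs_l2 g \<longleftrightarrow> (AE t in lborel. f t = g t)"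
  using Quotient3_rel[OF Quotient3_l2, of f g] by (auto simp: l2_eq_def)

lemma rep_abs_l2: "sq_int f \<Longrightarrow> AE t in lborel. rep_l2 (abs_l2 f) t = f t"
  using abs_l2_eq_iff[OF sq_int_rep, of f "abs_l2 f"] abs_rep_l2 by simp

lemma inner_abs_l2: "sq_int f \<Longrightarrow> sq_int g \<Longrightarrow> inner (abs_l2 f) (abs_l2 g) = (\<integral>t. f t * g t \<partial>lborel)"
  by (rule inner_l2.abs_eq) (auto simp: l2_eq_def)

lemma inner_l2_rep: "inner x y = (\<integral>t. rep_l2 x t * rep_l2 y t \<partial>lborel)"
  using inner_abs_l2[OF sq_int_rep sq_int_rep, of x y] by (simp add: abs_rep_l2)

lemma minus_abs_l2: "sq_int f \<Longrightarrow> sq_int g \<Longrightarrow> abs_l2 f - abs_l2 g = abs_l2 (\<lambda>t. f t - g t)"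
  by (rule minus_l2.abs_eq) (auto simp: l2_eq_def)

lemma plus_abs_l2: "sq_int f \<Longrightarrow> sq_int g \<Longrightarrow> abs_l2 f + abs_l2 g = abs_l2 (\<lambda>t. f t + g t)"
  by (rule plus_l2.abs_eq) (auto simp: l2_eq_def)

lemma scaleR_abs_l2: "sq_int f \<Longrightarrow> c *\<^sub>R abs_l2 f = abs_l2 (\<lambda>t. c * f t)"
  by (rule scaleR_l2.abs_eq) (auto simp: l2_eq_def)

lemma norm_abs_l2: "sq_int f \<Longrightarrow> (norm (abs_l2 f))\<^sup>2 = (\<integral>t. (f t)\<^sup>2 \<partial>lborel)"
  by (simp only: power2_norm_eq_inner inner_abs_l2) (simp add: power2_eq_square)

lemma nn_integral_sq:
  "sq_int f \<Longrightarrow> (\<integral>\<^sup>+t. ennreal ((f t)\<^sup>2) \<partial>lborel) = ennreal ((norm (abs_l2 f))\<^sup>2)"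
  by (simp add: norm_abs_l2 nn_integral_eq_integral sq_int_def)

lemma sq_intI_nn:
  assumes "f \<in> borel_measurable lborel" "(\<integral>\<^sup>+t. ennreal ((f t)\<^sup>2) \<partial>lborel) < \<infinity>"
  shows "sq_int f"
  using assms unfolding sq_int_def by (auto intro!: integrableI_nonneg)

lemma l2_fast_Cauchy:
  fixes f :: "nat \<Rightarrow> real \<Rightarrow> real"
  assumes f: "\<And>k. sq_int (f k)"
    and fast: "\<And>j k. j \<le> k \<Longrightarrow> norm (abs_l2 (f k) - abs_l2 (f j)) \<le> (1/4)^j"
  shows "\<exists>g. sq_int g \<and> (\<lambda>k. abs_l2 (f k)) \<longlonglongrightarrow> abs_l2 g"
proof -
  have [measurable]: "f k \<in> borel_measurable lborel" for k using f by (simp add: sq_int_def)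
  let ?d = "\<lambda>k t. f (Suc k) t - f k t"
  have d: "sq_int (?d k)" for k by (intro sq_int_diff f)
  have nd: "(norm (abs_l2 (?d k)))\<^sup>2 \<le> ((1/4)^k)\<^sup>2" for k
    using fast[of k "Suc k"] by (intro power_mono) (auto simp: minus_abs_l2 f)
  have "(\<integral>\<^sup>+t. (\<Sum>k. ennreal (4^k * (?d k t)\<^sup>2)) \<partial>lborel)
      = (\<Sum>k. \<integral>\<^sup>+t. ennreal (4^k * (?d k t)\<^sup>2) \<partial>lborel)"
    by (intro nn_integral_suminf) auto
  also have "\<dots> = (\<Sum>k. ennreal (4^k * (norm (abs_l2 (?d k)))\<^sup>2))"
    by (simp add: ennreal_mult nn_integral_cmult nn_integral_sq[OF d])
  also have "\<dots> \<le> (\<Sum>k. ennreal ((1/4)^k))"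
  proof (intro suminf_le)
    fix k :: nat
    have "4^k * (norm (abs_l2 (?d k)))\<^sup>2 \<le> 4^k * ((1/4)^k)\<^sup>2"
      using nd[of k] by (intro mult_left_mono) auto
    also have "\<dots> = (1/4::real)^k"
      by (simp add: power2_eq_square power_divide)
    finally show "ennreal (4^k * (norm (abs_l2 (?d k)))\<^sup>2) \<le> ennreal ((1/4)^k)"
      by (rule ennreal_leI)
  qed auto
  also have "\<dots> = ennreal (\<Sum>k. (1/4)^k)"
    by (intro suminf_ennreal2) (auto intro: summable_geometric)
  also have "\<dots> < \<infinity>" by simp
  finally have "(\<integral>\<^sup>+t. (\<Sum>k. ennreal (4^k * (?d k t)\<^sup>2)) \<partial>lborel) \<noteq> \<infinity>" by simp
  then have "AE t in lborel. (\<Sum>k. ennreal (4^k * (?d k t)\<^sup>2)) \<noteq> \<infinity>"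
    by (intro nn_integral_PInf_AE) auto
  then have conv: "AE t in lborel. convergent (\<lambda>k. f k t)"
  proof eventually_elim
    case (elim t)
    have "summable (\<lambda>k. 4^k * (?d k t)\<^sup>2)"
      using elim by (intro summable_suminf_not_top) auto
    then have "(\<lambda>k. 4^k * (?d k t)\<^sup>2) \<longlonglongrightarrow> 0" by (rule summable_LIMSEQ_zero)
    then have "\<forall>\<^sub>F k in sequentially. 4^k * (?d k t)\<^sup>2 < 1"
      by (rule order_tendstoD) simp
    then have ev: "\<forall>\<^sub>F k in sequentially. norm (?d k t) \<le> (1/2)^k"
    proof eventually_elim
      case (elim k)
      have "(\<bar>?d k t\<bar> * 2^k)\<^sup>2 = 4^k * (?d k t)\<^sup>2"
        by (simp add: power_mult_distrib power_even_eq[symmetric] flip: power_mult)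
           (simp add: power_mult mult.commute[of k 2])
      then have "(\<bar>?d k t\<bar> * 2^k)\<^sup>2 \<le> 1\<^sup>2" using elim by simp
      then have "\<bar>?d k t\<bar> * 2^k \<le> 1" by (rule power2_le_imp_le) simp
      then show ?case by (simp add: power_divide field_simps)
    qed
    have "summable (\<lambda>k. ?d k t)"
      by (rule summable_comparison_test_ev[OF ev]) (auto intro: summable_geometric)
    then have "convergent (\<lambda>n. \<Sum>k<n. ?d k t)" by (simp add: summable_iff_convergent)
    then have "convergent (\<lambda>n. f n t - f 0 t)" by (simp only: sum_lessThan_telescope[of "\<lambda>k. f k t"])
    then show ?case by (simp only: convergent_diff_const_right_iff)
  qed
  define g where "g t = lim (\<lambda>k. f k t)" for t
  have [measurable]: "g \<in> borel_measurable lborel" unfolding g_def by measurable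
  have lim: "AE t in lborel. (\<lambda>k. f k t) \<longlonglongrightarrow> g t"
    using conv by eventually_elim (simp add: g_def convergent_LIMSEQ_iff)
  have fatou: "(\<integral>\<^sup>+t. ennreal ((g t - f j t)\<^sup>2) \<partial>lborel) \<le> ennreal (((1/4)^j)\<^sup>2)" for j
  proof -
    have "(\<integral>\<^sup>+t. ennreal ((g t - f j t)\<^sup>2) \<partial>lborel)
        = (\<integral>\<^sup>+t. liminf (\<lambda>k. ennreal ((f k t - f j t)\<^sup>2)) \<partial>lborel)"
    proof (rule nn_integral_cong_AE)
      show "AE t in lborel. ennreal ((g t - f j t)\<^sup>2) = liminf (\<lambda>k. ennreal ((f k t - f j t)\<^sup>2))"
        using lim
      proof eventually_elim
        case (elim t)
        then have "(\<lambda>k. ennreal ((f k t - f j t)\<^sup>2)) \<longlonglongrightarrow> ennreal ((g t - f j t)\<^sup>2)"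
          by (intro tendsto_intros)
        from lim_imp_Liminf[OF _ this] show ?case by simp
      qed
    qed
    also have "\<dots> \<le> liminf (\<lambda>k. \<integral>\<^sup>+t. ennreal ((f k t - f j t)\<^sup>2) \<partial>lborel)"
      by (rule nn_integral_liminf) auto
    also have "\<dots> \<le> ennreal (((1/4)^j)\<^sup>2)"
    proof (rule Liminf_le)
      show "\<forall>\<^sub>F k in sequentially. (\<integral>\<^sup>+t. ennreal ((f k t - f j t)\<^sup>2) \<partial>lborel) \<le> ennreal (((1/4)^j)\<^sup>2)"
        using eventually_ge_at_top[of j]
      proof eventually_elim
        case (elim k)
        have "(norm (abs_l2 (\<lambda>t. f k t - f j t)))\<^sup>2 \<le> ((1/4)^j)\<^sup>2"
          using fast[OF elim] by (intro power_mono) (auto simp: minus_abs_l2 f)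
        then show ?case
          by (subst nn_integral_sq) (auto intro: sq_int_diff f ennreal_leI)
      qed
    qed simp
    finally show ?thesis .
  qed
  have gf: "sq_int (\<lambda>t. g t - f j t)" for j
    by (rule sq_intI_nn) (use fatou[of j] in \<open>auto simp: less_top[symmetric] top_unique\<close>)
  have g: "sq_int g" using sq_int_add[OF gf[of 0] f[of 0]] by simp
  have "norm (abs_l2 (f j) - abs_l2 g) \<le> (1/4)^j" for j
  proof -
    have "ennreal ((norm (abs_l2 (\<lambda>t. g t - f j t)))\<^sup>2) \<le> ennreal (((1/4)^j)\<^sup>2)"
      using fatou[of j] by (simp only: nn_integral_sq[OF gf])
    then have "norm (abs_l2 (\<lambda>t. g t - f j t)) \<le> (1/4)^j"
      by (subst (asm) ennreal_le_iff) (auto intro: power2_le_imp_le)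
    then show ?thesis by (simp add: minus_abs_l2[symmetric] f g norm_minus_commute)
  qed
  then have "(\<lambda>j. abs_l2 (f j) - abs_l2 g) \<longlonglongrightarrow> 0"
    by (intro Lim_null_comparison[OF _ LIMSEQ_power_zero[of "1/4::real"]]) auto
  then show ?thesis using g LIM_zero_iff by blast
qed

instance l2 :: complete_space
proof
  fix X :: "nat \<Rightarrow> l2" assume X: "Cauchy X"
  have "\<exists>n. \<forall>j\<ge>n. \<forall>k\<ge>n. norm (X j - X k) < (1/4)^m" for m
    using X[unfolded Cauchy_def, rule_format, of "(1/4)^m"] by (auto simp: dist_norm)
  then obtain n where n: "\<And>m j k. j \<ge> n m \<Longrightarrow> k \<ge> n m \<Longrightarrow> norm (X j - X k) < (1/4)^m"
    by metis
  define r where "r m = m + (\<Sum>i\<le>m. n i)" for m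
  have r: "strict_mono r" unfolding strict_mono_Suc_iff r_def by simp
  have rn: "n m \<le> r k" if "m \<le> k" for m k
  proof -
    have "n m \<le> (\<Sum>i\<le>k. n i)" using that by (intro member_le_sum) auto
    then show ?thesis by (simp add: r_def)
  qed
  have "\<exists>g. sq_int g \<and> (\<lambda>k. abs_l2 (rep_l2 (X (r k)))) \<longlonglongrightarrow> abs_l2 g"
  proof (rule l2_fast_Cauchy)
    show "norm (abs_l2 (rep_l2 (X (r k))) - abs_l2 (rep_l2 (X (r j)))) \<le> (1/4)^j" if "j \<le> k" for j k
      using n[OF rn[OF that] rn[OF order_refl]] by (simp add: abs_rep_l2)
  qed (rule sq_int_rep)
  then obtain g where "(X \<circ> r) \<longlonglongrightarrow> abs_l2 g" by (auto simp: abs_rep_l2 comp_def)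
  then have "X \<longlonglongrightarrow> abs_l2 g"
    using Cauchy_converges_subseq X r by blast
  then show "convergent X" by (auto simp: convergent_def)
qed


lemma l2_dominated_convergence:
  assumes h: "sq_int h" and [measurable]: "g \<in> borel_measurable lborel"
    and f [measurable]: "\<And>k. f k \<in> borel_measurable lborel"
    and lim: "AE t in lborel. (\<lambda>k. f k t) \<longlonglongrightarrow> g t"
    and bd: "\<And>k. AE t in lborel. \<bar>f k t\<bar> \<le> h t"
  shows "sq_int g" "\<And>k. sq_int (f k)" "(\<lambda>k. abs_l2 (f k)) \<longlonglongrightarrow> abs_l2 g"
proof -
  have [measurable]: "h \<in> borel_measurable lborel" and h2: "integrable lborel (\<lambda>t. (h t)\<^sup>2)"
    using h by (auto simp: sq_int_def)
  have bdd: "AE t in lborel. \<forall>k. \<bar>f k t\<bar> \<le> h t" using bd by (simp add: AE_all_countable)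
  have bg: "AE t in lborel. \<bar>g t\<bar> \<le> h t"
    using lim bdd
  proof eventually_elim
    case (elim t)
    have "(\<lambda>k. \<bar>f k t\<bar>) \<longlonglongrightarrow> \<bar>g t\<bar>" using elim by (intro tendsto_intros)
    then show ?case using elim by (intro LIMSEQ_le_const2) auto
  qed
  have sqb: "sq_int u" if [measurable]: "u \<in> borel_measurable lborel" and "AE t in lborel. \<bar>u t\<bar> \<le> h t" for u
    unfolding sq_int_def
  proof
    show "integrable lborel (\<lambda>t. (u t)\<^sup>2)"
    proof (rule Bochner_Integration.integrable_bound[OF h2])
      show "AE t in lborel. norm ((u t)\<^sup>2) \<le> norm ((h t)\<^sup>2)"
        using that(2)
      proof eventually_elim
        case (elim t)
        then have "\<bar>u t\<bar> \<le> \<bar>h t\<bar>" by linarith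
        then show ?case by (simp only: abs_le_square_iff) simp
      qed
    qed simp
  qed simp
  show g: "sq_int g" by (rule sqb[OF _ bg]) simp
  show fk: "sq_int (f k)" for k by (rule sqb[OF _ bd]) simp
  have "(\<lambda>k. \<integral>t. (f k t - g t)\<^sup>2 \<partial>lborel) \<longlonglongrightarrow> (\<integral>t. 0 \<partial>(lborel :: real measure))"
  proof (rule integral_dominated_convergence[where w = "\<lambda>t. 4 * (h t)\<^sup>2"])
    show "AE t in lborel. (\<lambda>k. (f k t - g t)\<^sup>2) \<longlonglongrightarrow> 0"
      using lim
    proof eventually_elim
      case (elim t)
      then have "(\<lambda>k. (f k t - g t)\<^sup>2) \<longlonglongrightarrow> (g t - g t)\<^sup>2" by (intro tendsto_intros)
      then show ?case by simp
    qed
    show "AE t in lborel. norm ((f k t - g t)\<^sup>2) \<le> 4 * (h t)\<^sup>2" for k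
      using bd[of k] bg
    proof eventually_elim
      case (elim t)
      then have "\<bar>f k t - g t\<bar> \<le> \<bar>2 * h t\<bar>" by linarith
      then have "(f k t - g t)\<^sup>2 \<le> (2 * h t)\<^sup>2" by (simp only: abs_le_square_iff)
      then show ?case by (simp add: power_mult_distrib)
    qed
    show "integrable lborel (\<lambda>t. 4 * (h t)\<^sup>2)" using h2 by (rule integrable_mult_right)
  qed measurable
  moreover have "(\<integral>t. (f k t - g t)\<^sup>2 \<partial>lborel) = (norm (abs_l2 (f k) - abs_l2 g))\<^sup>2" for k
    by (simp only: minus_abs_l2[OF fk g] norm_abs_l2[OF sq_int_diff[OF fk g]])
  ultimately have "(\<lambda>k. (norm (abs_l2 (f k) - abs_l2 g))\<^sup>2) \<longlonglongrightarrow> 0"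
    by (simp only: integral_zero)
  then have "(\<lambda>k. sqrt ((norm (abs_l2 (f k) - abs_l2 g))\<^sup>2)) \<longlonglongrightarrow> sqrt 0"
    by (rule tendsto_real_sqrt)
  then have "(\<lambda>k. norm (abs_l2 (f k) - abs_l2 g)) \<longlonglongrightarrow> 0"
    by (simp only: real_sqrt_abs abs_norm_cancel real_sqrt_zero)
  then have "(\<lambda>k. abs_l2 (f k) - abs_l2 g) \<longlonglongrightarrow> 0" by (rule tendsto_norm_zero_cancel)
  then show "(\<lambda>k. abs_l2 (f k)) \<longlonglongrightarrow> abs_l2 g" by (rule LIM_zero_cancel)
qed

lemma sq_int_indicator:
  assumes [measurable]: "A \<in> sets borel" and "A \<subseteq> {a<..b::real}" shows "sq_int (indicator A)"
  unfolding sq_int_def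
proof
  have "emeasure lborel A \<le> emeasure lborel {a..b}" using assms by (intro emeasure_mono) auto
  also have "\<dots> < \<infinity>" by (simp add: emeasure_lborel_Icc_eq)
  finally have "integrable lborel (indicator A :: real \<Rightarrow> real)"
    by (intro integrable_real_indicator) auto
  moreover have "(\<lambda>t. (indicator A t)\<^sup>2) = (indicator A :: real \<Rightarrow> real)"
    by (auto simp: indicator_def)
  ultimately show "integrable lborel (\<lambda>t. (indicator A t :: real)\<^sup>2)" by simp
qed simp

lemma l2_ex_countable_dense: "\<exists>Q :: l2 set. countable Q \<and> closure Q = UNIV"
proof -
  define e where "e n b = abs_l2 (indicator {- real n<..b})" for n :: nat and b :: real
  define s where "s = (\<lambda>xs. \<Sum>(q, n, b)\<leftarrow>xs. of_rat q *\<^sub>R e n (of_rat b))"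
  define Q where "Q = range s"
  have cQ: "countable Q" unfolding Q_def by simp
  have Qadd: "x + y \<in> Q" if "x \<in> Q" "y \<in> Q" for x y
  proof -
    from that obtain xs ys where "x = s xs" "y = s ys" unfolding Q_def by blast
    then have "x + y = s (xs @ ys)" by (simp add: s_def)
    then show ?thesis by (simp add: Q_def)
  qed
  have Qscale: "of_rat q *\<^sub>R x \<in> Q" if "x \<in> Q" for q x
  proof -
    from that obtain xs where x: "x = s xs" unfolding Q_def by blast
    have "of_rat q *\<^sub>R s xs = s (map (\<lambda>(r, n, b). (q * r, n, b)) xs)"
      by (induction xs) (auto simp: s_def scaleR_add_right of_rat_mult)
    then show ?thesis by (simp add: Q_def x)
  qed
  let ?V = "closure Q"
  have add: "x + y \<in> ?V" if xy: "x \<in> ?V" "y \<in> ?V" for x y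
  proof -
    obtain f g where "\<And>n. f n \<in> Q" "f \<longlonglongrightarrow> x" "\<And>n. g n \<in> Q" "g \<longlonglongrightarrow> y"
      using xy unfolding closure_sequential by blast
    then have "(\<lambda>n. f n + g n) \<longlonglongrightarrow> x + y" "\<forall>n. f n + g n \<in> Q"
      by (auto intro: tendsto_add Qadd)
    then show ?thesis unfolding closure_sequential by (intro exI[of _ "\<lambda>n. f n + g n"]) simp
  qed
  have scale: "c *\<^sub>R x \<in> ?V" if x: "x \<in> ?V" for c x
  proof -
    obtain f where f: "\<And>n. f n \<in> Q" "f \<longlonglongrightarrow> x" using x unfolding closure_sequential by blast
    have "\<exists>q. \<bar>of_rat q - c\<bar> < 1 / real (Suc n)" for n
      using of_rat_dense[of c "c + 1 / real (Suc n)"] by (auto simp: abs_if) (smt (verit))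
    then obtain q where q: "\<And>n. \<bar>of_rat (q n) - c\<bar> < 1 / real (Suc n)" by metis
    have "(\<lambda>n. of_rat (q n) - c) \<longlonglongrightarrow> 0"
      by (rule Lim_null_comparison[OF _ LIMSEQ_inverse_real_of_nat])
         (use q in \<open>auto intro!: always_eventually less_imp_le simp: inverse_eq_divide\<close>)
    then have "(\<lambda>n. of_rat (q n)) \<longlonglongrightarrow> c" by (rule LIM_zero_cancel)
    then have "(\<lambda>n. of_rat (q n) *\<^sub>R f n) \<longlonglongrightarrow> c *\<^sub>R x" using f by (intro tendsto_intros)
    moreover have "of_rat (q n) *\<^sub>R f n \<in> Q" for n by (rule Qscale) (rule f)
    ultimately show ?thesis unfolding closure_sequential
      by (intro exI[of _ "\<lambda>n. of_rat (q n) *\<^sub>R f n"]) simp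
  qed
  have diff: "x - y \<in> ?V" if "x \<in> ?V" "y \<in> ?V" for x y
    using add[OF that(1) scale[OF that(2), of "-1"]] by simp
  have "s [] \<in> Q" unfolding Q_def by blast
  then have zero: "0 \<in> ?V" using closure_subset by (auto simp: s_def)
  have lim: "x \<in> ?V" if "\<And>n. f n \<in> ?V" "f \<longlonglongrightarrow> x" for f x
    using that closed_sequentially[OF closed_closure] by blast
  have sqI: "sq_int (indicator (B \<inter> {- real n<..real n}))" if "B \<in> sets borel" for B n
    by (rule sq_int_indicator[of _ "- real n" "real n"]) (use that in auto)
  have e_rat: "e n (of_rat b) \<in> ?V" for n b
  proof -
    have "s [(1, n, b)] \<in> Q" unfolding Q_def by blast
    then show ?thesis using closure_subset by (auto simp: s_def)
  qed
  have e_real: "e n b \<in> ?V" for n b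
  proof -
    have "\<exists>q. b < of_rat q \<and> of_rat q < b + 1 / real (Suc k)" for k
      using of_rat_dense[of b "b + 1 / real (Suc k)"] by auto
    then obtain q where q: "\<And>k. b < of_rat (q k)" "\<And>k. of_rat (q k) < b + 1 / real (Suc k)"
      by metis
    have ql: "(\<lambda>k. of_rat (q k)) \<longlonglongrightarrow> b"
    proof (rule tendsto_sandwich[where f = "\<lambda>_. b"])
      show "(\<lambda>k. b + 1 / real (Suc k)) \<longlonglongrightarrow> b"
        using tendsto_add[OF tendsto_const LIMSEQ_inverse_real_of_nat, of b] by (simp add: inverse_eq_divide)
    qed (use q in \<open>auto intro!: always_eventually less_imp_le simp del: of_nat_Suc\<close>)
    have q1: "of_rat (q k) \<le> b + 1" for k
    proof -
      have "1 / real (Suc k) \<le> 1" by simp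
      then show ?thesis using q(2)[of k] by linarith
    qed
    have "(\<lambda>k. e n (of_rat (q k))) \<longlonglongrightarrow> e n b" unfolding e_def
    proof (rule l2_dominated_convergence(3)[where h = "indicator {- real n<..b + 1}"])
      show "sq_int (indicator {- real n<..b + 1})" by (rule sq_int_indicator) auto
      show "AE t in lborel. \<bar>indicator {- real n<..of_rat (q k)} t\<bar> \<le> (indicator {- real n<..b + 1} t :: real)" for k
        using q1[of k] by (auto simp: indicator_def)
      show "AE t in lborel. (\<lambda>k. indicator {- real n<..of_rat (q k)} t) \<longlonglongrightarrow> (indicator {- real n<..b} t :: real)"
      proof (rule AE_I2)
        fix t :: real
        show "(\<lambda>k. indicator {- real n<..of_rat (q k)} t) \<longlonglongrightarrow> (indicator {- real n<..b} t :: real)"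
        proof (cases "t \<le> b")
          case True
          then have "indicator {- real n<..of_rat (q k)} t = (indicator {- real n<..b} t :: real)" for k
            using q(1)[of k] by (auto simp: indicator_def)
          then show ?thesis by simp
        next
          case False
          then have "\<forall>\<^sub>F k in sequentially. of_rat (q k) < t" by (intro order_tendstoD[OF ql]) simp
          then have "\<forall>\<^sub>F k in sequentially. indicator {- real n<..of_rat (q k)} t = (indicator {- real n<..b} t :: real)"
            by eventually_elim (use False in \<open>auto simp: indicator_def\<close>)
          then show ?thesis by (rule tendsto_eventually)
        qed
      qed
    qed auto
    from lim[OF e_rat this] show ?thesis .
  qed
  have empty0: "abs_l2 (\<lambda>_. 0) = 0" by (simp add: zero_l2_def)
  have ind: "abs_l2 (indicator (B \<inter> {- real n<..real n})) \<in> ?V" if B: "B \<in> sets borel" for B n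
  proof -
    let ?I = "{- real n<..real n}"
    have "Int_stable (range (\<lambda>a::real. {..a}))" by (auto simp: Int_stable_def)
    moreover have "range (\<lambda>a::real. {..a}) \<subseteq> Pow UNIV" by simp
    moreover have "B \<in> sigma_sets UNIV (range (\<lambda>a::real. {..a}))"
      using B by (simp add: borel_eq_atMost)
    ultimately show ?thesis
    proof (induction rule: sigma_sets_induct_disjoint)
      case (basic A)
      then obtain a where A: "A = {..a}" by auto
      have "A \<inter> ?I = {- real n<..min a (real n)}" by (auto simp: A)
      then show ?case using e_real[of n "min a (real n)"] by (simp add: e_def)
    next
      case empty
      show ?case using zero empty0 by simp
    next
      case (compl A)
      then have [measurable]: "A \<in> sets borel" by (simp add: borel_eq_atMost)
      have "abs_l2 (indicator ((UNIV - A) \<inter> ?I))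
          = abs_l2 (indicator (UNIV \<inter> ?I)) - abs_l2 (indicator (A \<inter> ?I))"
        by (subst minus_abs_l2[OF sqI sqI]) (auto intro!: arg_cong[of _ _ abs_l2] simp: indicator_def)
      moreover have "abs_l2 (indicator (UNIV \<inter> ?I)) \<in> ?V" using e_real[of n "real n"] by (simp add: e_def)
      ultimately show ?case using compl diff by simp
    next
      case (union A)
      then have mA [measurable]: "A i \<in> sets borel" for i by (auto simp: borel_eq_atMost)
      have part: "abs_l2 (indicator ((\<Union>i<k. A i) \<inter> ?I)) \<in> ?V" for k
      proof (induction k)
        case 0
        show ?case using zero empty0 by simp
      next
        case (Suc k)
        have "A i \<inter> A k = {}" if "i < k" for i
          using union(1) that by (intro disjoint_family_onD[where I = UNIV]) auto
        then have dj: "x \<notin> A k" if "x \<in> A i" "i < k" for x i using that by blast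
        have "abs_l2 (indicator ((\<Union>i<Suc k. A i) \<inter> ?I))
            = abs_l2 (indicator ((\<Union>i<k. A i) \<inter> ?I)) + abs_l2 (indicator (A k \<inter> ?I))"
          by (subst plus_abs_l2[OF sqI sqI]) (auto intro!: arg_cong[of _ _ abs_l2] simp: indicator_def lessThan_Suc fun_eq_iff dest: dj)
        then show ?case using Suc union add by simp
      qed
      have "(\<lambda>k. abs_l2 (indicator ((\<Union>i<k. A i) \<inter> ?I))) \<longlonglongrightarrow> abs_l2 (indicator ((\<Union>i. A i) \<inter> ?I))"
      proof (rule l2_dominated_convergence(3)[where h = "indicator (UNIV \<inter> ?I)"])
        show "sq_int (indicator (UNIV \<inter> ?I))" by (rule sqI) simp
        show "AE t in lborel. (\<lambda>k. indicator ((\<Union>i<k. A i) \<inter> ?I) t) \<longlonglongrightarrow> (indicator ((\<Union>i. A i) \<inter> ?I) t :: real)"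
        proof (rule AE_I2)
          fix t :: real
          show "(\<lambda>k. indicator ((\<Union>i<k. A i) \<inter> ?I) t) \<longlonglongrightarrow> (indicator ((\<Union>i. A i) \<inter> ?I) t :: real)"
          proof (cases "\<exists>i. t \<in> A i")
            case True
            then obtain i where i: "t \<in> A i" by blast
            have "\<forall>\<^sub>F k in sequentially. indicator ((\<Union>i<k. A i) \<inter> ?I) t = (indicator ((\<Union>i. A i) \<inter> ?I) t :: real)"
              using eventually_gt_at_top[of i] by eventually_elim (use i in \<open>auto simp: indicator_def\<close>)
            then show ?thesis by (rule tendsto_eventually)
          next
            case False
            then show ?thesis by (simp add: indicator_def)
          qed
        qed
        show "AE t in lborel. \<bar>indicator ((\<Union>i<k. A i) \<inter> ?I) t\<bar> \<le> (indicator (UNIV \<inter> ?I) t :: real)" for k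
          by (rule AE_I2) (auto simp: indicator_def)
      qed measurable
      from lim[OF part this] show ?case .
    qed
  qed
  have "x \<in> ?V" for x
  proof -
    define f where "f = rep_l2 x"
    have f: "sq_int f" "x = abs_l2 f" by (auto simp: f_def sq_int_rep abs_rep_l2)
    then have [measurable]: "f \<in> borel_measurable borel" by (simp add: sq_int_def)
    have "f \<in> borel_measurable borel" by measurable
    from borel_measurable_implies_sequence_metric[OF this, of 0]
    obtain F where "\<forall>i. simple_function borel (F i)" "\<forall>t\<in>space borel. (\<lambda>i. F i t) \<longlonglongrightarrow> f t"
      "\<forall>i. \<forall>t\<in>space borel. dist (F i t) 0 \<le> 2 * dist (f t) 0"
      by (elim exE conjE)
    then have F: "\<And>i. simple_function borel (F i)" "\<And>t. (\<lambda>i. F i t) \<longlonglongrightarrow> f t"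
      "\<And>i t. dist (F i t) 0 \<le> 2 * dist (f t) 0" by simp_all
    let ?G = "\<lambda>i t. F i t * indicator {- real i<..real i} t"
    have [measurable]: "F i \<in> borel_measurable borel" for i using F by (intro borel_measurable_simple_function)
    have conv: "(\<lambda>i. abs_l2 (?G i)) \<longlonglongrightarrow> abs_l2 f"
    proof (rule l2_dominated_convergence(3)[where h = "\<lambda>t. 2 * \<bar>f t\<bar>"])
      show "sq_int (\<lambda>t. 2 * \<bar>f t\<bar>)" using f(1) by (auto simp: sq_int_def power_mult_distrib)
      show "AE t in lborel. \<bar>?G i t\<bar> \<le> 2 * \<bar>f t\<bar>" for i
      proof (rule AE_I2)
        fix t show "\<bar>?G i t\<bar> \<le> 2 * \<bar>f t\<bar>"
          using F(3)[of i t] by (cases "t \<in> {- real i<..real i}") simp_all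
      qed
      show "AE t in lborel. (\<lambda>i. ?G i t) \<longlonglongrightarrow> f t"
      proof (rule AE_I2)
        fix t :: real
        obtain m where m: "\<bar>t\<bar> < real m" using reals_Archimedean2 by blast
        have "\<forall>\<^sub>F i in sequentially. F i t = ?G i t"
          using eventually_ge_at_top[of m] by eventually_elim (use m in \<open>auto simp: indicator_def\<close>)
        then show "(\<lambda>i. ?G i t) \<longlonglongrightarrow> f t" by (rule Lim_transform_eventually[OF F(2)])
      qed
    qed measurable
    have "abs_l2 (?G i) \<in> ?V" for i
    proof -
      let ?I = "{- real i<..real i}"
      have fin: "finite (range (F i))" using F(1)[of i] by (auto simp: simple_function_def)
      define u :: "real \<Rightarrow> real \<Rightarrow> real" where "u y = indicator (F i -` {y} \<inter> ?I)" for y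
      have "F i -` {y} \<in> sets borel" for y
        using measurable_sets_borel[of "F i" borel "{y}"] by simp
      then have u: "sq_int (u y)" "abs_l2 (u y) \<in> ?V" for y
        unfolding u_def by (auto intro: sqI ind)
      have sum: "sq_int (\<lambda>t. \<Sum>y\<in>R. y * u y t) \<and> abs_l2 (\<lambda>t. \<Sum>y\<in>R. y * u y t) \<in> ?V"
        if "finite R" for R
        using that
      proof (induction R)
        case empty
        then show ?case using zero empty0 by (simp add: sq_int_zero)
      next
        case (insert y R)
        have y: "sq_int (\<lambda>t. y * u y t)" by (rule sq_int_scale[OF u(1)])
        have "abs_l2 (\<lambda>t. y * u y t) \<in> ?V"
          using scale[OF u(2)] by (simp add: scaleR_abs_l2[OF u(1)])
        then have "abs_l2 (\<lambda>t. y * u y t + (\<Sum>y\<in>R. y * u y t)) \<in> ?V"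
          using insert.IH y by (simp add: add flip: plus_abs_l2)
        then show ?case using insert y by (simp add: sq_int_add)
      qed
      have "?G i = (\<lambda>t. \<Sum>y\<in>range (F i). y * u y t)"
      proof
        fix t
        have "(\<Sum>y\<in>range (F i). y * u y t)
            = (\<Sum>y\<in>range (F i). if y = F i t then F i t * indicator ?I t else 0)"
          by (intro sum.cong) (auto simp: indicator_def u_def)
        then show "?G i t = (\<Sum>y\<in>range (F i). y * u y t)"
          using fin by simp
      qed
      then show ?thesis using sum[OF fin] by simp
    qed
    from lim[OF this conv] show ?thesis by (simp add: f)
  qed
  then have "?V = UNIV" by blast
  then show ?thesis using cQ by (intro exI[of _ Q] conjI)
qed

instance l2 :: second_countable_topology
proof
  obtain Q :: "l2 set" where Q: "countable Q" "closure Q = UNIV" using l2_ex_countable_dense by blast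
  define B where "B = (\<lambda>(x, n). ball x (1 / real (Suc n))) ` (Q \<times> UNIV)"
  have "topological_basis B"
  proof (rule topological_basisI)
    show "open U" if "U \<in> B" for U using that by (auto simp: B_def)
    fix U and x :: l2 assume "open U" "x \<in> U"
    then obtain r where r: "r > 0" "ball x r \<subseteq> U" by (auto simp: open_contains_ball)
    obtain n where n: "1 / real (Suc n) < r / 2" by (rule nat_approx_posE[of "r/2"]) (use r in auto)
    have "x \<in> closure Q" using Q by simp
    then obtain y where y: "y \<in> Q" "dist y x < 1 / real (Suc n)"
      unfolding closure_approachable by (meson of_nat_0_less_iff zero_less_Suc zero_less_divide_1_iff)
    have "ball y (1 / real (Suc n)) \<subseteq> U"
    proof
      fix z assume z: "z \<in> ball y (1 / real (Suc n))"
      have "dist x z \<le> dist y x + dist y z" by (metis dist_commute dist_triangle)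
      then have "z \<in> ball x r" using z y n by simp
      then show "z \<in> U" using r by blast
    qed
    then show "\<exists>B'\<in>B. x \<in> B' \<and> B' \<subseteq> U"
      using y by (intro bexI[of _ "ball y (1 / real (Suc n))"]) (auto simp: B_def)
  qed
  moreover have "countable B" unfolding B_def using Q by auto
  ultimately show "\<exists>B::l2 set set. countable B \<and> open = generate_topology B"
    by (intro exI[of _ B] conjI topological_basis_imp_subbasis)
qed


text \<open>
  The Hilbert space of square integrable functions on \<open>T\<close> is identified with the closed subspace
  of those elements of \<open>l2\<close> that vanish almost everywhere outside \<open>T\<close>; on it the inner product
  of \<open>l2\<close> is the integral over \<open>T\<close>.
\<close>

definition l2_on :: "real set \<Rightarrow> l2 set" where
  "l2_on T = {x. AE t in lborel. t \<notin> T \<longrightarrow> rep_l2 x t = 0}"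


text \<open>
  Second derivatives are taken in the Sobolev sense: \<open>x\<close> has a representative \<open>h\<close> that is
  differentiable on the whole interval and whose derivative \<open>h'\<close> is absolutely continuous, namely
  the indefinite integral of the square integrable function \<open>g\<close>. For \<open>c < d\<close> such a \<open>g\<close> is
  unique as an element of \<open>l2\<close>.
\<close>

definition has_second_deriv :: "real \<Rightarrow> real \<Rightarrow> l2 \<Rightarrow> l2 \<Rightarrow> bool" where
  "has_second_deriv c d x g \<longleftrightarrow> x \<in> l2_on {c..d} \<and> g \<in> l2_on {c..d} \<and>
     (\<exists>h h'. (AE t in lborel. t \<in> {c..d} \<longrightarrow> rep_l2 x t = h t) \<and>
        (\<forall>t\<in>{c..d}. (h has_real_derivative h' t) (at t within {c..d})) \<and>
        (\<forall>t\<in>{c..d}. h' t = h' c + (LINT s:{c..t}|lborel. rep_l2 g s)))"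

definition sobolev2 :: "real \<Rightarrow> real \<Rightarrow> l2 set" where
  "sobolev2 c d = {x. \<exists>g. has_second_deriv c d x g}"

definition second_deriv :: "real \<Rightarrow> real \<Rightarrow> l2 \<Rightarrow> l2" where
  "second_deriv c d x = (THE g. has_second_deriv c d x g)"

definition roughness :: "real \<Rightarrow> real \<Rightarrow> l2 \<Rightarrow> l2 \<Rightarrow> real" where
  "roughness c d x y = inner (second_deriv c d x) (second_deriv c d y)"


definition tensor_sq :: "'h::real_inner \<Rightarrow> 'h \<Rightarrow> 'h" where
  "tensor_sq x f = inner f x *\<^sub>R x"

text \<open>
  The covariance operator of a centered random element, \<open>f \<mapsto> E (\<langle>f, X\<rangle> X)\<close>.
\<close>

definition cov_op :: "'w measure \<Rightarrow> ('w \<Rightarrow> l2) \<Rightarrow> l2 \<Rightarrow> l2" where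
  "cov_op M X f = (\<integral>\<omega>. tensor_sq (X \<omega>) f \<partial>M)"

definition sample_mean :: "nat \<Rightarrow> (nat \<Rightarrow> l2) \<Rightarrow> l2" where
  "sample_mean N x = (1 / real N) *\<^sub>R (\<Sum>n=1..N. x n)"

definition sample_cov_op :: "nat \<Rightarrow> (nat \<Rightarrow> l2) \<Rightarrow> l2 \<Rightarrow> l2" where
  "sample_cov_op N x f =
     (1 / real N) *\<^sub>R (\<Sum>n=1..N. tensor_sq (x n) f) - tensor_sq (sample_mean N x) f"

text \<open>
  \<open>Z\<close> is a version of the Hilbert space valued conditional expectation of \<open>X\<close> given \<open>F\<close>
  (the library has conditional expectations of real random variables only).
\<close>

definition is_cond_exp ::
    "'w measure \<Rightarrow> 'w measure \<Rightarrow> ('w \<Rightarrow> l2) \<Rightarrow> ('w \<Rightarrow> l2) \<Rightarrow> bool" where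
  "is_cond_exp M F X Z \<longleftrightarrow> Z \<in> borel_measurable F \<and> integrable M Z \<and>
     (\<forall>A\<in>sets F. (LINT \<omega>:A|M. Z \<omega>) = (LINT \<omega>:A|M. X \<omega>))"


definition continuous_operator_on :: "l2 set \<Rightarrow> (l2 \<Rightarrow> l2) \<Rightarrow> bool" where
  "continuous_operator_on V A \<longleftrightarrow> (\<forall>f\<in>V. A f \<in> V) \<and>
     (\<forall>f\<in>V. \<forall>g\<in>V. A (f + g) = A f + A g) \<and>
     (\<forall>r. \<forall>f\<in>V. A (r *\<^sub>R f) = r *\<^sub>R A f) \<and> continuous_on V A"

definition op_norm_on :: "l2 set \<Rightarrow> (l2 \<Rightarrow> l2) \<Rightarrow> real" where
  "op_norm_on V A = (SUP f\<in>{f \<in> V. norm f \<le> 1}. norm (A f))"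


text \<open>
  The predicates below are not assumed to define measurable events, so probabilities are bounded
  from below through measurable subevents. For measurable events and random variables these are
  the usual notions.
\<close>

definition with_prob_to_1 :: "'w measure \<Rightarrow> (nat \<Rightarrow> 'w \<Rightarrow> bool) \<Rightarrow> bool" where
  "with_prob_to_1 M P \<longleftrightarrow> (\<exists>E. (\<forall>N. E N \<in> sets M) \<and> (\<forall>N. \<forall>\<omega>\<in>E N. P N \<omega>) \<and>
     (\<lambda>N. measure M (E N)) \<longlonglongrightarrow> 1)"

definition tends_in_prob :: "'w measure \<Rightarrow> (nat \<Rightarrow> 'w \<Rightarrow> real) \<Rightarrow> real \<Rightarrow> bool" where
  "tends_in_prob M Z l \<longleftrightarrow> (\<forall>e>0. with_prob_to_1 M (\<lambda>N \<omega>. \<bar>Z N \<omega> - l\<bar> < e))"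

definition bigo_in_prob :: "'w measure \<Rightarrow> (nat \<Rightarrow> 'w \<Rightarrow> real) \<Rightarrow> (nat \<Rightarrow> real) \<Rightarrow> bool" where
  "bigo_in_prob M Z r \<longleftrightarrow> (\<forall>e>0. \<exists>K. \<forall>\<^sub>F N in sequentially.
     \<exists>E\<in>sets M. measure M E \<ge> 1 - e \<and> (\<forall>\<omega>\<in>E. \<bar>Z N \<omega>\<bar> \<le> K * r N))"


definition penalized_quotient ::
    "real \<Rightarrow> real \<Rightarrow> (l2 \<Rightarrow> l2) \<Rightarrow> (l2 \<Rightarrow> l2) \<Rightarrow> real \<Rightarrow> l2 \<Rightarrow> real" where
  "penalized_quotient c d GE GX \<alpha> a =
     inner (GE a) a / (inner (GX a) a + \<alpha> * roughness c d a a)"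

text \<open>
  Division by zero yields \<open>0\<close> in HOL, so that the quotient is well defined at every nonzero vector
  of \<open>sobolev2 c d\<close> is made part of the assertion that it has a maximum there.
\<close>

definition is_max_point ::
    "real \<Rightarrow> real \<Rightarrow> (l2 \<Rightarrow> l2) \<Rightarrow> (l2 \<Rightarrow> l2) \<Rightarrow> real \<Rightarrow> l2 \<Rightarrow> bool" where
  "is_max_point c d GE GX \<alpha> a \<longleftrightarrow>
     (\<forall>b\<in>sobolev2 c d. b \<noteq> 0 \<longrightarrow> inner (GX b) b + \<alpha> * roughness c d b b \<noteq> 0) \<and>
     a \<in> sobolev2 c d \<and> a \<noteq> 0 \<and>
     (\<forall>b\<in>sobolev2 c d. b \<noteq> 0 \<longrightarrow>
        penalized_quotient c d GE GX \<alpha> b \<le> penalized_quotient c d GE GX \<alpha> a)"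

end

theory Submission
  imports Defs "HOL-Complex_Analysis.Great_Picard"
begin

text \<open>
  Write \<open>Q g = \<langle>\<Gamma>X g, g\<rangle> + \<alpha> [g, g]\<close>. By (A3) with parameter \<open>1\<close>, \<open>Q g\<close> is at least a constant times
  \<open>\<alpha> \<parallel>g\<parallel>\<^sup>2\<close> as soon as \<open>\<alpha> \<le> 1\<close>, so by (A4), (A5) and the \<open>\<surd>N\<close> rate of the empirical covariance the
  forms of both estimated operators differ from the true ones by at most \<open>\<theta> Q\<close> with probability
  tending to \<open>1\<close>, for every \<open>\<theta> > 0\<close>. On that event the penalised denominator is coercive, so the
  compactness of the embedding of the Sobolev space into \<open>l2\<close> yields a maximiser \<open>b\<close>; comparing \<open>b\<close>
  with \<open>a 1\<close> gives \<open>\<langle>\<Gamma>E b, b\<rangle> \<ge> m \<langle>\<Gamma>X b, b\<rangle>\<close> with \<open>m\<close> close to \<open>lam 1\<close>, and the spectral gap (A6)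
  forces the component of \<open>b\<close> that is \<open>\<Gamma>X\<close>-orthogonal to \<open>a 1\<close> to be small.
\<close>

section \<open>The space of square integrable functions\<close>

text \<open>The eigenvalues of \<open>\<Gamma>X\<close> accumulate at 0, so an operator norm error
  of order 1/sqrt N is not dominated by the form of \<open>\<Gamma>X\<close> alone. The penalty
  restores a lower bound at the price of a factor \<alpha>; the relative error is then of order
  1/(sqrt N \<alpha>), which the growth condition in (A5) sends to 0, while \<alpha> tending to 0
  brings the denominator at \<open>a 1\<close> back to 1. Only quadratic forms are compared, so the
  unbounded inverse of \<open>\<Gamma>X\<close> is never formed. As \<open>a 1\<close> is an
  eigenvector, both true forms split without cross terms along \<open>a 1\<close> and its
  \<Gamma>X-orthogonal complement. This gives the explicit bound (\<open>lam 1\<close> - m)/(m -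
  \<open>lam 2\<close>) for the squared \<Gamma>X-distance of a normalised maximiser from
  \<open>a 1\<close>, where m is continuous in \<theta> and equals \<open>lam 1\<close> at \<theta>
  = 0. The same inequality shows that a maximiser is never \<Gamma>X-orthogonal to
  \<open>a 1\<close>, so the normalisation is possible. On the good event the estimate is
  deterministic and holds for every normalised maximiser, so no measurable selection is
  made.\<close>

lemma rep_l2_measurable [measurable]: "rep_l2 x \<in> borel_measurable borel"
  using sq_int_rep[of x] by (simp add: sq_int_def)

lemma rep_l2_add: "AE t in lborel. rep_l2 (x + y) t = rep_l2 x t + rep_l2 y t"
  using rep_abs_l2[OF sq_int_add[OF sq_int_rep sq_int_rep], of x y]
  by (simp only: plus_abs_l2[OF sq_int_rep sq_int_rep, symmetric] abs_rep_l2)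

lemma rep_l2_scaleR: "AE t in lborel. rep_l2 (r *\<^sub>R x) t = r * rep_l2 x t"
  using rep_abs_l2[OF sq_int_scale[OF sq_int_rep], of r x]
  by (simp only: scaleR_abs_l2[OF sq_int_rep, symmetric] abs_rep_l2)

lemma rep_l2_zero: "AE t in lborel. rep_l2 0 t = 0"
  using rep_abs_l2[OF sq_int_zero] by (simp add: zero_l2_def)

lemma subspace_l2_on: "subspace (l2_on T)"
proof (rule subspaceI)
  show "0 \<in> l2_on T" using rep_l2_zero by (auto simp: l2_on_def)
next
  fix x y assume "x \<in> l2_on T" "y \<in> l2_on T"
  then show "x + y \<in> l2_on T"
    using rep_l2_add[of x y] unfolding l2_on_def mem_Collect_eq by eventually_elim auto
next
  fix r x assume "x \<in> l2_on T"
  then show "r *\<^sub>R x \<in> l2_on T"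
    using rep_l2_scaleR[of r x] unfolding l2_on_def mem_Collect_eq by eventually_elim auto
qed

text \<open>The part \<open>f\<close> of the limit outside \<open>T\<close> is orthogonal to all of
  \<open>l2_on T\<close>. By continuity it is orthogonal to the limit \<open>l\<close> too, and that
  inner product is the integral of the square of \<open>l\<close> outside \<open>T\<close>.\<close>

lemma closed_l2_on:
  assumes [measurable]: "T \<in> sets borel"
  shows "closed (l2_on T)"
  unfolding closed_sequential_limits
proof (intro allI impI, elim conjE)
  fix x l assume x: "\<forall>n. x n \<in> l2_on T" and l: "x \<longlonglongrightarrow> l"
  define f where "f t = indicator (- T) t * rep_l2 l t" for t
  have f: "sq_int f"
    unfolding sq_int_def
  proof
    show "f \<in> borel_measurable lborel" unfolding f_def by measurable
    show "integrable lborel (\<lambda>t. (f t)\<^sup>2)"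
    proof (rule Bochner_Integration.integrable_bound)
      show "integrable lborel (\<lambda>t. (rep_l2 l t)\<^sup>2)" using sq_int_rep by (simp add: sq_int_def)
    qed (auto simp: f_def indicator_def)
  qed
  have ortho: "inner y (abs_l2 f) = (\<integral>t. rep_l2 y t * f t \<partial>lborel)" for y
    using inner_abs_l2[OF sq_int_rep f, of y] by (simp add: abs_rep_l2)
  have "inner (x n) (abs_l2 f) = 0" for n
  proof -
    have "AE t in lborel. rep_l2 (x n) t * f t = 0"
      using x unfolding l2_on_def by (auto simp: f_def indicator_def elim!: allE[of _ n])
    then show ?thesis unfolding ortho by (rule integral_eq_zero_AE)
  qed
  moreover have "(\<lambda>n. inner (x n) (abs_l2 f)) \<longlonglongrightarrow> inner l (abs_l2 f)"
    using l by (intro tendsto_intros)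
  ultimately have "inner l (abs_l2 f) = 0" by (simp add: LIMSEQ_const_iff)
  then have "(\<integral>t. rep_l2 l t * f t \<partial>lborel) = 0" by (simp add: ortho)
  then have "AE t in lborel. rep_l2 l t * f t = 0"
    using sq_int_mult[OF sq_int_rep f]
    by (subst (asm) integral_nonneg_eq_0_iff_AE) (auto simp: f_def indicator_def)
  then show "l \<in> l2_on T" unfolding l2_on_def mem_Collect_eq
    by eventually_elim (auto simp: f_def indicator_def split: if_splits)
qed

text \<open>\<open>ennreal\<close> sends negative numbers to 0, so the densities built from
  \<open>f\<close> and from its negative are the positive and the negative part of \<open>f\<close>.
  The hypothesis makes these two finite measures agree on all half-lines, hence everywhere; equal
  positive and negative parts force \<open>f\<close> to vanish. The factor \<open>r\<close> in the
  auxiliary facts treats both signs at once.\<close>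

lemma AE_eq_0_if_integral_greaterThan_eq_0:
  fixes f :: "real \<Rightarrow> real"
  assumes f: "integrable lborel f" and eq: "\<And>x. (LINT s:{x<..}|lborel. f s) = 0"
  shows "AE x in lborel. f x = 0"
proof -
  have [measurable]: "f \<in> borel_measurable borel" using f by auto
  have fin: "integrable lborel (\<lambda>s. indicator {x<..} s * max 0 (r * f s))" for x r
    using integrable_mult_indicator[of "{x<..}" lborel, OF _ integrable_max[OF integrable_zero integrable_mult_right[OF f, of r]]]
    by simp
  have em: "emeasure (density lborel (\<lambda>s. ennreal (r * f s))) {x<..}
      = ennreal (\<integral>s. indicator {x<..} s * max 0 (r * f s) \<partial>lborel)" for x r
  proof -
    have "emeasure (density lborel (\<lambda>s. ennreal (r * f s))) {x<..}
      = (\<integral>\<^sup>+ s. ennreal (indicator {x<..} s * max 0 (r * f s)) \<partial>lborel)"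
      by (subst emeasure_density) (auto intro!: nn_integral_cong simp: indicator_def max_def ennreal_neg)
    also have "\<dots> = ennreal (\<integral>s. indicator {x<..} s * max 0 (r * f s) \<partial>lborel)"
      by (rule nn_integral_eq_integral[OF fin]) auto
    finally show ?thesis .
  qed
  have "density lborel (\<lambda>s. ennreal (1 * f s)) = density lborel (\<lambda>s. ennreal (- 1 * f s))"
  proof (rule measure_eqI_lessThan)
    fix x
    have "(\<integral>s. indicator {x<..} s * max 0 (1 * f s) \<partial>lborel) - (\<integral>s. indicator {x<..} s * max 0 (- 1 * f s) \<partial>lborel)
        = (\<integral>s. indicator {x<..} s * max 0 (1 * f s) - indicator {x<..} s * max 0 (- 1 * f s) \<partial>lborel)"
      by (rule Bochner_Integration.integral_diff[symmetric]) (rule fin)+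
    also have "\<dots> = (LINT s:{x<..}|lborel. f s)"
      unfolding set_lebesgue_integral_def by (rule Bochner_Integration.integral_cong) (auto simp: indicator_def max_def)
    finally show "emeasure (density lborel (\<lambda>s. ennreal (1 * f s))) {x<..} = emeasure (density lborel (\<lambda>s. ennreal (- 1 * f s))) {x<..}"
      unfolding em using eq[of x] by simp
  next
    show "emeasure (density lborel (\<lambda>s. ennreal (1 * f s))) {x<..} < \<infinity>" for x
      unfolding em by simp
  qed auto
  then have "AE s in lborel. ennreal (1 * f s) = ennreal (- 1 * f s)"
    by (intro sigma_finite_measure.density_unique[OF sigma_finite_lborel]) auto
  then show ?thesis
  proof eventually_elim
    case (elim s)
    then show ?case by (cases "0 \<le> f s") (auto simp: ennreal_neg)
  qed
qed

text \<open>Integrals over \<open>{c..t}\<close> become inner products with this vector, so the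
  identity that ties \<open>h'\<close> to \<open>g\<close> is visibly linear and continuous in
  \<open>g\<close>.\<close>

definition interval_l2 :: "real \<Rightarrow> real \<Rightarrow> l2" where
  "interval_l2 c t = abs_l2 (indicator {c..t})"

lemma sq_int_interval: "sq_int (indicator {c..t::real})"
  by (rule sq_int_indicator[where a = "c - 1" and b = t]) auto

lemma set_integral_rep_l2: "(LINT s:{c..t}|lborel. rep_l2 g s) = inner g (interval_l2 c t)"
  using inner_abs_l2[OF sq_int_rep sq_int_interval, of g c t]
  by (simp add: abs_rep_l2 interval_l2_def set_lebesgue_integral_def mult.commute)

lemma norm_interval_l2: "c \<le> t \<Longrightarrow> norm (interval_l2 c t) = sqrt (t - c)"
proof -
  assume "c \<le> t"
  have "(norm (interval_l2 c t))\<^sup>2 = (\<integral>s. (indicator {c..t} s)\<^sup>2 \<partial>lborel)"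
    unfolding interval_l2_def by (rule norm_abs_l2[OF sq_int_interval])
  also have "(\<lambda>s. (indicator {c..t} s)\<^sup>2) = (indicator {c..t} :: real \<Rightarrow> real)"
    by (auto simp: indicator_def)
  finally have "(norm (interval_l2 c t))\<^sup>2 = t - c" using \<open>c \<le> t\<close> by simp
  then show ?thesis by (metis norm_ge_zero real_sqrt_abs abs_of_nonneg)
qed

text \<open>The hypothesis says that the primitive of \<open>g\<close> vanishes on the interval, and
  every tail integral is a difference of two values of that primitive.\<close>

lemma l2_on_eq_0_if_orthogonal_intervals:
  assumes g: "g \<in> l2_on {c..d}" and ortho: "\<And>t. t \<in> {c..d} \<Longrightarrow> inner g (interval_l2 c t) = 0" and "c < d"
  shows "g = 0"
proof -
  have "AE t in lborel. indicator {c..d} t * rep_l2 g t = rep_l2 g t"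
    using g unfolding l2_on_def mem_Collect_eq by eventually_elim (auto simp: indicator_def)
  moreover have int: "integrable lborel (\<lambda>t. indicator {c..d} t * rep_l2 g t)"
    by (rule sq_int_mult[OF sq_int_interval sq_int_rep])
  have I: "integrable lborel (\<lambda>s. indicator {a..b} s * rep_l2 g s)" for a b
    by (rule sq_int_mult[OF sq_int_interval sq_int_rep])
  have "(LINT s:{x<..}|lborel. indicator {c..d} s * rep_l2 g s) = 0" for x
  proof (cases "x < c")
    case True
    then have "(LINT s:{x<..}|lborel. indicator {c..d} s * rep_l2 g s) = (LINT s:{c..d}|lborel. rep_l2 g s)"
      unfolding set_lebesgue_integral_def by (intro Bochner_Integration.integral_cong) (auto simp: indicator_def)
    then show ?thesis using ortho[of d] \<open>c < d\<close> by (simp add: set_integral_rep_l2)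
  next
    case False
    \<comment> \<open>Cutting at \<open>min x d\<close> also covers \<open>x \<ge> d\<close>, where
      the tail is empty and the two integrals coincide.\<close>
    have "(LINT s:{x<..}|lborel. indicator {c..d} s * rep_l2 g s)
        = (\<integral>s. indicator {c..d} s * rep_l2 g s - indicator {c..min x d} s * rep_l2 g s \<partial>lborel)"
      unfolding set_lebesgue_integral_def using False
      by (intro Bochner_Integration.integral_cong) (auto simp: indicator_def)
    also have "\<dots> = (LINT s:{c..d}|lborel. rep_l2 g s) - (LINT s:{c..min x d}|lborel. rep_l2 g s)"
      unfolding set_lebesgue_integral_def by (simp add: I)
    finally show ?thesis using ortho[of d] ortho[of "min x d"] False \<open>c < d\<close> by (simp add: set_integral_rep_l2)
  qed
  from AE_eq_0_if_integral_greaterThan_eq_0[OF int this]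
  have "AE t in lborel. indicator {c..d} t * rep_l2 g t = 0" .
  ultimately have "AE t in lborel. rep_l2 g t = 0" by eventually_elim simp
  then have "abs_l2 (rep_l2 g) = abs_l2 (\<lambda>_. 0)"
    by (subst abs_l2_eq_iff) (auto simp: sq_int_rep sq_int_zero)
  then show ?thesis by (simp add: abs_rep_l2 zero_l2_def)
qed

section \<open>Second derivatives: closedness and compactness\<close>

text \<open>
  This replaces weak compactness of balls: elements of nearly minimal norm over shrinking
  neighbourhoods of \<open>x0\<close> form a Cauchy sequence by the parallelogram law.
\<close>

lemma closed_convex_weak_limit:
  fixes G :: "('a::real_normed_vector \<times> 'b::{real_inner, complete_space}) set"
  assumes "convex G" "closed G" and G: "\<And>n. (x n, g n) \<in> G"
    and x: "x \<longlonglongrightarrow> x0" and g: "\<And>n::nat. norm (g n) \<le> R"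
  shows "\<exists>g0. (x0, g0) \<in> G \<and> norm g0 \<le> R"
proof -
  define e where "e m = 1 / real (Suc m)" for m
  have e0: "e m > 0" for m by (simp add: e_def)
  have e: "e \<longlonglongrightarrow> 0" unfolding e_def using LIMSEQ_inverse_real_of_nat by (simp add: inverse_eq_divide)
  \<comment> \<open>\<open>C m\<close> collects the second components of the points of
    \<open>G\<close> whose first component is within \<open>e m\<close> of \<open>x0\<close>. The
    sets decrease, so the infima \<open>\<delta> m\<close> of the norm increase; they stay below
    \<open>R\<close>.\<close>
  define C where "C m = {z. \<exists>y. (y, z) \<in> G \<and> norm (y - x0) \<le> e m}" for m
  define \<delta> where "\<delta> m = Inf (norm ` C m)" for m
  have C_anti: "C n \<subseteq> C m" if "m \<le> n" for m n
    using that unfolding C_def e_def by (fastforce simp: frac_le intro: order_trans)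
  have C_mem: "\<exists>k. g k \<in> C m" for m
  proof -
    have "\<forall>\<^sub>F k in sequentially. dist (x k) x0 < e m" using x e0 by (rule tendstoD)
    then obtain k where "dist (x k) x0 < e m" by (auto simp: eventually_sequentially)
    then show ?thesis using G unfolding C_def by (auto simp: dist_norm intro!: exI[of _ k] exI[of _ "x k"])
  qed
  have bdd: "bdd_below (norm ` C m)" for m by (rule bdd_belowI[of _ 0]) auto
  have ne: "norm ` C m \<noteq> {}" for m using C_mem by blast
  have \<delta>_le: "\<delta> m \<le> norm z" if "z \<in> C m" for m z
    unfolding \<delta>_def using that by (intro cInf_lower bdd) auto
  have \<delta>R: "\<delta> m \<le> R" for m using C_mem[of m] \<delta>_le[of _ m] g order_trans by blast
  have \<delta>0: "0 \<le> \<delta> m" for m unfolding \<delta>_def by (rule cInf_greatest[OF ne]) auto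
  have "incseq \<delta>"
    unfolding incseq_def \<delta>_def using C_anti by (auto intro!: cInf_superset_mono[OF ne bdd])
  then obtain D where D: "\<delta> \<longlonglongrightarrow> D" using incseq_convergent[of \<delta> R] \<delta>R by blast
  have "\<exists>z\<in>C m. norm z < \<delta> m + e m" for m
    using cInf_lessD[OF ne, of m "\<delta> m + e m"] e0 unfolding \<delta>_def by auto
  then obtain z where zC: "\<And>m. z m \<in> C m" and z: "\<And>m. norm (z m) < \<delta> m + e m" by metis
  have C_mid: "(1/2) *\<^sub>R (u + v) \<in> C m" if uv: "u \<in> C m" "v \<in> C m" for m u v
  proof -
    obtain p q where p: "(p, u) \<in> G" "norm (p - x0) \<le> e m" and q: "(q, v) \<in> G" "norm (q - x0) \<le> e m"
      using uv unfolding C_def by blast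
    have "(1/2) *\<^sub>R (p, u) + (1/2) *\<^sub>R (q, v) \<in> G"
      using \<open>convex G\<close> p q unfolding convex_def by (metis field_sum_of_halves half_gt_zero less_eq_real_def zero_less_one)
    moreover have "norm ((1/2) *\<^sub>R (p + q) - x0) \<le> e m"
    proof -
      have "(1/2) *\<^sub>R (p + q) - x0 = (1/2) *\<^sub>R ((p - x0) + (q - x0))"
        by (simp add: algebra_simps flip: scaleR_2)
      then have "norm ((1/2) *\<^sub>R (p + q) - x0) = (1/2) * norm ((p - x0) + (q - x0))" by simp
      also have "\<dots> \<le> e m" using norm_triangle_ineq[of "p - x0" "q - x0"] p q by simp
      finally show ?thesis .
    qed
    ultimately show ?thesis unfolding C_def by (auto simp: scaleR_add_right)
  qed
  \<comment> \<open>By convexity the midpoint of \<open>z m\<close> and \<open>z n\<close> lies in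
    \<open>C m\<close>, so its norm is at least \<open>\<delta> m\<close>; this is the subtracted
    term of the parallelogram law.\<close>
  have par: "(norm (z m - z n))\<^sup>2 \<le> 2 * (\<delta> m + e m)\<^sup>2 + 2 * (\<delta> n + e n)\<^sup>2 - 4 * (\<delta> m)\<^sup>2" if "m \<le> n" for m n
  proof -
    have "z n \<in> C m" using zC C_anti[OF that] by blast
    then have "\<delta> m \<le> norm ((1/2) *\<^sub>R (z m + z n))" by (intro \<delta>_le C_mid zC)
    then have "(2 * \<delta> m)\<^sup>2 \<le> (norm (z m + z n))\<^sup>2" using \<delta>0[of m] by (intro power_mono) auto
    moreover have "(norm (z m - z n))\<^sup>2 = 2 * (norm (z m))\<^sup>2 + 2 * (norm (z n))\<^sup>2 - (norm (z m + z n))\<^sup>2"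
      by (simp add: power2_norm_eq_inner inner_simps inner_commute)
    moreover have "(norm (z m))\<^sup>2 \<le> (\<delta> m + e m)\<^sup>2" "(norm (z n))\<^sup>2 \<le> (\<delta> n + e n)\<^sup>2"
      using z[of m] z[of n] by (auto intro!: power_mono)
    ultimately show ?thesis by (simp add: power_mult_distrib)
  qed
  have s1: "(\<lambda>m. (\<delta> m + e m)\<^sup>2) \<longlonglongrightarrow> D\<^sup>2" using tendsto_power[OF tendsto_add[OF D e], of 2] by simp
  have s2: "(\<lambda>m. (\<delta> m)\<^sup>2) \<longlonglongrightarrow> D\<^sup>2" using tendsto_power[OF D] .
  have "Cauchy z"
  proof (rule CauchyI')
    fix \<epsilon> :: real assume "\<epsilon> > 0"
    \<comment> \<open>All squares in \<open>par\<close> tend to the square of \<open>D\<close>, and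
      there its right-hand side is 2 + 2 - 4 = 0 times that square. The tolerance is an eighth
      because the coefficients 2, 2 and 4 add up to 8.\<close>
    then have "\<epsilon>\<^sup>2/8 > 0" by simp
    from tendstoD[OF s1 this] tendstoD[OF s2 this]
    have "\<forall>\<^sub>F m in sequentially. \<bar>(\<delta> m + e m)\<^sup>2 - D\<^sup>2\<bar> < \<epsilon>\<^sup>2/8 \<and> \<bar>(\<delta> m)\<^sup>2 - D\<^sup>2\<bar> < \<epsilon>\<^sup>2/8"
      by eventually_elim (simp add: dist_real_def)
    then obtain K where K: "\<And>m. m \<ge> K \<Longrightarrow> \<bar>(\<delta> m + e m)\<^sup>2 - D\<^sup>2\<bar> < \<epsilon>\<^sup>2/8 \<and> \<bar>(\<delta> m)\<^sup>2 - D\<^sup>2\<bar> < \<epsilon>\<^sup>2/8"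
      by (auto simp: eventually_sequentially)
    have "dist (z m) (z n) < \<epsilon>" if "K \<le> m" "m < n" for m n
    proof -
      have "(norm (z m - z n))\<^sup>2 < \<epsilon>\<^sup>2"
        using par[of m n] K[of m] K[of n] that by linarith
      then show ?thesis using \<open>\<epsilon> > 0\<close> by (auto simp: dist_norm intro: power2_less_imp_less)
    qed
    then show "\<exists>K. \<forall>m\<ge>K. \<forall>n>m. dist (z m) (z n) < \<epsilon>" by blast
  qed
  then obtain g0 where g0: "z \<longlonglongrightarrow> g0" using Cauchy_convergent convergent_def by blast
  obtain y where y: "\<And>m. (y m, z m) \<in> G" "\<And>m. norm (y m - x0) \<le> e m"
    using zC unfolding C_def by simp metis
  have "(\<lambda>m. y m - x0) \<longlonglongrightarrow> 0"
    by (rule Lim_null_comparison[OF _ e]) (use y in auto)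
  then have "y \<longlonglongrightarrow> x0" by (rule LIM_zero_cancel)
  then have "(\<lambda>m. (y m, z m)) \<longlonglongrightarrow> (x0, g0)" using g0 by (rule tendsto_Pair)
  with y(1) have "(x0, g0) \<in> G" by (rule closed_sequentially[OF \<open>closed G\<close>])
  moreover have "norm g0 \<le> R"
  proof (rule LIMSEQ_le)
    show "(\<lambda>m. norm (z m)) \<longlonglongrightarrow> norm g0" using g0 by (rule tendsto_norm)
    show "(\<lambda>m. R + e m) \<longlonglongrightarrow> R" using tendsto_add[OF tendsto_const e] by simp
    show "\<exists>N. \<forall>m\<ge>N. norm (z m) \<le> R + e m"
      using z \<delta>R by (intro exI[of _ 0] allI impI) (meson add_right_mono less_imp_le order_trans)
  qed
  ultimately show ?thesis by blast
qed

section \<open>Second derivatives as a linear relation\<close>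

text \<open>Naming the witnesses \<open>h\<close> and \<open>h'\<close> lets sums, multiples,
  differences and limits act on them together with \<open>x\<close> and \<open>g\<close>.\<close>

definition second_deriv_rep ::
    "real \<Rightarrow> real \<Rightarrow> l2 \<Rightarrow> l2 \<Rightarrow> (real \<Rightarrow> real) \<Rightarrow> (real \<Rightarrow> real) \<Rightarrow> bool" where
  "second_deriv_rep c d x g h h' \<longleftrightarrow>
     (AE t in lborel. t \<in> {c..d} \<longrightarrow> rep_l2 x t = h t) \<and>
     (\<forall>t\<in>{c..d}. (h has_real_derivative h' t) (at t within {c..d})) \<and>
     (\<forall>t\<in>{c..d}. h' t = h' c + inner g (interval_l2 c t))"

lemma has_second_deriv_iff:
  "has_second_deriv c d x g \<longleftrightarrow>
     x \<in> l2_on {c..d} \<and> g \<in> l2_on {c..d} \<and> (\<exists>h h'. second_deriv_rep c d x g h h')"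
  by (simp add: has_second_deriv_def second_deriv_rep_def set_integral_rep_l2)

lemma second_deriv_repD:
  assumes "second_deriv_rep c d x g h h'"
  shows "AE t in lborel. t \<in> {c..d} \<longrightarrow> rep_l2 x t = h t"
    and "t \<in> {c..d} \<Longrightarrow> (h has_real_derivative h' t) (at t within {c..d})"
    and "t \<in> {c..d} \<Longrightarrow> h' t = h' c + inner g (interval_l2 c t)"
  using assms unfolding second_deriv_rep_def by blast+

lemma second_deriv_rep_add:
  assumes "second_deriv_rep c d x g h h'" "second_deriv_rep c d y k l l'"
  shows "second_deriv_rep c d (x + y) (g + k) (\<lambda>t. h t + l t) (\<lambda>t. h' t + l' t)"
  unfolding second_deriv_rep_def
proof (intro conjI ballI)
  show "AE t in lborel. t \<in> {c..d} \<longrightarrow> rep_l2 (x + y) t = h t + l t"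
    using rep_l2_add[of x y] second_deriv_repD(1)[OF assms(1)] second_deriv_repD(1)[OF assms(2)]
    by eventually_elim simp
next
  fix t assume t: "t \<in> {c..d}"
  show "((\<lambda>t. h t + l t) has_real_derivative h' t + l' t) (at t within {c..d})"
    using second_deriv_repD(2)[OF assms(1) t] second_deriv_repD(2)[OF assms(2) t] by (rule DERIV_add)
  have "h' t = h' c + inner g (interval_l2 c t)" "l' t = l' c + inner k (interval_l2 c t)"
    using second_deriv_repD(3)[OF assms(1) t] second_deriv_repD(3)[OF assms(2) t] .
  then show "h' t + l' t = h' c + l' c + inner (g + k) (interval_l2 c t)"
    by (simp add: inner_add_left)
qed

lemma second_deriv_rep_scaleR:
  assumes "second_deriv_rep c d x g h h'"
  shows "second_deriv_rep c d (r *\<^sub>R x) (r *\<^sub>R g) (\<lambda>t. r * h t) (\<lambda>t. r * h' t)"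
  unfolding second_deriv_rep_def
proof (intro conjI ballI)
  show "AE t in lborel. t \<in> {c..d} \<longrightarrow> rep_l2 (r *\<^sub>R x) t = r * h t"
    using rep_l2_scaleR[of r x] second_deriv_repD(1)[OF assms]
    by eventually_elim simp
next
  fix t assume t: "t \<in> {c..d}"
  show "((\<lambda>t. r * h t) has_real_derivative r * h' t) (at t within {c..d})"
    using second_deriv_repD(2)[OF assms t] by (rule DERIV_cmult)
  have "h' t = h' c + inner g (interval_l2 c t)"
    by (rule second_deriv_repD(3)[OF assms t])
  then show "r * h' t = r * h' c + inner (r *\<^sub>R g) (interval_l2 c t)"
    by (simp add: distrib_left)
qed

lemma second_deriv_rep_diff:
  assumes "second_deriv_rep c d x g h h'" "second_deriv_rep c d y k l l'"
  shows "second_deriv_rep c d (x - y) (g - k) (\<lambda>t. h t - l t) (\<lambda>t. h' t - l' t)"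
  using second_deriv_rep_add[OF assms(1) second_deriv_rep_scaleR[OF assms(2), of "-1"]] by simp

lemma second_deriv_rep_continuous_on:
  assumes "second_deriv_rep c d x g h h'"
  shows "continuous_on {c..d} h"
  by (rule DERIV_continuous_on[OF second_deriv_repD(2)[OF assms]])

lemma has_second_deriv_add:
  "has_second_deriv c d x g \<Longrightarrow> has_second_deriv c d y k \<Longrightarrow> has_second_deriv c d (x + y) (g + k)"
  unfolding has_second_deriv_iff using subspace_add[OF subspace_l2_on] second_deriv_rep_add by blast

lemma has_second_deriv_scaleR:
  "has_second_deriv c d x g \<Longrightarrow> has_second_deriv c d (r *\<^sub>R x) (r *\<^sub>R g)"
  unfolding has_second_deriv_iff using subspace_scale[OF subspace_l2_on] second_deriv_rep_scaleR by blast

lemma has_second_deriv_diff: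
  "has_second_deriv c d x g \<Longrightarrow> has_second_deriv c d y k \<Longrightarrow> has_second_deriv c d (x - y) (g - k)"
  using has_second_deriv_add[OF _ has_second_deriv_scaleR, of c d x g y k "-1"] by simp

lemma has_second_deriv_zero: "has_second_deriv c d 0 0"
proof -
  have "second_deriv_rep c d 0 0 (\<lambda>_. 0) (\<lambda>_. 0)"
    unfolding second_deriv_rep_def
  proof (intro conjI ballI)
    show "AE t in lborel. t \<in> {c..d} \<longrightarrow> rep_l2 0 t = 0"
      using rep_l2_zero by eventually_elim auto
  qed auto
  then show ?thesis unfolding has_second_deriv_iff using subspace_0[OF subspace_l2_on] by blast
qed

section \<open>Point values controlled by norms\<close>

lemma norm_l2_ge_on_interval:
  assumes "a \<le> b" and h: "AE t in lborel. t \<in> {a..b} \<longrightarrow> rep_l2 x t = h t"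
    and B: "0 \<le> B" "\<And>t. t \<in> {a..b} \<Longrightarrow> B \<le> \<bar>h t\<bar>"
  shows "(b - a) * B\<^sup>2 \<le> (norm x)\<^sup>2"
proof -
  have "(b - a) * B\<^sup>2 = (\<integral>t. indicator {a..b} t * B\<^sup>2 \<partial>lborel)" using \<open>a \<le> b\<close> by simp
  also have "\<dots> \<le> (\<integral>t. (rep_l2 x t)\<^sup>2 \<partial>lborel)"
  proof (rule integral_mono_AE)
    show "integrable lborel (\<lambda>t. indicator {a..b} t * B\<^sup>2)"
      by (intro integrable_mult_left integrable_real_indicator) (auto simp: emeasure_lborel_Icc_eq)
    show "integrable lborel (\<lambda>t. (rep_l2 x t)\<^sup>2)" using sq_int_rep by (simp add: sq_int_def)
    show "AE t in lborel. indicator {a..b} t * B\<^sup>2 \<le> (rep_l2 x t)\<^sup>2"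
      using h
    proof eventually_elim
      case (elim t)
      show ?case
      proof (cases "t \<in> {a..b}")
        case True
        then have "B\<^sup>2 \<le> \<bar>h t\<bar>\<^sup>2" using B by (intro power_mono) auto
        then show ?thesis using True elim by simp
      qed simp
    qed
  qed
  also have "\<dots> = (norm x)\<^sup>2" using norm_abs_l2[OF sq_int_rep, of x] by (simp add: abs_rep_l2)
  finally show ?thesis .
qed

text \<open>The continuous function |h| attains its minimum, and a constant lower bound for |h|
  bounds the norm from below by that constant times the root of the length.\<close>

lemma small_value_on_interval:
  assumes "a < b" and h: "AE t in lborel. t \<in> {a..b} \<longrightarrow> rep_l2 x t = h t"
    and cont: "continuous_on {a..b} h"
  shows "\<exists>t\<in>{a..b}. \<bar>h t\<bar> \<le> norm x / sqrt (b - a)"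
proof -
  have "continuous_on {a..b} (\<lambda>t. \<bar>h t\<bar>)" using cont by (intro continuous_intros)
  then obtain t0 where t0: "t0 \<in> {a..b}" "\<And>t. t \<in> {a..b} \<Longrightarrow> \<bar>h t0\<bar> \<le> \<bar>h t\<bar>"
    using continuous_attains_inf[of "{a..b}" "\<lambda>t. \<bar>h t\<bar>"] \<open>a < b\<close> by auto
  have "(b - a) * \<bar>h t0\<bar>\<^sup>2 \<le> (norm x)\<^sup>2"
    using \<open>a < b\<close> t0 by (intro norm_l2_ge_on_interval[OF _ h]) auto
  then have "(sqrt (b - a) * \<bar>h t0\<bar>)\<^sup>2 \<le> (norm x)\<^sup>2" using \<open>a < b\<close> by (simp add: power_mult_distrib)
  then have "sqrt (b - a) * \<bar>h t0\<bar> \<le> norm x" by (rule power2_le_imp_le) simp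
  then have "\<bar>h t0\<bar> \<le> norm x / sqrt (b - a)" using \<open>a < b\<close> by (simp add: field_simps)
  with t0(1) show ?thesis by blast
qed

text \<open>
  A function of small norm is small at some point of each of the two outer thirds of the interval;
  the mean value theorem then bounds the derivative at some point between them, and hence
  everywhere, since the derivative varies by at most a multiple of \<open>norm g\<close>.
\<close>

lemma second_deriv_rep_bound:
  assumes "c < d"
  shows "\<exists>C\<ge>0. \<forall>x g h h'. second_deriv_rep c d x g h h' \<longrightarrow>
    (\<forall>t\<in>{c..d}. \<bar>h t\<bar> \<le> C * (norm x + norm g) \<and> \<bar>h' t\<bar> \<le> C * (norm x + norm g))"
proof -
  \<comment> \<open>\<open>k\<close> converts the norm of \<open>x\<close> into a value at one point
    of a third of length \<open>l\<close>. In \<open>m\<close>, the term \<open>2 * k / l\<close>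
    bounds the difference quotient between two such points at distance at least \<open>l\<close>,
    and \<open>2 * sqrt (3 * l)\<close> pays for two Cauchy-Schwarz estimates, at \<open>t\<close>
    and at \<open>\<xi>\<close>. The summand \<open>3 * l * m\<close> of \<open>C\<close> is the
    derivative bound times the length of the interval.\<close>
  define l where "l = (d - c) / 3"
  have l: "l > 0" "d - c = 3 * l" using assms by (auto simp: l_def)
  define k where "k = 1 / sqrt l"
  define m where "m = 2 * k / l + 2 * sqrt (3 * l)"
  define C where "C = k + m + 3 * l * m"
  have km: "k > 0" "m > 0" using l by (auto simp: k_def m_def add_pos_pos)
  show ?thesis
  proof (intro exI[of _ C] conjI allI impI)
    show "C \<ge> 0" using km l by (simp add: C_def)
    fix x g h h' assume rep: "second_deriv_rep c d x g h h'"
    have ae: "AE t in lborel. t \<in> {c..d} \<longrightarrow> rep_l2 x t = h t"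
      and der: "\<And>t. t \<in> {c..d} \<Longrightarrow> (h has_real_derivative h' t) (at t within {c..d})"
      and h': "\<And>t. t \<in> {c..d} \<Longrightarrow> h' t = h' c + inner g (interval_l2 c t)"
      by (fact second_deriv_repD[OF rep])+
    note cont = second_deriv_rep_continuous_on[OF rep]
    have ex: "\<exists>t\<in>{a..b}. \<bar>h t\<bar> \<le> norm x * k" if "{a..b} \<subseteq> {c..d}" "b = a + l" for a b
    proof -
      have "AE t in lborel. t \<in> {a..b} \<longrightarrow> rep_l2 x t = h t"
        using ae by eventually_elim (use that(1) in blast)
      from small_value_on_interval[OF _ this continuous_on_subset[OF cont that(1)]]
      show ?thesis using that l by (simp add: k_def)
    qed
    obtain t1 where t1: "t1 \<in> {c..c + l}" "\<bar>h t1\<bar> \<le> norm x * k"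
      using ex[of c "c + l"] l by auto
    obtain t2 where t2: "t2 \<in> {d - l..d}" "\<bar>h t2\<bar> \<le> norm x * k"
      using ex[of "d - l" d] l by auto
    have t12: "t2 - t1 \<ge> l" "t1 \<in> {c..d}" "t2 \<in> {c..d}" using t1 t2 l by auto
    have "\<exists>\<xi>\<in>{t1<..<t2}. h t2 - h t1 = h' \<xi> * (t2 - t1)"
    proof (rule mvt_simple)
      show "t1 < t2" using t12 l by simp
      fix t assume t: "t1 \<le> t" "t \<le> t2"
      have "(h has_real_derivative h' t) (at t within {t1..t2})"
        by (rule DERIV_subset[OF der]) (use t t12 in auto)
      then show "(h has_derivative (\<lambda>s. h' t * s)) (at t within {t1..t2})"
        by (simp add: has_field_derivative_def)
    qed
    then obtain \<xi> where \<xi>: "\<xi> \<in> {t1<..<t2}" "h t2 - h t1 = h' \<xi> * (t2 - t1)" by blast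
    have "\<bar>h' \<xi>\<bar> * l \<le> \<bar>h' \<xi>\<bar> * (t2 - t1)" using t12 by (intro mult_left_mono) auto
    also have "\<dots> = \<bar>h t2 - h t1\<bar>" using \<xi> t12 l by (simp add: abs_mult)
    also have "\<dots> \<le> 2 * (norm x * k)" using t1 t2 by linarith
    finally have \<xi>b: "\<bar>h' \<xi>\<bar> \<le> 2 * k / l * norm x" using l by (simp add: field_simps)
    have st: "\<bar>inner g (interval_l2 c t)\<bar> \<le> norm g * sqrt (3 * l)" if "t \<in> {c..d}" for t
    proof -
      have "\<bar>inner g (interval_l2 c t)\<bar> \<le> norm g * norm (interval_l2 c t)" by (rule Cauchy_Schwarz_ineq2)
      also have "\<dots> \<le> norm g * sqrt (3 * l)"
        using that l by (intro mult_left_mono) (auto simp: norm_interval_l2)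
      finally show ?thesis .
    qed
    have h'b: "\<bar>h' t\<bar> \<le> m * (norm x + norm g)" if t: "t \<in> {c..d}" for t
    proof -
      have x\<xi>: "\<xi> \<in> {c..d}" using \<xi> t12 by auto
      have "\<bar>h' t\<bar> \<le> \<bar>h' \<xi>\<bar> + \<bar>inner g (interval_l2 c t)\<bar> + \<bar>inner g (interval_l2 c \<xi>)\<bar>"
        using h'[OF t] h'[OF x\<xi>] by linarith
      also have "\<dots> \<le> 2 * k / l * norm x + 2 * sqrt (3 * l) * norm g"
        using \<xi>b st[OF t] st[OF x\<xi>] by (simp add: mult_ac)
      also have "\<dots> \<le> m * norm x + m * norm g"
        using km l by (intro add_mono mult_right_mono) (auto simp: m_def)
      finally show ?thesis by (simp add: distrib_left)
    qed
    let ?R = "norm x + norm g"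
    have hb: "\<bar>h t\<bar> \<le> k * ?R + 3 * l * m * ?R" if t: "t \<in> {c..d}" for t
    proof -
      have "norm (h t - h t1) \<le> m * ?R * norm (t - t1)"
      proof (rule field_differentiable_bound[where S = "{c..d}" and f' = h'])
        show "norm (h' z) \<le> m * ?R" if "z \<in> {c..d}" for z using h'b[OF that] by simp
      qed (use der t t12 in auto)
      also have "\<dots> \<le> m * ?R * (3 * l)"
        using t t12 l km by (intro mult_left_mono) auto
      finally have "\<bar>h t\<bar> \<le> \<bar>h t1\<bar> + m * ?R * (3 * l)"
        unfolding real_norm_def by linarith
      moreover have "norm x * k \<le> k * ?R" using km by (simp add: distrib_left)
      ultimately show ?thesis using t1 by (simp add: mult_ac)
    qed
    show "\<forall>t\<in>{c..d}. \<bar>h t\<bar> \<le> C * ?R \<and> \<bar>h' t\<bar> \<le> C * ?R"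
    proof (intro ballI conjI)
      fix t assume t: "t \<in> {c..d}"
      have "0 \<le> k * ?R" "0 \<le> m * ?R" "0 \<le> 3 * l * m * ?R" using km l by auto
      then show "\<bar>h t\<bar> \<le> C * ?R" "\<bar>h' t\<bar> \<le> C * ?R"
        using hb[OF t] h'b[OF t] unfolding C_def distrib_right by linarith+
    qed
  qed
qed

text \<open>By linearity this is the uniqueness that makes \<open>second_deriv\<close> well defined.
  A continuous representative of 0 vanishes everywhere, hence so does its derivative, and then every
  integral of \<open>g\<close> over \<open>{c..t}\<close>.\<close>

lemma has_second_deriv_0_imp_0:
  assumes "c < d" and "has_second_deriv c d 0 g"
  shows "g = 0"
proof -
  obtain h h' where rep: "second_deriv_rep c d 0 g h h'" and g: "g \<in> l2_on {c..d}"
    using assms(2) unfolding has_second_deriv_iff by blast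
  note cont = second_deriv_rep_continuous_on[OF rep]
  have h0: "h t0 = 0" if t0: "t0 \<in> {c..d}" for t0
  proof (rule ccontr)
    assume "h t0 \<noteq> 0"
    then obtain \<delta> where \<delta>: "\<delta> > 0" "\<And>t. t \<in> {c..d} \<Longrightarrow> dist t t0 < \<delta> \<Longrightarrow> dist (h t) (h t0) < \<bar>h t0\<bar>"
      using cont t0 unfolding continuous_on_iff by (metis zero_less_abs_iff)
    \<comment> \<open>The half-width \<open>\<delta>/2\<close> keeps \<open>{a..b}\<close> where
      \<open>h\<close> differs from 0, and cutting at \<open>c\<close> and \<open>d\<close> leaves
      positive length even if \<open>t0\<close> is an end point. The zero norm yields a zero of
      \<open>h\<close> inside.\<close>
    define a where "a = max c (t0 - \<delta>/2)"
    define b where "b = min d (t0 + \<delta>/2)"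
    have ab: "a < b" "{a..b} \<subseteq> {c..d}" using t0 \<delta>(1) \<open>c < d\<close> by (auto simp: a_def b_def)
    have "AE t in lborel. t \<in> {a..b} \<longrightarrow> rep_l2 0 t = h t"
      using second_deriv_repD(1)[OF rep] by eventually_elim (use ab in auto)
    from small_value_on_interval[OF ab(1) this continuous_on_subset[OF cont ab(2)]]
    obtain t where t: "t \<in> {a..b}" "h t = 0" by auto
    have "dist t t0 < \<delta>" using t(1) \<delta>(1) by (auto simp: a_def b_def dist_real_def)
    then show False using \<delta>(2)[of t] t ab by (auto simp: dist_real_def)
  qed
  have h'0: "h' t = 0" if t: "t \<in> {c..d}" for t
  proof -
    have "(h has_real_derivative h' t) (at t within {c..d})"
      by (rule second_deriv_repD(2)[OF rep t])
    then have "((\<lambda>_. 0) has_real_derivative h' t) (at t within {c..d})"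
      by (rule has_field_derivative_transform_within[OF _ zero_less_one t]) (simp add: h0)
    moreover have "at t within {c..d} \<noteq> bot"
      using t \<open>c < d\<close> by (simp add: trivial_limit_within)
    ultimately show ?thesis
      using has_field_derivative_unique[of "\<lambda>_. 0" "h' t" t "{c..d}" 0] by simp
  qed
  show ?thesis
  proof (rule l2_on_eq_0_if_orthogonal_intervals[OF g _ \<open>c < d\<close>])
    fix t assume t: "t \<in> {c..d}"
    have "h' t = h' c + inner g (interval_l2 c t)" by (rule second_deriv_repD(3)[OF rep t])
    then show "inner g (interval_l2 c t) = 0" using h'0[OF t] h'0[of c] \<open>c < d\<close> by simp
  qed
qed

lemma second_deriv_eqI:
  assumes "c < d" and g: "has_second_deriv c d x g"
  shows "second_deriv c d x = g"
  unfolding second_deriv_def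
proof (rule the_equality)
  show "has_second_deriv c d x g" by (rule g)
next
  fix k assume "has_second_deriv c d x k"
  from has_second_deriv_diff[OF this g] have "has_second_deriv c d 0 (k - g)" by simp
  then show "k = g" using has_second_deriv_0_imp_0[OF \<open>c < d\<close>] by force
qed

lemma sobolev2_has_second_deriv:
  "c < d \<Longrightarrow> x \<in> sobolev2 c d \<Longrightarrow> has_second_deriv c d x (second_deriv c d x)"
  using second_deriv_eqI unfolding sobolev2_def by blast

lemma subspace_sobolev2: "subspace (sobolev2 c d)"
  using has_second_deriv_zero has_second_deriv_add has_second_deriv_scaleR
  unfolding sobolev2_def by (intro subspaceI) blast+

lemma sobolev2_subset: "sobolev2 c d \<subseteq> l2_on {c..d}"
  by (auto simp: sobolev2_def has_second_deriv_def)

lemma roughness_nonneg: "0 \<le> roughness c d x x"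
  by (simp add: roughness_def)

lemma roughness_scaleR:
  assumes "c < d" "x \<in> sobolev2 c d"
  shows "roughness c d (r *\<^sub>R x) (r *\<^sub>R x) = r\<^sup>2 * roughness c d x x"
proof -
  have "second_deriv c d (r *\<^sub>R x) = r *\<^sub>R second_deriv c d x"
    by (rule second_deriv_eqI[OF assms(1) has_second_deriv_scaleR[OF sobolev2_has_second_deriv[OF assms]]])
  then show ?thesis by (simp add: roughness_def power2_eq_square)
qed

section \<open>Limits of functions with bounded second derivatives\<close>

text \<open>On a bounded interval a constant is square integrable and serves as dominating function.
  Pointwise limits of representatives thus become limits in \<open>l2\<close>, and the limit keeps
  the pointwise limit as representative.\<close>

lemma l2_tendsto_if_pointwise_bounded:
  assumes x: "\<And>n. x n \<in> l2_on {c..d}"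
    and ae: "\<And>n. AE t in lborel. t \<in> {c..d} \<longrightarrow> rep_l2 (x n) t = h n t"
    and cont: "\<And>n. continuous_on {c..d} (h n)"
    and bd: "\<And>n t. t \<in> {c..d} \<Longrightarrow> \<bar>h n t\<bar> \<le> B"
    and lim: "\<And>t. t \<in> {c..d} \<Longrightarrow> (\<lambda>n::nat. h n t) \<longlonglongrightarrow> h0 t"
  shows "\<exists>x0. x \<longlonglongrightarrow> x0 \<and> (AE t in lborel. t \<in> {c..d} \<longrightarrow> rep_l2 x0 t = h0 t)"
proof -
  define f where "f = (\<lambda>n t. indicator {c..d} t * h n t)"
  define f0 where "f0 = (\<lambda>t. indicator {c..d} t * h0 t)"
  have f [measurable]: "f n \<in> borel_measurable lborel" for n
    using borel_measurable_continuous_on_indicator[OF _ cont[of n]] by (simp add: f_def)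
  have lim': "(\<lambda>n. f n t) \<longlonglongrightarrow> f0 t" for t
    using lim[of t] by (cases "t \<in> {c..d}") (auto simp: f_def f0_def)
  have f0: "f0 \<in> borel_measurable lborel"
    by (rule borel_measurable_LIMSEQ_real[OF lim' f])
  have "sq_int (\<lambda>t. \<bar>B\<bar> * indicator {c..d} t)" by (rule sq_int_scale[OF sq_int_interval])
  note dct = l2_dominated_convergence[OF this f0 f]
  have b: "AE t in lborel. \<bar>f n t\<bar> \<le> \<bar>B\<bar> * indicator {c..d} t" for n
    using bd[of _ n] by (intro AE_I2) (auto simp: f_def indicator_def intro!: order_trans[OF _ abs_ge_self])
  have sf: "sq_int f0" "sq_int (f n)" and f_lim: "(\<lambda>n. abs_l2 (f n)) \<longlonglongrightarrow> abs_l2 f0" for n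
    using dct[of "\<lambda>n. n"] lim' b by auto
  have "x = (\<lambda>n. abs_l2 (f n))"
  proof
    fix n
    have "AE t in lborel. rep_l2 (x n) t = f n t"
      using ae[of n] x[of n, unfolded l2_on_def mem_Collect_eq]
      by eventually_elim (auto simp: f_def indicator_def)
    then show "x n = abs_l2 (f n)"
      using abs_l2_eq_iff[OF sq_int_rep sf(2), of "x n" n] by (simp add: abs_rep_l2)
  qed
  moreover note f_lim
  moreover have "AE t in lborel. t \<in> {c..d} \<longrightarrow> rep_l2 (abs_l2 f0) t = h0 t"
    using rep_abs_l2[OF sf(1)] by (auto simp: f0_def elim!: eventually_mono)
  ultimately show ?thesis by auto
qed

text \<open>The common bound on the derivatives makes the representatives equi-Lipschitz, so
  Arzela-Ascoli gives a uniformly convergent subsequence. Only a limit in \<open>l2\<close> is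
  claimed; its second derivative comes from \<open>has_second_deriv_weak_limit\<close>.\<close>

lemma sobolev2_compact_embedding:
  assumes "c < d" and D: "\<And>n. has_second_deriv c d (x n) (g n)"
    and R: "\<And>n::nat. norm (x n) + norm (g n) \<le> R"
  shows "\<exists>x0 r. strict_mono (r :: nat \<Rightarrow> nat) \<and> (x \<circ> r) \<longlonglongrightarrow> x0"
proof -
  obtain C where C: "C \<ge> 0" "\<And>x g h h' t. second_deriv_rep c d x g h h' \<Longrightarrow> t \<in> {c..d} \<Longrightarrow>
      \<bar>h t\<bar> \<le> C * (norm x + norm g) \<and> \<bar>h' t\<bar> \<le> C * (norm x + norm g)"
    using second_deriv_rep_bound[OF \<open>c < d\<close>] by blast
  obtain h h' where rep: "\<And>n. second_deriv_rep c d (x n) (g n) (h n) (h' n)"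
    using D unfolding has_second_deriv_iff by metis
  define B where "B = C * R"
  have CR: "C * (norm (x n) + norm (g n)) \<le> B" for n
    unfolding B_def using R C(1) by (intro mult_left_mono) auto
  have hB: "\<bar>h n t\<bar> \<le> B" and h'B: "\<bar>h' n t\<bar> \<le> B" if "t \<in> {c..d}" for n t
    using C(2)[OF rep that, of n] CR[of n] by linarith+
  have B0: "0 \<le> B" using CR[of 0] C(1) by (smt (verit) mult_nonneg_nonneg norm_ge_zero)
  have lip: "\<bar>h n s - h n t\<bar> \<le> B * \<bar>s - t\<bar>" if st: "s \<in> {c..d}" "t \<in> {c..d}" for n s t
  proof -
    have "norm (h n s - h n t) \<le> B * norm (s - t)"
    proof (rule field_differentiable_bound[where S = "{c..d}" and f' = "h' n"])
      show "(h n has_field_derivative h' n z) (at z within {c..d})" if "z \<in> {c..d}" for z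
        using second_deriv_repD(2)[OF rep] that by blast
    qed (use st h'B in auto)
    then show ?thesis by simp
  qed
  obtain h0 r where r: "strict_mono (r :: nat \<Rightarrow> nat)"
    and unif: "\<And>e. 0 < e \<Longrightarrow> \<exists>N. \<forall>n t. n \<ge> N \<and> t \<in> {c..d} \<longrightarrow> norm (h (r n) t - h0 t) < e"
  proof (rule Arzela_Ascoli[of "{c..d}" h B])
    fix t e :: real assume t: "t \<in> {c..d}" and e: "0 < e"
    \<comment> \<open>The divisor is \<open>B + 1\<close> because \<open>B\<close> may be 0.\<close>
    have "norm (h n t - h n y) < e" if "y \<in> {c..d}" "norm (t - y) < e / (B + 1)" for n y
    proof -
      have "norm (h n t - h n y) \<le> B * norm (t - y)" using lip[OF t that(1)] by simp
      also have "\<dots> \<le> (B + 1) * norm (t - y)" by (simp add: distrib_right)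
      also have "\<dots> < e" using that(2) B0 by (simp add: field_simps)
      finally show ?thesis .
    qed
    then show "\<exists>\<delta>>0. \<forall>n y. y \<in> {c..d} \<and> norm (t - y) < \<delta> \<longrightarrow> norm (h n t - h n y) < e"
      using e B0 by (intro exI[of _ "e / (B + 1)"]) auto
  qed (use hB in auto)
  have "\<exists>x0. (x \<circ> r) \<longlonglongrightarrow> x0 \<and> (AE t in lborel. t \<in> {c..d} \<longrightarrow> rep_l2 x0 t = h0 t)"
  proof (rule l2_tendsto_if_pointwise_bounded[where h = "h \<circ> r" and B = B])
    show "(x \<circ> r) n \<in> l2_on {c..d}" for n using D by (auto simp: has_second_deriv_def)
    show "AE t in lborel. t \<in> {c..d} \<longrightarrow> rep_l2 ((x \<circ> r) n) t = (h \<circ> r) n t" for n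
      using second_deriv_repD(1)[OF rep[of "r n"]] by simp
    show "continuous_on {c..d} ((h \<circ> r) n)" for n
      using second_deriv_rep_continuous_on[OF rep] by simp
    show "\<bar>(h \<circ> r) n t\<bar> \<le> B" if "t \<in> {c..d}" for n t using hB[OF that] by simp
    show "(\<lambda>n. (h \<circ> r) n t) \<longlonglongrightarrow> h0 t" if "t \<in> {c..d}" for t
      using unif that by (intro LIMSEQ_I) fastforce
  qed
  then show ?thesis using r by blast
qed

text \<open>The uniform bound, applied to differences of members of the sequence, makes the values
  of \<open>h n\<close> and \<open>h' n\<close> at \<open>c\<close> Cauchy. With the convergence of
  \<open>g\<close> the derivatives then converge uniformly, and the theorem on differentiating a
  sequence of functions produces the limit \<open>h0\<close>.\<close>

lemma has_second_deriv_closed: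
  assumes "c < d" and D: "\<And>n::nat. has_second_deriv c d (x n) (g n)"
    and x: "x \<longlonglongrightarrow> x0" and g: "g \<longlonglongrightarrow> g0"
  shows "has_second_deriv c d x0 g0"
proof -
  obtain C where C: "C \<ge> 0" "\<And>x g h h' t. second_deriv_rep c d x g h h' \<Longrightarrow> t \<in> {c..d} \<Longrightarrow>
      \<bar>h t\<bar> \<le> C * (norm x + norm g) \<and> \<bar>h' t\<bar> \<le> C * (norm x + norm g)"
    using second_deriv_rep_bound[OF \<open>c < d\<close>] by blast
  obtain h h' where rep: "\<And>n. second_deriv_rep c d (x n) (g n) (h n) (h' n)"
    using D unfolding has_second_deriv_iff by metis
  have cc: "c \<in> {c..d}" using \<open>c < d\<close> by simp
  have conv: "convergent (\<lambda>n. k n)"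
    if k: "\<And>m n. \<bar>k m - k n\<bar> \<le> C * (norm (x m - x n) + norm (g m - g n))" for k :: "nat \<Rightarrow> real"
  proof -
    have "Cauchy k"
    proof (rule metric_CauchyI)
      fix e :: real assume "e > 0"
      then have e: "e / (2 * (C + 1)) > 0" using C(1) by simp
      obtain N1 where N1: "\<And>m n. m \<ge> N1 \<Longrightarrow> n \<ge> N1 \<Longrightarrow> dist (x m) (x n) < e / (2 * (C + 1))"
        using metric_CauchyD[OF LIMSEQ_imp_Cauchy[OF x] e] by blast
      obtain N2 where N2: "\<And>m n. m \<ge> N2 \<Longrightarrow> n \<ge> N2 \<Longrightarrow> dist (g m) (g n) < e / (2 * (C + 1))"
        using metric_CauchyD[OF LIMSEQ_imp_Cauchy[OF g] e] by blast
      have "dist (k m) (k n) < e" if "m \<ge> max N1 N2" "n \<ge> max N1 N2" for m n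
      proof -
        have s: "norm (x m - x n) + norm (g m - g n) < e / (C + 1)"
          using N1[of m n] N2[of m n] that C(1) by (simp add: dist_norm field_simps)
        have "dist (k m) (k n) \<le> C * (norm (x m - x n) + norm (g m - g n))"
          using k by (simp add: dist_real_def)
        also have "\<dots> \<le> (C + 1) * (norm (x m - x n) + norm (g m - g n))"
          by (simp add: distrib_right)
        also have "\<dots> < e" using s C(1) by (simp add: field_simps)
        finally show ?thesis .
      qed
      then show "\<exists>N. \<forall>m\<ge>N. \<forall>n\<ge>N. dist (k m) (k n) < e" by blast
    qed
    then show ?thesis by (simp add: Cauchy_convergent_iff)
  qed
  obtain p0 where p0: "(\<lambda>n. h n c) \<longlonglongrightarrow> p0"
    using conv[of "\<lambda>n. h n c"] C(2)[OF second_deriv_rep_diff[OF rep rep] cc]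
    unfolding convergent_def by blast
  obtain p1 where p1: "(\<lambda>n. h' n c) \<longlonglongrightarrow> p1"
    using conv[of "\<lambda>n. h' n c"] C(2)[OF second_deriv_rep_diff[OF rep rep] cc]
    unfolding convergent_def by blast
  define h0' where "h0' t = p1 + inner g0 (interval_l2 c t)" for t
  have "\<exists>h0. \<forall>t\<in>{c..d}. (\<lambda>n. h n t) \<longlonglongrightarrow> h0 t \<and>
      (h0 has_derivative (\<lambda>s. h0' t * s)) (at t within {c..d})"
  proof (rule has_derivative_sequence[where f = h and f' = "\<lambda>n t s. h' n t * s" and l = p0])
    show "c \<in> {c..d}" by (rule cc)
    show "(h n has_derivative (\<lambda>s. h' n t * s)) (at t within {c..d})" if "t \<in> {c..d}" for n t
      using second_deriv_repD(2)[OF rep that] by (simp add: has_field_derivative_def)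
    fix e :: real assume "e > 0"
    define L where "L = sqrt (d - c) + 1"
    have L: "L > 0" using \<open>c < d\<close> by (auto simp: L_def intro: add_nonneg_pos)
    then have "e / (2 * L) > 0" "e / 2 > 0" using \<open>e > 0\<close> by auto
    from tendstoD[OF p1 this(2)] tendstoD[OF g this(1)]
    show "\<forall>\<^sub>F n in sequentially. \<forall>t\<in>{c..d}. \<forall>s. norm (h' n t * s - h0' t * s) \<le> e * norm s"
    proof eventually_elim
      case (elim n)
      show ?case
      proof (intro ballI allI)
        fix t s assume t: "t \<in> {c..d}"
        have "h' n t = h' n c + inner (g n) (interval_l2 c t)"
          by (rule second_deriv_repD(3)[OF rep t])
        then have "\<bar>h' n t - h0' t\<bar> \<le> \<bar>h' n c - p1\<bar> + \<bar>inner (g n - g0) (interval_l2 c t)\<bar>"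
          by (simp add: h0'_def inner_diff_left)
        also have "\<bar>inner (g n - g0) (interval_l2 c t)\<bar> \<le> norm (g n - g0) * norm (interval_l2 c t)"
          by (rule Cauchy_Schwarz_ineq2)
        also have "\<dots> \<le> e / (2 * L) * L"
        proof (intro mult_mono)
          have "norm (interval_l2 c t) \<le> sqrt (d - c)" using t by (simp add: norm_interval_l2)
          then show "norm (interval_l2 c t) \<le> L" unfolding L_def by linarith
        qed (use elim L \<open>e > 0\<close> in \<open>auto simp: dist_norm\<close>)
        also have "\<dots> = e / 2" using L by simp
        finally have "\<bar>h' n t - h0' t\<bar> \<le> e" using elim by (simp add: dist_real_def)
        then have "\<bar>h' n t - h0' t\<bar> * \<bar>s\<bar> \<le> e * \<bar>s\<bar>" by (intro mult_right_mono) auto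
        then show "norm (h' n t * s - h0' t * s) \<le> e * norm s"
          by (simp flip: left_diff_distrib abs_mult)
      qed
    qed
  qed (use p0 in auto)
  then obtain h0 where h0: "\<And>t. t \<in> {c..d} \<Longrightarrow> (\<lambda>n. h n t) \<longlonglongrightarrow> h0 t"
    and der: "\<And>t. t \<in> {c..d} \<Longrightarrow> (h0 has_real_derivative h0' t) (at t within {c..d})"
    unfolding has_field_derivative_def by blast
  have "Bseq x" "Bseq g" using x g by (auto intro: convergent_imp_Bseq convergentI)
  then obtain K1 K2 where K: "\<And>n. norm (x n) \<le> K1" "\<And>n. norm (g n) \<le> K2"
    unfolding Bseq_def by blast
  have "\<exists>x1. x \<longlonglongrightarrow> x1 \<and> (AE t in lborel. t \<in> {c..d} \<longrightarrow> rep_l2 x1 t = h0 t)"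
  proof (rule l2_tendsto_if_pointwise_bounded[where h = h and B = "C * (K1 + K2)"])
    show "x n \<in> l2_on {c..d}" for n using D by (auto simp: has_second_deriv_def)
    show "AE t in lborel. t \<in> {c..d} \<longrightarrow> rep_l2 (x n) t = h n t" for n
      by (rule second_deriv_repD(1)[OF rep])
    show "continuous_on {c..d} (h n)" for n by (rule second_deriv_rep_continuous_on[OF rep])
    fix n t assume t: "t \<in> {c..d}"
    have "\<bar>h n t\<bar> \<le> C * (norm (x n) + norm (g n))" using C(2)[OF rep t] by blast
    also have "\<dots> \<le> C * (K1 + K2)" using K C(1) by (intro mult_left_mono add_mono) auto
    finally show "\<bar>h n t\<bar> \<le> C * (K1 + K2)" .
  qed (rule h0)
  then have ae: "AE t in lborel. t \<in> {c..d} \<longrightarrow> rep_l2 x0 t = h0 t"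
    using LIMSEQ_unique[OF x] by blast
  \<comment> \<open>Hence \<open>h0' c = p1\<close>, so the formula defining \<open>h0'\<close> is
    the required integral identity.\<close>
  have "interval_l2 c c = 0"
    using norm_interval_l2[of c c] by simp
  then have "second_deriv_rep c d x0 g0 h0 h0'"
    unfolding second_deriv_rep_def using ae der by (simp add: h0'_def)
  moreover have "x n \<in> l2_on {c..d}" "g n \<in> l2_on {c..d}" for n
    using D by (auto simp: has_second_deriv_def)
  then have "x0 \<in> l2_on {c..d}" "g0 \<in> l2_on {c..d}"
    using closed_sequentially[OF closed_l2_on] x g by (metis borel_closed closed_atLeastAtMost)+
  ultimately show ?thesis unfolding has_second_deriv_iff by blast
qed

text \<open>Lower semicontinuity of the roughness: the graph of the second derivative is convex and
  closed, so it has a point over \<open>x0\<close> that respects the bound, although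
  \<open>g\<close> itself need not converge.\<close>

lemma has_second_deriv_weak_limit:
  assumes "c < d" and D: "\<And>n. has_second_deriv c d (x n) (g n)"
    and x: "x \<longlonglongrightarrow> x0" and R: "\<And>n::nat. norm (g n) \<le> R"
  shows "\<exists>g0. has_second_deriv c d x0 g0 \<and> norm g0 \<le> R"
proof -
  let ?G = "{(y, z). has_second_deriv c d y z}"
  have "convex ?G"
    unfolding convex_def by (auto intro!: has_second_deriv_add has_second_deriv_scaleR)
  moreover have "closed ?G"
    unfolding closed_sequential_limits
  proof (intro allI impI, elim conjE)
    fix p l assume p: "\<forall>n. p n \<in> ?G" and l: "p \<longlonglongrightarrow> l"
    have "has_second_deriv c d (fst l) (snd l)"
    proof (rule has_second_deriv_closed[OF \<open>c < d\<close>])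
      show "has_second_deriv c d (fst (p n)) (snd (p n))" for n using p by (auto simp: case_prod_beta)
    qed (use l in \<open>auto intro: tendsto_fst tendsto_snd\<close>)
    then show "l \<in> ?G" by (simp add: case_prod_beta)
  qed
  ultimately show ?thesis
    using closed_convex_weak_limit[of ?G x g x0 R] D x R by auto
qed

section \<open>Existence of a maximiser\<close>

lemma quadratic_form_scaleR:
  assumes "\<And>r y. y \<in> V \<Longrightarrow> F (r *\<^sub>R y) = r *\<^sub>R F y" and "x \<in> (V :: 'a::real_inner set)"
  shows "inner (F (r *\<^sub>R x)) (r *\<^sub>R x) = r\<^sup>2 * inner (F x) x"
  using assms by (simp add: power2_eq_square)

lemma sobolev2_scaleR: "x \<in> sobolev2 c d \<Longrightarrow> r *\<^sub>R x \<in> sobolev2 c d"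
  using subspace_scale[OF subspace_sobolev2] .

text \<open>
  On the set where the denominator is at most \<open>1\<close>, which is compact, the numerator has a
  maximum; by homogeneity it is a maximum of the quotient because the numerator is positive there.
\<close>

lemma is_max_point_exists:
  fixes GE GX :: "l2 \<Rightarrow> l2"
  assumes "c < d" and "\<alpha> > 0" and "\<rho> > 0"
    and GE: "continuous_on (l2_on {c..d}) GE" "\<And>r x. x \<in> l2_on {c..d} \<Longrightarrow> GE (r *\<^sub>R x) = r *\<^sub>R GE x"
    and GX: "continuous_on (l2_on {c..d}) GX" "\<And>r x. x \<in> l2_on {c..d} \<Longrightarrow> GX (r *\<^sub>R x) = r *\<^sub>R GX x"
    and GX0: "\<And>x. x \<in> l2_on {c..d} \<Longrightarrow> 0 \<le> inner (GX x) x"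
    and coercive: "\<And>x. x \<in> sobolev2 c d \<Longrightarrow> \<rho> * (norm x)\<^sup>2 \<le> inner (GX x) x + \<alpha> * roughness c d x x"
    and pos: "x1 \<in> sobolev2 c d" "inner (GE x1) x1 > 0"
  shows "\<exists>b. is_max_point c d GE GX \<alpha> b"
proof -
  let ?S = "sobolev2 c d" and ?V = "l2_on {c..d}"
  define n where "n x = inner (GE x) x" for x
  define q where "q x = inner (GX x) x + \<alpha> * roughness c d x x" for x
  have SV: "x \<in> ?S \<Longrightarrow> x \<in> ?V" for x using sobolev2_subset by blast
  have n_scale: "n (r *\<^sub>R x) = r\<^sup>2 * n x" if "x \<in> ?S" for r x
    unfolding n_def using quadratic_form_scaleR[of ?V GE] GE(2) SV[OF that] by blast
  have q_scale: "q (r *\<^sub>R x) = r\<^sup>2 * q x" if "x \<in> ?S" for r x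
    unfolding q_def using quadratic_form_scaleR[of ?V GX x r] GX(2) SV[OF that] roughness_scaleR[OF \<open>c < d\<close> that]
    by (simp add: algebra_simps)
  have q_pos: "q x > 0" if "x \<in> ?S" "x \<noteq> 0" for x
  proof -
    have "0 < \<rho> * (norm x)\<^sup>2" using \<open>\<rho> > 0\<close> that by simp
    then show ?thesis using coercive[OF that(1)] unfolding q_def by linarith
  qed
  have n_cont: "continuous_on ?V n" unfolding n_def by (intro continuous_on_inner GE continuous_on_id)
  have g_cont: "continuous_on ?V (\<lambda>x. inner (GX x) x)" by (intro continuous_on_inner GX continuous_on_id)
  define K where "K = {x \<in> ?S. q x \<le> 1}"
  have KV: "K \<subseteq> ?V" using SV by (auto simp: K_def)
  have "seq_compact K"
  proof (rule seq_compactI)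
    fix x :: "nat \<Rightarrow> l2" assume x: "\<forall>k. x k \<in> K"
    define g where "g k = second_deriv c d (x k)" for k
    have xS: "x k \<in> ?S" and xq: "q (x k) \<le> 1" for k using x by (auto simp: K_def)
    have D: "has_second_deriv c d (x k) (g k)" for k
      unfolding g_def by (rule sobolev2_has_second_deriv[OF \<open>c < d\<close> xS])
    have rough: "(norm (g k))\<^sup>2 = roughness c d (x k) (x k)" for k
      by (simp add: g_def roughness_def power2_norm_eq_inner)
    \<comment> \<open>Coercivity bounds \<open>x k\<close>. The second derivative is bounded through
      \<alpha>, as the form of \<open>GX\<close> is nonnegative.\<close>
    have "norm (x k) \<le> sqrt (1 / \<rho>)" for k
    proof (rule real_le_rsqrt)
      have "\<rho> * (norm (x k))\<^sup>2 \<le> 1" using coercive[OF xS[of k]] xq[of k] unfolding q_def by linarith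
      then show "(norm (x k))\<^sup>2 \<le> 1 / \<rho>" using \<open>\<rho> > 0\<close> by (simp add: field_simps)
    qed
    moreover have "norm (g k) \<le> sqrt (1 / \<alpha>)" for k
    proof (rule real_le_rsqrt)
      have "\<alpha> * (norm (g k))\<^sup>2 \<le> 1" using xq[of k] GX0[OF SV[OF xS[of k]]] unfolding q_def rough by linarith
      then show "(norm (g k))\<^sup>2 \<le> 1 / \<alpha>" using \<open>\<alpha> > 0\<close> by (simp add: field_simps)
    qed
    ultimately have "norm (x k) + norm (g k) \<le> sqrt (1 / \<rho>) + sqrt (1 / \<alpha>)" for k by (rule add_mono)
    from sobolev2_compact_embedding[OF \<open>c < d\<close>, of x g, OF D this]
    obtain x0 r where r: "strict_mono (r :: nat \<Rightarrow> nat)" and x0: "(x \<circ> r) \<longlonglongrightarrow> x0" by blast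
    have x0V: "x0 \<in> ?V"
      using closed_sequentially[OF closed_l2_on _ x0, of "{c..d}"] SV[OF xS] by simp
    have lim: "(\<lambda>k. inner (GX (x (r k))) (x (r k))) \<longlonglongrightarrow> inner (GX x0) x0"
      using g_cont[unfolded continuous_on_sequentially, rule_format, of x0 "x \<circ> r"] x0V x0 SV[OF xS]
      by (simp add: comp_def)
    have bound: "\<exists>g0. has_second_deriv c d x0 g0 \<and> \<alpha> * (norm g0)\<^sup>2 \<le> 1 - inner (GX x0) x0 + \<epsilon>" if "\<epsilon> > 0" for \<epsilon>
    proof -
      let ?R = "1 - inner (GX x0) x0 + \<epsilon>"
      have "\<forall>\<^sub>F k in sequentially. inner (GX (x (r k))) (x (r k)) > inner (GX x0) x0 - \<epsilon>"
        using that by (intro order_tendstoD[OF lim]) simp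
      then obtain k0 where k0: "\<And>k. k \<ge> k0 \<Longrightarrow> inner (GX (x (r k))) (x (r k)) > inner (GX x0) x0 - \<epsilon>"
        by (auto simp: eventually_sequentially)
      have R: "\<alpha> * (norm (g (r (k + k0))))\<^sup>2 \<le> ?R" for k
        using xq[of "r (k + k0)"] k0[of "k + k0"] unfolding q_def rough by simp
      have "\<exists>g0. has_second_deriv c d x0 g0 \<and> norm g0 \<le> sqrt (?R / \<alpha>)"
      proof (rule has_second_deriv_weak_limit[OF \<open>c < d\<close>, of "\<lambda>k. x (r (k + k0))" "\<lambda>k. g (r (k + k0))"])
        show "(\<lambda>k. x (r (k + k0))) \<longlonglongrightarrow> x0" using LIMSEQ_ignore_initial_segment[OF x0, of k0] by (simp add: comp_def)
        show "norm (g (r (k + k0))) \<le> sqrt (?R / \<alpha>)" for k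
          using R[of k] \<open>\<alpha> > 0\<close> by (intro real_le_rsqrt) (simp add: field_simps)
      qed (rule D)
      then obtain g0 where g0: "has_second_deriv c d x0 g0" "norm g0 \<le> sqrt (?R / \<alpha>)" by blast
      have "0 \<le> \<alpha> * (norm (g (r (0 + k0))))\<^sup>2" using \<open>\<alpha> > 0\<close> by simp
      then have "0 \<le> ?R" using R[of 0] by linarith
      then have "0 \<le> ?R / \<alpha>" using \<open>\<alpha> > 0\<close> by (intro divide_nonneg_pos)
      then have "(norm g0)\<^sup>2 \<le> ?R / \<alpha>" using power_mono[OF g0(2) norm_ge_zero, of 2] by simp
      then show ?thesis using g0(1) \<open>\<alpha> > 0\<close> by (auto simp: field_simps)
    qed
    have x0S: "x0 \<in> ?S" using bound[of 1] by (auto simp: sobolev2_def)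
    have "\<alpha> * roughness c d x0 x0 \<le> 1 - inner (GX x0) x0 + \<epsilon>" if "\<epsilon> > 0" for \<epsilon>
      using bound[OF that] second_deriv_eqI[OF \<open>c < d\<close>, of x0] by (auto simp: roughness_def power2_norm_eq_inner)
    then have "\<alpha> * roughness c d x0 x0 \<le> 1 - inner (GX x0) x0" by (rule field_le_epsilon)
    then have "x0 \<in> K" using x0S unfolding K_def q_def by simp
    then show "\<exists>l\<in>K. \<exists>r. strict_mono r \<and> (x \<circ> r) \<longlonglongrightarrow> l" using r x0 by blast
  qed
  then have "compact K" by (simp add: compact_eq_seq_compact_metric)
  have normalise: "(1 / sqrt (q x)) *\<^sub>R x \<in> K" "n ((1 / sqrt (q x)) *\<^sub>R x) = n x / q x" if "x \<in> ?S" "x \<noteq> 0" for x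
  proof -
    have r: "(1 / sqrt (q x))\<^sup>2 = 1 / q x" using q_pos[OF that] by (simp add: power_divide)
    have "q ((1 / sqrt (q x)) *\<^sub>R x) = 1" "n ((1 / sqrt (q x)) *\<^sub>R x) = n x / q x"
      unfolding q_scale[OF that(1)] n_scale[OF that(1)] r using q_pos[OF that] by simp_all
    then show "(1 / sqrt (q x)) *\<^sub>R x \<in> K" "n ((1 / sqrt (q x)) *\<^sub>R x) = n x / q x"
      using sobolev2_scaleR[OF that(1)] by (simp_all add: K_def)
  qed
  have x10: "x1 \<noteq> 0" using pos by auto
  have "K \<noteq> {}" using normalise(1)[OF pos(1) x10] by blast
  from continuous_attains_sup[OF \<open>compact K\<close> this continuous_on_subset[OF n_cont KV]]
  obtain b where b: "b \<in> K" "\<And>x. x \<in> K \<Longrightarrow> n x \<le> n b" by blast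
  have le: "n x / q x \<le> n b" if "x \<in> ?S" "x \<noteq> 0" for x using b(2)[OF normalise(1)[OF that]] normalise(2)[OF that] by simp
  have "0 < n x1 / q x1" using pos(2) q_pos[OF pos(1) x10] by (simp add: n_def)
  then have nb: "n b > 0" using le[OF pos(1) x10] by linarith
  have bS: "b \<in> ?S" and qb: "q b \<le> 1" using b(1) by (auto simp: K_def)
  have b0: "b \<noteq> 0" using nb by (auto simp: n_def)
  have "n b \<le> n b / q b" using nb qb q_pos[OF bS b0] by (simp add: field_simps)
  then have max: "n x / q x \<le> n b / q b" if "x \<in> ?S" "x \<noteq> 0" for x
    using le[OF that] by linarith
  have "is_max_point c d GE GX \<alpha> b"
    unfolding is_max_point_def penalized_quotient_def n_def[symmetric] q_def[symmetric]
    using bS b0 max q_pos by (metis less_irrefl)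
  then show ?thesis by blast
qed

section \<open>Covariance operators\<close>

instance l2 :: banach ..

lemma norm_tensor_sq_le: "norm (tensor_sq z f) \<le> norm f * (norm z)\<^sup>2"
  using mult_right_mono[OF Cauchy_Schwarz_ineq2[of f z] norm_ge_zero[of z]]
  by (simp add: tensor_sq_def power2_eq_square mult_ac)

lemma integrable_tensor_sq:
  fixes Z :: "'w \<Rightarrow> l2"
  assumes [measurable]: "Z \<in> borel_measurable M" and Z2: "integrable M (\<lambda>\<omega>. (norm (Z \<omega>))\<^sup>2)"
  shows "integrable M (\<lambda>\<omega>. tensor_sq (Z \<omega>) f)"
proof (rule Bochner_Integration.integrable_bound)
  show "integrable M (\<lambda>\<omega>. norm f * (norm (Z \<omega>))\<^sup>2)" using Z2 by simp
  show "(\<lambda>\<omega>. tensor_sq (Z \<omega>) f) \<in> borel_measurable M" unfolding tensor_sq_def by measurable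
  show "AE \<omega> in M. norm (tensor_sq (Z \<omega>) f) \<le> norm (norm f * (norm (Z \<omega>))\<^sup>2)"
    by (simp add: norm_tensor_sq_le)
qed

lemma inner_cov_op:
  assumes "Z \<in> borel_measurable M" "integrable M (\<lambda>\<omega>. (norm (Z \<omega>))\<^sup>2)"
  shows "inner (cov_op M Z f) g = (\<integral>\<omega>. inner f (Z \<omega>) * inner g (Z \<omega>) \<partial>M)"
  unfolding cov_op_def integral_inner_left[OF integrable_tensor_sq[OF assms], symmetric]
  by (simp add: tensor_sq_def inner_commute)

lemma inner_cov_op_commute:
  assumes "Z \<in> borel_measurable M" "integrable M (\<lambda>\<omega>. (norm (Z \<omega>))\<^sup>2)"
  shows "inner (cov_op M Z f) g = inner (cov_op M Z g) f"
  unfolding inner_cov_op[OF assms] by (simp add: mult.commute)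

lemma inner_cov_op_nonneg:
  assumes "Z \<in> borel_measurable M" "integrable M (\<lambda>\<omega>. (norm (Z \<omega>))\<^sup>2)"
  shows "0 \<le> inner (cov_op M Z f) f"
  unfolding inner_cov_op[OF assms] by simp

lemma bounded_linear_cov_op:
  assumes "Z \<in> borel_measurable M" "integrable M (\<lambda>\<omega>. (norm (Z \<omega>))\<^sup>2)"
  shows "bounded_linear (cov_op M Z)"
proof (rule bounded_linear_intro)
  note int = integrable_tensor_sq[OF assms]
  show "cov_op M Z (f + g) = cov_op M Z f + cov_op M Z g" for f g
    unfolding cov_op_def by (subst Bochner_Integration.integral_add[OF int int, symmetric])
      (simp add: tensor_sq_def inner_add_left scaleR_add_left)
  show "cov_op M Z (r *\<^sub>R f) = r *\<^sub>R cov_op M Z f" for r f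
    unfolding cov_op_def by (subst integral_scaleR_right[symmetric]) (simp add: tensor_sq_def)
  show "norm (cov_op M Z f) \<le> norm f * (\<integral>\<omega>. (norm (Z \<omega>))\<^sup>2 \<partial>M)" for f
  proof -
    have "norm (cov_op M Z f) \<le> (\<integral>\<omega>. norm (tensor_sq (Z \<omega>) f) \<partial>M)"
      unfolding cov_op_def by (rule integral_norm_bound)
    also have "\<dots> \<le> (\<integral>\<omega>. norm f * (norm (Z \<omega>))\<^sup>2 \<partial>M)"
    proof (rule integral_mono)
      show "norm (tensor_sq (Z \<omega>) f) \<le> norm f * (norm (Z \<omega>))\<^sup>2" for \<omega>
        by (rule norm_tensor_sq_le)
    qed (use assms int in auto)
    finally show ?thesis by simp
  qed
qed

section \<open>Square integrability of conditional expectations\<close>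

text \<open>Both sides are continuous in \<open>e\<close>, so the bound extends from
  \<open>Q\<close> to the choice \<open>e = z\<close>.\<close>

lemma norm_le_if_inner_le_on_dense:
  fixes z :: "'a::real_inner"
  assumes "closure Q = UNIV" and le: "\<And>e. e \<in> Q \<Longrightarrow> inner z e \<le> norm e * w"
  shows "(norm z)\<^sup>2 \<le> norm z * w"
proof -
  have "closed {e. inner z e \<le> norm e * w}"
    by (intro closed_Collect_le continuous_intros)
  then have "closure Q \<subseteq> {e. inner z e \<le> norm e * w}" using le by (intro closure_minimal) auto
  then have "inner z z \<le> norm z * w" using assms(1) by blast
  then show ?thesis by (simp add: power2_norm_eq_inner)
qed

text \<open>
  Testing against a countable dense set gives \<open>norm E(X|F) \<le> E(norm X|F)\<close>, and the real
  conditional Jensen inequality applies to the right-hand side.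
\<close>

lemma cond_exp_square_integrable:
  fixes X Z :: "'w \<Rightarrow> l2"
  assumes "finite_measure M" and sub: "subalgebra M F" and X [measurable]: "X \<in> borel_measurable M"
    and X1: "integrable M X" and X2: "integrable M (\<lambda>\<omega>. (norm (X \<omega>))\<^sup>2)"
    and Z: "is_cond_exp M F X Z"
  shows "integrable M (\<lambda>\<omega>. (norm (Z \<omega>))\<^sup>2)"
proof -
  interpret finite_measure_subalgebra M F
    using assms by (simp add: finite_measure_subalgebra_def finite_measure_subalgebra_axioms_def)
  have ZF [measurable]: "Z \<in> borel_measurable F" and Zi: "integrable M Z"
    and ZA: "\<And>A. A \<in> sets F \<Longrightarrow> (LINT \<omega>:A|M. Z \<omega>) = (LINT \<omega>:A|M. X \<omega>)"
    using Z by (auto simp: is_cond_exp_def)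
  have [measurable]: "Z \<in> borel_measurable M" by (rule measurable_from_subalg[OF sub ZF])
  define W where "W = real_cond_exp M F (\<lambda>\<omega>. norm (X \<omega>))"
  obtain Q :: "l2 set" where Q: "countable Q" "closure Q = UNIV" using l2_ex_countable_dense by blast
  have sets: "A \<in> sets M" if "A \<in> sets F" for A using sub that by (auto simp: subalgebra_def)
  have "AE \<omega> in M. inner (Z \<omega>) e \<le> norm e * W \<omega>" for e
  proof -
    have inn: "(LINT \<omega>:A|M. inner (U \<omega>) e) = inner (LINT \<omega>:A|M. U \<omega>) e"
      if "A \<in> sets M" "integrable M U" for A and U :: "'w \<Rightarrow> l2"
      using integral_inner_left[of e M "\<lambda>\<omega>. indicator A \<omega> *\<^sub>R U \<omega>"] integrable_mult_indicator[OF that]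
      by (simp add: set_lebesgue_integral_def)
    \<comment> \<open>Inner products with a fixed vector commute with the integral, so
      \<open>inner (Z \<omega>) e\<close> is a version of the real conditional expectation.\<close>
    have 1: "AE \<omega> in M. real_cond_exp M F (\<lambda>\<omega>. inner (X \<omega>) e) \<omega> = inner (Z \<omega>) e"
    proof (rule real_cond_exp_charact)
      show "(LINT \<omega>:A|M. inner (X \<omega>) e) = (LINT \<omega>:A|M. inner (Z \<omega>) e)" if "A \<in> sets F" for A
        using inn[OF sets[OF that] X1] inn[OF sets[OF that] Zi] ZA[OF that] by simp
    qed (use X1 Zi in auto)
    have 2: "AE \<omega> in M. real_cond_exp M F (\<lambda>\<omega>. inner (X \<omega>) e) \<omega> \<le> real_cond_exp M F (\<lambda>\<omega>. norm e * norm (X \<omega>)) \<omega>"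
    proof (rule real_cond_exp_mono)
      have "inner x e \<le> norm e * norm x" for x :: l2
        using norm_cauchy_schwarz[of x e] by (simp add: mult.commute)
      then show "AE \<omega> in M. inner (X \<omega>) e \<le> norm e * norm (X \<omega>)" by simp
    qed (use X1 in auto)
    have 3: "AE \<omega> in M. real_cond_exp M F (\<lambda>\<omega>. norm e * norm (X \<omega>)) \<omega> = norm e * W \<omega>"
      unfolding W_def using X1 by (intro real_cond_exp_cmult) auto
    from 1 2 3 show ?thesis by eventually_elim simp
  qed
  \<comment> \<open>The exceptional null set depends on \<open>e\<close>; countability of
    \<open>Q\<close> merges them into one.\<close>
  then have "AE \<omega> in M. \<forall>e\<in>Q. inner (Z \<omega>) e \<le> norm e * W \<omega>"
    using Q(1) by (simp add: AE_ball_countable)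
  then have bd: "AE \<omega> in M. norm ((norm (Z \<omega>))\<^sup>2) \<le> norm ((W \<omega>)\<^sup>2)"
  proof eventually_elim
    case (elim \<omega>)
    then have "(norm (Z \<omega>))\<^sup>2 \<le> norm (Z \<omega>) * W \<omega>"
      by (intro norm_le_if_inner_le_on_dense[OF Q(2)]) auto
    \<comment> \<open>Cancelling a factor needs a nonzero norm; where \<open>Z\<close> vanishes the
      sign of \<open>W\<close> is unknown, hence the absolute value.\<close>
    then have "norm (Z \<omega>) \<le> \<bar>W \<omega>\<bar>"
      by (cases "norm (Z \<omega>) = 0") (auto simp: power2_eq_square mult_le_cancel_left)
    then show ?case using power_mono[of "norm (Z \<omega>)" "\<bar>W \<omega>\<bar>" 2] by simp
  qed
  have "integrable M (\<lambda>\<omega>. (W \<omega>)\<^sup>2)"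
    unfolding W_def
  proof (rule integrable_convex_cond_exp[where I = UNIV])
    show "convex_on UNIV (\<lambda>x::real. x\<^sup>2)" by (rule convex_power2)
  qed (use X1 X2 in auto)
  then show ?thesis by (rule Bochner_Integration.integrable_bound[OF _ _ bd]) measurable
qed

section \<open>Orthonormal expansions and Hilbert-Schmidt bounds\<close>

lemma partial_sum_inner_orthonormal:
  fixes u :: "nat \<Rightarrow> 'a::real_inner"
  assumes on: "\<And>i j. inner (u i) (u j) = (if i = j then 1 else 0)" and "finite I"
  shows "inner (\<Sum>i\<in>I. c i *\<^sub>R u i) (u j) = (if j \<in> I then c j else 0)"
  using \<open>finite I\<close> by (simp add: inner_sum_left on if_distrib cong: if_cong)

lemma norm_sum_orthonormal:
  fixes u :: "nat \<Rightarrow> 'a::real_inner"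
  assumes on: "\<And>i j. inner (u i) (u j) = (if i = j then 1 else 0)" and I: "finite I"
  shows "(norm (\<Sum>i\<in>I. c i *\<^sub>R u i))\<^sup>2 = (\<Sum>i\<in>I. (c i)\<^sup>2)"
  unfolding power2_norm_eq_inner inner_sum_right[of "\<Sum>i\<in>I. c i *\<^sub>R u i"] inner_scaleR_right
    partial_sum_inner_orthonormal[OF on I]
  by (intro sum.cong) (auto simp: power2_eq_square)

lemma bessel_inequality:
  fixes u :: "nat \<Rightarrow> 'a::real_inner"
  assumes on: "\<And>i j. inner (u i) (u j) = (if i = j then 1 else 0)"
  shows "(\<Sum>i<n. (inner g (u i))\<^sup>2) \<le> (norm g)\<^sup>2"
proof -
  let ?s = "\<Sum>i<n. inner g (u i) *\<^sub>R u i"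
  have gs: "inner g ?s = (\<Sum>i<n. (inner g (u i))\<^sup>2)" by (simp add: inner_sum_right power2_eq_square)
  have ss: "inner ?s ?s = (\<Sum>i<n. (inner g (u i))\<^sup>2)"
    using norm_sum_orthonormal[OF on, of "{..<n}"] by (simp add: power2_norm_eq_inner)
  have "0 \<le> inner (g - ?s) (g - ?s)" by simp
  also have "\<dots> = (norm g)\<^sup>2 - 2 * inner g ?s + inner ?s ?s"
    by (simp only: inner_diff_left inner_diff_right power2_norm_eq_inner inner_commute[of ?s g])
  finally show ?thesis unfolding gs ss by simp
qed

text \<open>Bessel's inequality makes the partial sums Cauchy. Completeness of the system is known
  inside \<open>V\<close> only, so the limit \<open>l\<close> has to be kept in \<open>V\<close>;
  then \<open>g - l\<close> is orthogonal to every \<open>u i\<close> and must vanish.\<close>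

lemma orthonormal_expansion:
  fixes u :: "nat \<Rightarrow> 'a::{real_inner, complete_space}"
  assumes on: "\<And>i j. inner (u i) (u j) = (if i = j then 1 else 0)"
    and V: "subspace V" "closed V" "\<And>i. u i \<in> V"
    and complete: "\<And>g. g \<in> V \<Longrightarrow> (\<And>i. inner g (u i) = 0) \<Longrightarrow> g = 0" and g: "g \<in> V"
  shows "(\<lambda>n. \<Sum>i<n. inner g (u i) *\<^sub>R u i) \<longlonglongrightarrow> g"
proof -
  define s where "s n = (\<Sum>i<n. inner g (u i) *\<^sub>R u i)" for n
  have sV: "s n \<in> V" for n unfolding s_def by (intro subspace_sum subspace_scale V)
  define S where "S n = (\<Sum>i<n. (inner g (u i))\<^sup>2)" for n
  have "summable (\<lambda>i. (inner g (u i))\<^sup>2)"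
  proof (rule bounded_imp_summable)
    show "(\<Sum>i\<le>n. (inner g (u i))\<^sup>2) \<le> (norm g)\<^sup>2" for n
      using bessel_inequality[OF on, of g "Suc n"] unfolding lessThan_Suc_atMost .
  qed simp
  then have "Cauchy S" unfolding S_def by (intro convergent_Cauchy) (simp add: summable_iff_convergent)
  have diff: "(norm (s n - s m))\<^sup>2 = S n - S m" if "m \<le> n" for m n
  proof -
    have "s n - s m = (\<Sum>i\<in>{m..<n}. inner g (u i) *\<^sub>R u i)"
      unfolding s_def using that by (simp add: sum_diff_nat_ivl lessThan_atLeast0)
    moreover have "S n - S m = (\<Sum>i\<in>{m..<n}. (inner g (u i))\<^sup>2)"
      unfolding S_def using that by (simp add: sum_diff_nat_ivl lessThan_atLeast0)
    ultimately show ?thesis by (simp add: norm_sum_orthonormal[OF on])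
  qed
  have "Cauchy s"
  proof (rule CauchyI')
    fix e :: real assume "e > 0"
    then have "e\<^sup>2 > 0" by simp
    then obtain K where K: "\<And>m n. m \<ge> K \<Longrightarrow> n \<ge> K \<Longrightarrow> dist (S m) (S n) < e\<^sup>2"
      using metric_CauchyD[OF \<open>Cauchy S\<close>] by blast
    have "dist (s m) (s n) < e" if "m \<ge> K" "n > m" for m n
    proof -
      have "(norm (s n - s m))\<^sup>2 < e\<^sup>2" using K[of m n] diff[of m n] that by (simp add: dist_real_def)
      then have "norm (s n - s m) < e" using \<open>e > 0\<close> by (auto intro: power2_less_imp_less)
      then show ?thesis by (simp add: dist_norm norm_minus_commute)
    qed
    then show "\<exists>K. \<forall>m\<ge>K. \<forall>n>m. dist (s m) (s n) < e" by blast
  qed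
  then obtain l where l: "s \<longlonglongrightarrow> l" using Cauchy_convergent convergent_def by blast
  have lV: "l \<in> V" using closed_sequentially[OF V(2) sV l] .
  have "inner (g - l) (u j) = 0" for j
  proof -
    have "\<forall>\<^sub>F n in sequentially. inner (s n) (u j) = inner g (u j)"
      using eventually_gt_at_top[of j]
      by eventually_elim (simp add: s_def partial_sum_inner_orthonormal[OF on])
    then have "(\<lambda>n. inner (s n) (u j)) \<longlonglongrightarrow> inner g (u j)" by (rule tendsto_eventually)
    moreover have "(\<lambda>n. inner (s n) (u j)) \<longlonglongrightarrow> inner l (u j)" using l by (intro tendsto_intros)
    ultimately show ?thesis using LIMSEQ_unique by (fastforce simp: inner_diff_left)
  qed
  then have "g - l = 0" by (intro complete subspace_diff V g lV)
  then show ?thesis using l unfolding s_def by simp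
qed

text \<open>The bound is asked of partial sums, the form in which the probabilistic estimate
  delivers it.\<close>

lemma norm_le_if_coefficients_le:
  fixes u :: "nat \<Rightarrow> 'a::{real_inner, complete_space}"
  assumes on: "\<And>i j. inner (u i) (u j) = (if i = j then 1 else 0)"
    and V: "subspace V" "closed V" "\<And>i. u i \<in> V"
    and complete: "\<And>g. g \<in> V \<Longrightarrow> (\<And>i. inner g (u i) = 0) \<Longrightarrow> g = 0" and g: "g \<in> V"
    and le: "\<And>n. (\<Sum>i<n. (inner g (u i))\<^sup>2) \<le> H"
  shows "(norm g)\<^sup>2 \<le> H"
proof (rule LIMSEQ_le_const2)
  show "(\<lambda>n. (norm (\<Sum>i<n. inner g (u i) *\<^sub>R u i))\<^sup>2) \<longlonglongrightarrow> (norm g)\<^sup>2"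
    by (intro tendsto_intros orthonormal_expansion[OF on V complete g])
  show "\<exists>N. \<forall>n\<ge>N. (norm (\<Sum>i<n. inner g (u i) *\<^sub>R u i))\<^sup>2 \<le> H"
    using le by (simp add: norm_sum_orthonormal[OF on])
qed

text \<open>The numerical range of an operator is bounded by its Hilbert-Schmidt norm.\<close>

lemma quadratic_form_le_if_coefficients_le:
  fixes u :: "nat \<Rightarrow> 'a::{real_inner, complete_space}"
  assumes on: "\<And>i j. inner (u i) (u j) = (if i = j then 1 else 0)"
    and V: "subspace V" "closed V" "\<And>i. u i \<in> V"
    and complete: "\<And>g. g \<in> V \<Longrightarrow> (\<And>i. inner g (u i) = 0) \<Longrightarrow> g = 0" and g: "g \<in> V"
    and F: "bounded_linear F"
    and le: "\<And>n. (\<Sum>i<n. \<Sum>j<n. (inner (F (u i)) (u j))\<^sup>2) \<le> H"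
  shows "\<bar>inner (F g) g\<bar> \<le> sqrt H * (norm g)\<^sup>2"
proof (rule LIMSEQ_le_const2)
  define s where "s n = (\<Sum>i<n. inner g (u i) *\<^sub>R u i)" for n
  have s: "s \<longlonglongrightarrow> g" unfolding s_def by (intro orthonormal_expansion[OF on V complete g])
  show "(\<lambda>n. \<bar>inner (F (s n)) (s n)\<bar>) \<longlonglongrightarrow> \<bar>inner (F g) g\<bar>"
    by (intro tendsto_intros s bounded_linear.tendsto[OF F])
  have "\<bar>inner (F (s n)) (s n)\<bar> \<le> sqrt H * (norm g)\<^sup>2" for n
  proof (rule abs_le_square_iff[THEN iffD2, of _ "sqrt H * (norm g)\<^sup>2", THEN order_trans])
    interpret F: bounded_linear F by (rule F)
    let ?I = "{..<n} \<times> {..<n}"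
    let ?c = "\<lambda>i. inner g (u i)"
    have H0: "0 \<le> H" using le[of 0] by simp
    have "inner (F (s n)) (s n) = (\<Sum>i<n. \<Sum>j<n. ?c i * ?c j * inner (F (u i)) (u j))"
      by (simp add: s_def F.sum F.scaleR inner_sum_left inner_sum_right sum_distrib_left mult_ac)
        (subst sum.swap, simp add: mult_ac)
    also have "\<dots> = (\<Sum>(i, j)\<in>?I. ?c i * ?c j * inner (F (u i)) (u j))"
      by (simp add: sum.cartesian_product)
    finally have "(inner (F (s n)) (s n))\<^sup>2
        = (\<Sum>p\<in>?I. (?c (fst p) * ?c (snd p)) * inner (F (u (fst p))) (u (snd p)))\<^sup>2"
      by (simp add: case_prod_beta)
    \<comment> \<open>Cauchy-Schwarz over index pairs separates the coefficients of
      \<open>g\<close>, bounded by Bessel, from the matrix of \<open>F\<close>, bounded by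
      \<open>H\<close>.\<close>
    also have "\<dots> \<le> (\<Sum>p\<in>?I. (?c (fst p) * ?c (snd p))\<^sup>2) * (\<Sum>p\<in>?I. (inner (F (u (fst p))) (u (snd p)))\<^sup>2)"
      by (rule Cauchy_Schwarz_ineq_sum)
    also have "(\<Sum>p\<in>?I. (?c (fst p) * ?c (snd p))\<^sup>2) = (\<Sum>i<n. (?c i)\<^sup>2) * (\<Sum>i<n. (?c i)\<^sup>2)"
      by (simp add: sum_product sum.cartesian_product case_prod_beta power_mult_distrib)
    also have "(\<Sum>p\<in>?I. (inner (F (u (fst p))) (u (snd p)))\<^sup>2) = (\<Sum>i<n. \<Sum>j<n. (inner (F (u i)) (u j))\<^sup>2)"
      by (simp add: sum.cartesian_product case_prod_beta)
    also have "(\<Sum>i<n. (?c i)\<^sup>2) * (\<Sum>i<n. (?c i)\<^sup>2) * (\<Sum>i<n. \<Sum>j<n. (inner (F (u i)) (u j))\<^sup>2)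
        \<le> (norm g)\<^sup>2 * (norm g)\<^sup>2 * H"
      by (intro mult_mono bessel_inequality on le) (auto intro!: sum_nonneg)
    also have "\<dots> = (sqrt H * (norm g)\<^sup>2)\<^sup>2" using H0 by (simp add: power_mult_distrib power2_eq_square)
    finally show "(inner (F (s n)) (s n))\<^sup>2 \<le> (sqrt H * (norm g)\<^sup>2)\<^sup>2" .
    show "\<bar>sqrt H * (norm g)\<^sup>2\<bar> \<le> sqrt H * (norm g)\<^sup>2" using H0 by simp
  qed
  then show "\<exists>N. \<forall>n\<ge>N. \<bar>inner (F (s n)) (s n)\<bar> \<le> sqrt H * (norm g)\<^sup>2" by blast
qed

section \<open>Rate of convergence of the empirical covariance operator\<close>

text \<open>After centring, independence removes all cross terms of the expanded square and only
  \<open>N\<close> diagonal terms remain. The variance \<open>v - \<mu>\<^sup>2\<close> is then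
  relaxed to the second moment \<open>v\<close>, which is easy to sum over coordinates.\<close>

lemma (in prob_space) sample_mean_square_error:
  fixes W :: "nat \<Rightarrow> 'a \<Rightarrow> real"
  assumes indep: "indep_vars (\<lambda>_. borel) W {1..}"
    and int: "\<And>n. n \<ge> 1 \<Longrightarrow> integrable M (\<lambda>\<omega>. (W n \<omega>)\<^sup>2)"
    and mean: "\<And>n. n \<ge> 1 \<Longrightarrow> expectation (W n) = \<mu>"
    and second: "\<And>n. n \<ge> 1 \<Longrightarrow> expectation (\<lambda>\<omega>. (W n \<omega>)\<^sup>2) = v" and "N \<ge> 1"
  shows "integrable M (\<lambda>\<omega>. ((1 / real N) * (\<Sum>n=1..N. W n \<omega>) - \<mu>)\<^sup>2)"
    and "expectation (\<lambda>\<omega>. ((1 / real N) * (\<Sum>n=1..N. W n \<omega>) - \<mu>)\<^sup>2) \<le> v / real N"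
proof -
  define U where "U = (\<lambda>n \<omega>. W n \<omega> - \<mu>)"
  have W [measurable]: "W n \<in> borel_measurable M" if "n \<ge> 1" for n
    using indep that unfolding indep_vars_def by auto
  have W1: "integrable M (W n)" if "n \<ge> 1" for n
    by (rule square_integrable_imp_integrable[OF W[OF that] int[OF that]])
  have U1: "integrable M (U n)" and U0: "expectation (U n) = 0" if "n \<ge> 1" for n
    using W1[OF that] mean[OF that] by (auto simp: U_def prob_space)
  have U_indep: "indep_vars (\<lambda>_. borel) U {1..}"
    unfolding U_def by (rule indep_vars_compose2[OF indep]) auto
  have UU: "integrable M (\<lambda>\<omega>. U n \<omega> * U m \<omega>) \<and>
      expectation (\<lambda>\<omega>. U n \<omega> * U m \<omega>) = (if n = m then v - \<mu>\<^sup>2 else 0)" if nm: "n \<ge> 1" "m \<ge> 1" for n m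
  proof (cases "n = m")
    case True
    have "(\<lambda>\<omega>. U n \<omega> * U m \<omega>) = (\<lambda>\<omega>. (W n \<omega>)\<^sup>2 - 2 * \<mu> * W n \<omega> + \<mu>\<^sup>2)"
      unfolding U_def True by (auto simp: power2_eq_square algebra_simps)
    then show ?thesis
      using int[OF nm(1)] W1[OF nm(1)] mean[OF nm(1)] second[OF nm(1)] True
      by (simp add: prob_space power2_eq_square)
  next
    case False
    have "indep_vars (\<lambda>_. borel) U {n, m}" by (rule indep_vars_subset[OF U_indep]) (use nm in auto)
    from indep_vars_lebesgue_integral[OF _ this] indep_vars_integrable[OF _ this]
    show ?thesis using False U1 U0 nm by auto
  qed
  have sq: "((1 / real N) * (\<Sum>n=1..N. W n \<omega>) - \<mu>)\<^sup>2
      = (1 / (real N)\<^sup>2) * (\<Sum>n=1..N. \<Sum>m=1..N. U n \<omega> * U m \<omega>)" for \<omega>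
  proof -
    have "(1 / real N) * (\<Sum>n=1..N. W n \<omega>) - \<mu> = (1 / real N) * (\<Sum>n=1..N. U n \<omega>)"
      using \<open>N \<ge> 1\<close> by (simp add: U_def sum_subtractf field_simps)
    then show ?thesis
      by (simp add: power_mult_distrib power_divide power2_eq_square sum_product)
  qed
  show "integrable M (\<lambda>\<omega>. ((1 / real N) * (\<Sum>n=1..N. W n \<omega>) - \<mu>)\<^sup>2)"
    unfolding sq using UU by (intro integrable_mult_right Bochner_Integration.integrable_sum) auto
  have "expectation (\<lambda>\<omega>. ((1 / real N) * (\<Sum>n=1..N. W n \<omega>) - \<mu>)\<^sup>2)
      = (1 / (real N)\<^sup>2) * (\<Sum>n=1..N. \<Sum>m=1..N. expectation (\<lambda>\<omega>. U n \<omega> * U m \<omega>))"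
  proof -
    have "expectation (\<lambda>\<omega>. \<Sum>n=1..N. \<Sum>m=1..N. U n \<omega> * U m \<omega>) = (\<Sum>n=1..N. expectation (\<lambda>\<omega>. \<Sum>m=1..N. U n \<omega> * U m \<omega>))"
      using UU by (intro Bochner_Integration.integral_sum Bochner_Integration.integrable_sum) auto
    also have "\<dots> = (\<Sum>n=1..N. \<Sum>m=1..N. expectation (\<lambda>\<omega>. U n \<omega> * U m \<omega>))"
      using UU by (intro sum.cong refl Bochner_Integration.integral_sum) auto
    finally show ?thesis unfolding sq by simp
  qed
  also have "(\<Sum>n=1..N. \<Sum>m=1..N. expectation (\<lambda>\<omega>. U n \<omega> * U m \<omega>)) = (\<Sum>n=1..N. \<Sum>m=1..N. if n = m then v - \<mu>\<^sup>2 else 0)"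
    using UU by (intro sum.cong) auto
  also have "\<dots> = real N * (v - \<mu>\<^sup>2)" by simp
  also have "(1 / (real N)\<^sup>2) * (real N * (v - \<mu>\<^sup>2)) = (v - \<mu>\<^sup>2) / real N"
    using \<open>N \<ge> 1\<close> by (simp add: power2_eq_square)
  also have "\<dots> \<le> v / real N" by (intro divide_right_mono) auto
  finally show "expectation (\<lambda>\<omega>. ((1 / real N) * (\<Sum>n=1..N. W n \<omega>) - \<mu>)\<^sup>2) \<le> v / real N" .
qed

text \<open>The events on which \<open>S n\<close> exceeds the level increase with \<open>n\<close>,
  so Markov's bound passes to their union. One event thus serves all \<open>n\<close>, as is needed
  to control an infinite sum through its partial sums.\<close>

lemma (in prob_space) Markov_inequality_incseq:
  fixes S :: "nat \<Rightarrow> 'a \<Rightarrow> real"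
  assumes int: "\<And>n. integrable M (S n)" and S0: "\<And>n \<omega>. 0 \<le> S n \<omega>"
    and mono: "\<And>n \<omega>. S n \<omega> \<le> S (Suc n) \<omega>"
    and C: "\<And>n. expectation (S n) \<le> C" "C > 0" and "\<epsilon> > 0"
  shows "\<exists>E\<in>events. prob E \<ge> 1 - \<epsilon> \<and> (\<forall>\<omega>\<in>E. \<forall>n. S n \<omega> \<le> C / \<epsilon>)"
proof -
  have [measurable]: "S n \<in> borel_measurable M" for n using int by auto
  define B where "B n = {\<omega> \<in> space M. C / \<epsilon> < S n \<omega>}" for n
  have B: "B n \<in> events" for n unfolding B_def by measurable
  have inc: "incseq B" unfolding B_def using mono by (intro incseq_SucI) (force intro: less_le_trans)
  have "prob (B n) \<le> \<epsilon>" for n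
  proof -
    have "prob (B n) \<le> prob {\<omega> \<in> space M. C / \<epsilon> \<le> S n \<omega>}"
      unfolding B_def by (intro finite_measure_mono) auto
    also have "\<dots> \<le> expectation (S n) / (C / \<epsilon>)"
      using S0 \<open>C > 0\<close> \<open>\<epsilon> > 0\<close> by (intro integral_Markov_inequality_measure[OF int sets.empty_sets]) auto
    also have "\<dots> \<le> C / (C / \<epsilon>)" using C \<open>\<epsilon> > 0\<close> by (intro divide_right_mono) auto
    finally show ?thesis using \<open>C > 0\<close> by simp
  qed
  moreover have "(\<lambda>n. prob (B n)) \<longlonglongrightarrow> prob (\<Union>n. B n)"
    using B inc by (intro finite_Lim_measure_incseq) auto
  ultimately have le: "prob (\<Union>n. B n) \<le> \<epsilon>" by (intro LIMSEQ_le_const2) auto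
  have U: "(\<Union>n. B n) \<in> events" using B by blast
  show ?thesis
  proof (intro bexI conjI ballI allI)
    show "space M - (\<Union>n. B n) \<in> events" using U by auto
    show "prob (space M - (\<Union>n. B n)) \<ge> 1 - \<epsilon>" using le by (simp add: prob_compl[OF U])
    show "S n \<omega> \<le> C / \<epsilon>" if "\<omega> \<in> space M - (\<Union>n. B n)" for n \<omega> using that by (auto simp: B_def not_less)
  qed
qed

section \<open>The empirical covariance operator\<close>

lemma bounded_linear_tensor_sq: "bounded_linear (tensor_sq x)"
  unfolding tensor_sq_def
  by (rule bounded_linear_compose[OF bounded_linear_scaleR_left bounded_linear_inner_left, unfolded comp_def])

lemma bounded_linear_sample_cov_op: "bounded_linear (sample_cov_op N x)"
  unfolding sample_cov_op_def
  by (intro bounded_linear_sub bounded_linear_sum bounded_linear_tensor_sq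
      bounded_linear_compose[OF bounded_linear_scaleR_right, unfolded comp_def])

text \<open>The form is the empirical variance of the numbers \<open>inner g (x n)\<close>;
  Cauchy-Schwarz against the constant 1 compares the squared mean with the mean of squares. For
  \<open>N = 0\<close> the factor \<open>1 / real N\<close> is 0 and the operator vanishes.\<close>

lemma inner_sample_cov_op_nonneg: "0 \<le> inner (sample_cov_op N x g) g"
proof (cases "N = 0")
  case False
  have "inner (sample_cov_op N x g) g = (1 / real N) * (\<Sum>n=1..N. (inner g (x n))\<^sup>2) - (inner g (sample_mean N x))\<^sup>2"
    by (simp add: sample_cov_op_def tensor_sq_def inner_diff_left inner_sum_left power2_eq_square
        inner_commute[of "x _" g] inner_commute[of "sample_mean N x" g])
  moreover have "(inner g (sample_mean N x))\<^sup>2 = (1 / real N)\<^sup>2 * (\<Sum>n=1..N. inner g (x n) * 1)\<^sup>2"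
    by (simp add: sample_mean_def inner_sum_right power_divide)
  moreover have "(1 / real N)\<^sup>2 * (\<Sum>n=1..N. inner g (x n) * 1)\<^sup>2
      \<le> (1 / real N)\<^sup>2 * ((\<Sum>n=1..N. (inner g (x n))\<^sup>2) * (\<Sum>n=1..N. 1\<^sup>2))"
    by (intro mult_left_mono Cauchy_Schwarz_ineq_sum) auto
  moreover have "\<dots> = (1 / real N) * (\<Sum>n=1..N. (inner g (x n))\<^sup>2)"
    using False by (simp add: power2_eq_square)
  ultimately show ?thesis by linarith
qed (simp add: sample_cov_op_def sample_mean_def tensor_sq_def)

text \<open>
  The squared Hilbert-Schmidt norm of the error has expectation at most \<open>E (norm X)^4 / N\<close>,
  computed coordinatewise in the basis \<open>u\<close>.
\<close>

lemma (in prob_space) sample_cov_op_error: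
  fixes X :: "'a \<Rightarrow> l2" and Xs :: "nat \<Rightarrow> 'a \<Rightarrow> l2" and u :: "nat \<Rightarrow> l2"
  assumes on: "\<And>i j. inner (u i) (u j) = (if i = j then 1 else 0)"
    and V: "subspace V" "closed V" "\<And>i. u i \<in> V"
    and complete: "\<And>g. g \<in> V \<Longrightarrow> (\<And>i. inner g (u i) = 0) \<Longrightarrow> g = 0"
    and X [measurable]: "X \<in> borel_measurable M"
    and X1: "integrable M X" "expectation X = 0"
    and X4: "integrable M (\<lambda>\<omega>. norm (X \<omega>) ^ 4)"
    and Xs [measurable]: "\<And>n. n \<ge> 1 \<Longrightarrow> Xs n \<in> borel_measurable M"
    and XsV: "\<And>n \<omega>. n \<ge> 1 \<Longrightarrow> \<omega> \<in> space M \<Longrightarrow> Xs n \<omega> \<in> V"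
    and indep: "indep_vars (\<lambda>_. borel) Xs {1..}"
    and ident: "\<And>n. n \<ge> 1 \<Longrightarrow> distr M borel (Xs n) = distr M borel X"
    and "\<epsilon> > 0"
  shows "\<exists>K\<ge>0. \<forall>N\<ge>1. \<exists>E\<in>events. prob E \<ge> 1 - \<epsilon> \<and> (\<forall>\<omega>\<in>E. \<forall>g\<in>V.
    \<bar>inner (sample_cov_op N (\<lambda>n. Xs n \<omega>) g - cov_op M X g) g\<bar> \<le> K / sqrt (real N) * (norm g)\<^sup>2)"
proof -
  have X2: "integrable M (\<lambda>\<omega>. (norm (X \<omega>))\<^sup>2)"
  proof (rule square_integrable_imp_integrable)
    show "integrable M (\<lambda>\<omega>. ((norm (X \<omega>))\<^sup>2)\<^sup>2)" using X4 by (simp flip: power_mult)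
  qed auto
  define m4 where "m4 = expectation (\<lambda>\<omega>. norm (X \<omega>) ^ 4)"
  define m2 where "m2 = expectation (\<lambda>\<omega>. (norm (X \<omega>))\<^sup>2)"
  \<comment> \<open>\<open>m4\<close> and \<open>m2\<close> bound the summed second moments of the
    matrix entries and of the sample mean, 1 ensures positivity, and the division by \<epsilon> is
    Markov's.\<close>
  define K0 where "K0 = (m4 + m2 + 1) / \<epsilon>"
  have m0: "0 \<le> m4" "0 \<le> m2" by (auto simp: m4_def m2_def)
  have K0: "0 < K0" using m0 \<open>\<epsilon> > 0\<close> by (simp add: K0_def)
  have transfer: "expectation (\<lambda>\<omega>. \<phi> (Xs n \<omega>)) = expectation (\<lambda>\<omega>. \<phi> (X \<omega>))"
    "integrable M (\<lambda>\<omega>. \<phi> (Xs n \<omega>)) = integrable M (\<lambda>\<omega>. \<phi> (X \<omega>))"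
    if n: "n \<ge> 1" and [measurable]: "\<phi> \<in> borel_measurable borel" for n and \<phi> :: "l2 \<Rightarrow> real"
    using integral_distr[OF Xs[OF n] that(2)] integral_distr[OF X that(2)]
      integrable_distr_eq[OF Xs[OF n] that(2)] integrable_distr_eq[OF X that(2)]
    unfolding ident[OF n] by simp_all
  have mse: "integrable M (\<lambda>\<omega>. ((1 / real N) * (\<Sum>n=1..N. \<phi> (Xs n \<omega>)) - \<mu>)\<^sup>2)"
    "expectation (\<lambda>\<omega>. ((1 / real N) * (\<Sum>n=1..N. \<phi> (Xs n \<omega>)) - \<mu>)\<^sup>2) \<le> expectation (\<lambda>\<omega>. (\<phi> (X \<omega>))\<^sup>2) / real N"
    if \<phi> [measurable]: "\<phi> \<in> borel_measurable borel" and sq: "integrable M (\<lambda>\<omega>. (\<phi> (X \<omega>))\<^sup>2)"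
      and \<mu>: "expectation (\<lambda>\<omega>. \<phi> (X \<omega>)) = \<mu>" and N: "N \<ge> 1" for \<phi> \<mu> and N :: nat
  proof -
    have "indep_vars (\<lambda>_. borel) (\<lambda>n \<omega>. \<phi> (Xs n \<omega>)) {1..}"
      by (rule indep_vars_compose2[OF indep]) (rule \<phi>)
    note * = sample_mean_square_error[OF this, of \<mu> "expectation (\<lambda>\<omega>. (\<phi> (X \<omega>))\<^sup>2)", OF _ _ _ N]
    show "integrable M (\<lambda>\<omega>. ((1 / real N) * (\<Sum>n=1..N. \<phi> (Xs n \<omega>)) - \<mu>)\<^sup>2)"
      by (rule *) (use transfer(1)[OF _ \<phi>] transfer[of _ "\<lambda>x. (\<phi> x)\<^sup>2"] sq \<mu> in auto)
    show "expectation (\<lambda>\<omega>. ((1 / real N) * (\<Sum>n=1..N. \<phi> (Xs n \<omega>)) - \<mu>)\<^sup>2) \<le> expectation (\<lambda>\<omega>. (\<phi> (X \<omega>))\<^sup>2) / real N"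
      by (rule *) (use transfer(1)[OF _ \<phi>] transfer[of _ "\<lambda>x. (\<phi> x)\<^sup>2"] sq \<mu> in auto)
  qed
  \<comment> \<open>\<open>F\<close> is the error before the correction by the sample mean, so its
    matrix entries are centred averages of i.i.d. variables. The rank-one correction is estimated
    separately, through the norm of the sample mean.\<close>
  define F where "F N \<omega> g = (1 / real N) *\<^sub>R (\<Sum>n=1..N. tensor_sq (Xs n \<omega>) g) - cov_op M X g" for N \<omega> g
  define \<mu> where "\<mu> i j = inner (cov_op M X (u i)) (u j)" for i j
  have Fij: "inner (F N \<omega> (u i)) (u j) = (1 / real N) * (\<Sum>n=1..N. inner (u i) (Xs n \<omega>) * inner (u j) (Xs n \<omega>)) - \<mu> i j"
    for N \<omega> i j
    by (simp add: F_def \<mu>_def tensor_sq_def inner_diff_left inner_sum_left inner_commute[of "Xs _ _" "u _"])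
  have mi: "inner (sample_mean N (\<lambda>n. Xs n \<omega>)) (u i) = (1 / real N) * (\<Sum>n=1..N. inner (u i) (Xs n \<omega>)) - 0" for N \<omega> i
    by (simp add: sample_mean_def inner_sum_left inner_commute[of "Xs _ _" "u _"])
  have coord_le: "(inner (u i) x)\<^sup>2 \<le> (norm x)\<^sup>2" for i and x :: l2
  proof -
    have "norm (u i) = 1" using on[of i i] by (simp add: norm_eq_sqrt_inner)
    then have "\<bar>inner (u i) x\<bar> \<le> norm x" using Cauchy_Schwarz_ineq2[of "u i" x] by simp
    then show ?thesis by (metis abs_le_square_iff abs_norm_cancel)
  qed
  have sq1: "integrable M (\<lambda>\<omega>. (inner (u i) (X \<omega>))\<^sup>2)" for i
    by (rule Bochner_Integration.integrable_bound[OF X2]) (use coord_le in auto)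
  have sq2: "integrable M (\<lambda>\<omega>. (inner (u i) (X \<omega>) * inner (u j) (X \<omega>))\<^sup>2)" for i j
  proof (rule Bochner_Integration.integrable_bound[OF X4])
    have "(inner (u i) x)\<^sup>2 * (inner (u j) x)\<^sup>2 \<le> (norm x)\<^sup>2 * (norm x)\<^sup>2" for x :: l2
      by (intro mult_mono coord_le) auto
    then show "AE \<omega> in M. norm ((inner (u i) (X \<omega>) * inner (u j) (X \<omega>))\<^sup>2) \<le> norm (norm (X \<omega>) ^ 4)"
      by (simp add: power_mult_distrib flip: power_add)
  qed simp
  have err2: "integrable M (\<lambda>\<omega>. (inner (F N \<omega> (u i)) (u j))\<^sup>2)"
    "expectation (\<lambda>\<omega>. (inner (F N \<omega> (u i)) (u j))\<^sup>2) \<le> expectation (\<lambda>\<omega>. (inner (u i) (X \<omega>) * inner (u j) (X \<omega>))\<^sup>2) / real N"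
    if N: "N \<ge> 1" for N i j
  proof -
    have \<mu>: "expectation (\<lambda>\<omega>. inner (u i) (X \<omega>) * inner (u j) (X \<omega>)) = \<mu> i j"
      unfolding \<mu>_def by (rule inner_cov_op[OF X X2, symmetric])
    have "(\<lambda>x. inner (u i) x * inner (u j) x) \<in> borel_measurable borel" by measurable
    from mse[OF this sq2 \<mu> N]
    show "integrable M (\<lambda>\<omega>. (inner (F N \<omega> (u i)) (u j))\<^sup>2)"
      "expectation (\<lambda>\<omega>. (inner (F N \<omega> (u i)) (u j))\<^sup>2) \<le> expectation (\<lambda>\<omega>. (inner (u i) (X \<omega>) * inner (u j) (X \<omega>))\<^sup>2) / real N"
      unfolding Fij .
  qed
  have err1: "integrable M (\<lambda>\<omega>. (inner (sample_mean N (\<lambda>n. Xs n \<omega>)) (u i))\<^sup>2)"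
    "expectation (\<lambda>\<omega>. (inner (sample_mean N (\<lambda>n. Xs n \<omega>)) (u i))\<^sup>2) \<le> expectation (\<lambda>\<omega>. (inner (u i) (X \<omega>))\<^sup>2) / real N"
    if N: "N \<ge> 1" for N i
  proof -
    have \<mu>: "expectation (\<lambda>\<omega>. inner (u i) (X \<omega>)) = 0" using X1 by simp
    have "(\<lambda>x. inner (u i) x) \<in> borel_measurable borel" by measurable
    from mse[OF this sq1 \<mu> N]
    show "integrable M (\<lambda>\<omega>. (inner (sample_mean N (\<lambda>n. Xs n \<omega>)) (u i))\<^sup>2)"
      "expectation (\<lambda>\<omega>. (inner (sample_mean N (\<lambda>n. Xs n \<omega>)) (u i))\<^sup>2) \<le> expectation (\<lambda>\<omega>. (inner (u i) (X \<omega>))\<^sup>2) / real N"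
      unfolding mi .
  qed
  \<comment> \<open>Bessel's inequality, used twice at each \<omega>, bounds the double sum by the
    fourth power of the norm, uniformly in \<open>k\<close>.\<close>
  have sum4: "(\<Sum>i<k. \<Sum>j<k. expectation (\<lambda>\<omega>. (inner (u i) (X \<omega>) * inner (u j) (X \<omega>))\<^sup>2)) \<le> m4" for k
  proof -
    have "(\<Sum>i<k. \<Sum>j<k. expectation (\<lambda>\<omega>. (inner (u i) (X \<omega>) * inner (u j) (X \<omega>))\<^sup>2))
        = expectation (\<lambda>\<omega>. \<Sum>i<k. \<Sum>j<k. (inner (u i) (X \<omega>) * inner (u j) (X \<omega>))\<^sup>2)"
      using sq2 by (simp add: Bochner_Integration.integral_sum)
    also have "\<dots> \<le> m4" unfolding m4_def
    proof (rule integral_mono)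
      fix \<omega>
      have "(\<Sum>i<k. \<Sum>j<k. (inner (u i) (X \<omega>) * inner (u j) (X \<omega>))\<^sup>2)
          = (\<Sum>i<k. (inner (X \<omega>) (u i))\<^sup>2) * (\<Sum>i<k. (inner (X \<omega>) (u i))\<^sup>2)"
        by (simp add: sum_product power_mult_distrib inner_commute)
      also have "\<dots> \<le> (norm (X \<omega>))\<^sup>2 * (norm (X \<omega>))\<^sup>2"
        by (intro mult_mono bessel_inequality on) (auto intro!: sum_nonneg)
      finally show "(\<Sum>i<k. \<Sum>j<k. (inner (u i) (X \<omega>) * inner (u j) (X \<omega>))\<^sup>2) \<le> norm (X \<omega>) ^ 4"
        by (simp flip: power_add)
    qed (use sq2 X4 in auto)
    finally show ?thesis .
  qed
  have sum2: "(\<Sum>i<k. expectation (\<lambda>\<omega>. (inner (u i) (X \<omega>))\<^sup>2)) \<le> m2" for k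
  proof -
    have "(\<Sum>i<k. expectation (\<lambda>\<omega>. (inner (u i) (X \<omega>))\<^sup>2)) = expectation (\<lambda>\<omega>. \<Sum>i<k. (inner (u i) (X \<omega>))\<^sup>2)"
      using sq1 by (simp add: Bochner_Integration.integral_sum)
    also have "\<dots> \<le> m2" unfolding m2_def
      using sq1 X2 bessel_inequality[OF on]
      by (intro integral_mono) (auto simp: inner_commute[of "u _"])
    finally show ?thesis .
  qed
  \<comment> \<open>The two sums approximate the squared Hilbert-Schmidt norm of \<open>F\<close>
    and the squared norm of the sample mean. Added up they are increasing in \<open>k\<close>, so
    one event controls both.\<close>
  define S where "S N k \<omega> = (\<Sum>i<k. \<Sum>j<k. (inner (F N \<omega> (u i)) (u j))\<^sup>2)
      + (\<Sum>i<k. (inner (sample_mean N (\<lambda>n. Xs n \<omega>)) (u i))\<^sup>2)" for N k \<omega>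
  show ?thesis
  proof (intro exI[of _ "sqrt K0 + K0"] conjI allI impI)
    show "0 \<le> sqrt K0 + K0" using K0 by simp
    fix N :: nat assume N: "N \<ge> 1"
    let ?C = "(m4 + m2 + 1) / real N"
    have "\<exists>E\<in>events. prob E \<ge> 1 - \<epsilon> \<and> (\<forall>\<omega>\<in>E. \<forall>k. S N k \<omega> \<le> ?C / \<epsilon>)"
    proof (rule Markov_inequality_incseq)
      show "integrable M (S N k)" for k
        unfolding S_def[abs_def] using err1[OF N] err2[OF N]
        by (intro Bochner_Integration.integrable_add Bochner_Integration.integrable_sum) auto
      show "0 \<le> S N k \<omega>" for k \<omega> unfolding S_def by (intro add_nonneg_nonneg sum_nonneg) auto
      show "S N k \<omega> \<le> S N (Suc k) \<omega>" for k \<omega>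
        unfolding S_def by (intro add_mono sum_mono2 order_trans[OF sum_mono sum_mono2])
          (auto intro!: sum_mono2 sum_nonneg add_nonneg_nonneg)
      have "expectation (S N k) = (\<Sum>i<k. \<Sum>j<k. expectation (\<lambda>\<omega>. (inner (F N \<omega> (u i)) (u j))\<^sup>2))
          + (\<Sum>i<k. expectation (\<lambda>\<omega>. (inner (sample_mean N (\<lambda>n. Xs n \<omega>)) (u i))\<^sup>2))" for k
        unfolding S_def[abs_def] using err1[OF N] err2[OF N]
        by (simp add: Bochner_Integration.integral_sum Bochner_Integration.integrable_sum)
      also have "\<dots> k \<le> (\<Sum>i<k. \<Sum>j<k. expectation (\<lambda>\<omega>. (inner (u i) (X \<omega>) * inner (u j) (X \<omega>))\<^sup>2) / real N)
          + (\<Sum>i<k. expectation (\<lambda>\<omega>. (inner (u i) (X \<omega>))\<^sup>2) / real N)" for k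
        by (intro add_mono sum_mono err1 err2 N)
      also have "\<dots> k = ((\<Sum>i<k. \<Sum>j<k. expectation (\<lambda>\<omega>. (inner (u i) (X \<omega>) * inner (u j) (X \<omega>))\<^sup>2))
          + (\<Sum>i<k. expectation (\<lambda>\<omega>. (inner (u i) (X \<omega>))\<^sup>2))) / real N" for k
        by (simp add: add_divide_distrib sum_divide_distrib)
      also have "\<dots> k \<le> ?C" for k
        using sum4[of k] sum2[of k] by (intro divide_right_mono) auto
      finally show "expectation (S N k) \<le> ?C" for k .
      show "?C > 0" using m0 N by simp
    qed (rule \<open>\<epsilon> > 0\<close>)
    then obtain E where E: "E \<in> events" "prob E \<ge> 1 - \<epsilon>" and SE: "\<And>\<omega> k. \<omega> \<in> E \<Longrightarrow> S N k \<omega> \<le> K0 / real N"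
      by (auto simp: K0_def mult.commute)
    show "\<exists>E\<in>events. prob E \<ge> 1 - \<epsilon> \<and> (\<forall>\<omega>\<in>E. \<forall>g\<in>V.
      \<bar>inner (sample_cov_op N (\<lambda>n. Xs n \<omega>) g - cov_op M X g) g\<bar> \<le> (sqrt K0 + K0) / sqrt (real N) * (norm g)\<^sup>2)"
    proof (intro bexI[OF _ E(1)] conjI E(2) ballI)
      fix \<omega> g assume \<omega>: "\<omega> \<in> E" and g: "g \<in> V"
      let ?m = "sample_mean N (\<lambda>n. Xs n \<omega>)"
      have \<omega>M: "\<omega> \<in> space M" using sets.sets_into_space[OF E(1)] \<omega> by blast
      have le2: "(\<Sum>i<k. \<Sum>j<k. (inner (F N \<omega> (u i)) (u j))\<^sup>2) \<le> K0 / real N" for k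
      proof -
        have "0 \<le> (\<Sum>i<k. (inner ?m (u i))\<^sup>2)" by (intro sum_nonneg) auto
        then show ?thesis using SE[OF \<omega>, of k] unfolding S_def by linarith
      qed
      have le1: "(\<Sum>i<k. (inner ?m (u i))\<^sup>2) \<le> K0 / real N" for k
      proof -
        have "0 \<le> (\<Sum>i<k. \<Sum>j<k. (inner (F N \<omega> (u i)) (u j))\<^sup>2)" by (intro sum_nonneg) auto
        then show ?thesis using SE[OF \<omega>, of k] unfolding S_def by linarith
      qed
      have "bounded_linear (F N \<omega>)" unfolding F_def
        by (intro bounded_linear_sub bounded_linear_sum bounded_linear_tensor_sq bounded_linear_cov_op X X2
            bounded_linear_compose[OF bounded_linear_scaleR_right, unfolded comp_def])
      from quadratic_form_le_if_coefficients_le[OF on V complete g this le2]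
      have 1: "\<bar>inner (F N \<omega> g) g\<bar> \<le> sqrt (K0 / real N) * (norm g)\<^sup>2" .
      have "?m \<in> V" unfolding sample_mean_def
        using XsV \<omega>M by (intro subspace_scale subspace_sum V) auto
      from norm_le_if_coefficients_le[OF on V complete this le1]
      have "(norm ?m)\<^sup>2 \<le> K0 / real N" .
      then have 2: "(inner g ?m)\<^sup>2 \<le> K0 / real N * (norm g)\<^sup>2"
        using Cauchy_Schwarz_ineq[of g ?m] mult_left_mono[of "(norm ?m)\<^sup>2" "K0 / real N" "(norm g)\<^sup>2"]
        by (simp add: power2_norm_eq_inner mult.commute)
      have "sample_cov_op N (\<lambda>n. Xs n \<omega>) g - cov_op M X g = F N \<omega> g - tensor_sq ?m g"
        by (simp add: sample_cov_op_def F_def)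
      then have "\<bar>inner (sample_cov_op N (\<lambda>n. Xs n \<omega>) g - cov_op M X g) g\<bar> \<le> \<bar>inner (F N \<omega> g) g\<bar> + (inner g ?m)\<^sup>2"
        using abs_triangle_ineq4[of "inner (F N \<omega> g) g" "inner (tensor_sq ?m g) g"]
        by (simp add: inner_diff_left tensor_sq_def power2_eq_square inner_commute[of ?m g])
      also have "\<dots> \<le> sqrt (K0 / real N) * (norm g)\<^sup>2 + K0 / real N * (norm g)\<^sup>2"
        using 1 2 by (rule add_mono)
      \<comment> \<open>The mean correction has order 1/N, which is absorbed by the slower rate
        1/sqrt N.\<close>
      also have "\<dots> \<le> sqrt K0 / sqrt (real N) * (norm g)\<^sup>2 + K0 / sqrt (real N) * (norm g)\<^sup>2"
      proof (intro add_mono mult_right_mono)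
        have "sqrt (real N) * 1 \<le> sqrt (real N) * sqrt (real N)" using N by (intro mult_left_mono) auto
        then show "K0 / real N \<le> K0 / sqrt (real N)" using K0 N by (intro divide_left_mono) auto
      qed (simp_all add: real_sqrt_divide)
      finally show "\<bar>inner (sample_cov_op N (\<lambda>n. Xs n \<omega>) g - cov_op M X g) g\<bar> \<le> (sqrt K0 + K0) / sqrt (real N) * (norm g)\<^sup>2"
        by (simp add: add_divide_distrib distrib_right)
    qed
  qed
qed

section \<open>Convergence in probability of the maximiser\<close>

text \<open>The events in the hypothesis depend on \<open>e\<close>, while the conclusion needs one
  sequence for all \<open>e\<close>. It is chosen to come within \<open>1 / real (Suc N)\<close> of
  the supremum of the probabilities of admissible events, a supremum that need not be
  attained.\<close>

lemma (in prob_space) with_prob_to_1I: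
  assumes "\<And>e. e > 0 \<Longrightarrow> \<forall>\<^sub>F N in sequentially. \<exists>E\<in>events. prob E \<ge> 1 - e \<and> (\<forall>\<omega>\<in>E. P N \<omega>)"
  shows "with_prob_to_1 M P"
proof -
  define \<E> where "\<E> N = {E \<in> events. \<forall>\<omega>\<in>E. P N \<omega>}" for N
  define p where "p N = Sup (prob ` \<E> N)" for N
  have ne: "prob ` \<E> N \<noteq> {}" for N by (auto simp: \<E>_def intro!: exI[of _ "{}"])
  have bdd: "bdd_above (prob ` \<E> N)" for N by (rule bdd_aboveI[of _ 1]) auto
  have "\<exists>E\<in>\<E> N. p N - 1 / real (Suc N) < prob E" for N
    using less_cSup_iff[OF ne bdd, of "p N - 1 / real (Suc N)" N] by (auto simp: p_def)
  then obtain E where E: "\<And>N. E N \<in> \<E> N" and pE: "\<And>N. p N - 1 / real (Suc N) < prob (E N)" by metis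
  have "(\<lambda>N. prob (E N)) \<longlonglongrightarrow> 1"
  proof (rule tendstoI)
    fix e :: real assume "e > 0"
    then have e2: "e / 2 > 0" by simp
    have "\<forall>\<^sub>F N in sequentially. 1 / real (Suc N) < e / 2"
      using order_tendstoD(2)[OF LIMSEQ_inverse_real_of_nat e2] by (simp add: inverse_eq_divide)
    with assms[OF e2] show "\<forall>\<^sub>F N in sequentially. dist (prob (E N)) 1 < e"
    proof eventually_elim
      case (elim N)
      then obtain F where F: "F \<in> \<E> N" "prob F \<ge> 1 - e / 2" by (auto simp: \<E>_def)
      have "prob F \<le> p N" unfolding p_def by (intro cSup_upper bdd imageI F)
      then have "1 - e < prob (E N)" using F(2) pE[of N] elim by linarith
      then show ?case by (simp add: dist_real_def)
    qed
  qed
  then show ?thesis using E unfolding with_prob_to_1_def \<E>_def by blast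
qed

lemma (in prob_space) with_prob_to_1D:
  assumes "with_prob_to_1 M P" and "e > 0"
  shows "\<forall>\<^sub>F N in sequentially. \<exists>E\<in>events. prob E \<ge> 1 - e \<and> (\<forall>\<omega>\<in>E. P N \<omega>)"
proof -
  obtain E where E: "\<And>N. E N \<in> events" "\<And>N \<omega>. \<omega> \<in> E N \<Longrightarrow> P N \<omega>" and lim: "(\<lambda>N. prob (E N)) \<longlonglongrightarrow> 1"
    using assms(1) unfolding with_prob_to_1_def by blast
  have "\<forall>\<^sub>F N in sequentially. 1 - e < prob (E N)" using \<open>e > 0\<close> by (intro order_tendstoD[OF lim]) simp
  then show ?thesis
  proof eventually_elim
    case (elim N)
    then show ?case using E(1)[of N] E(2)[of _ N] by (intro bexI[of _ "E N"]) auto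
  qed
qed

lemma (in prob_space) prob_Int_ge:
  assumes "E \<in> events" "F \<in> events" "prob E \<ge> 1 - e" "prob F \<ge> 1 - f"
  shows "prob (E \<inter> F) \<ge> 1 - (e + f)"
proof -
  have "prob (E \<union> F) = prob E + prob F - prob (E \<inter> F)"
    using assms by (intro measure_Un3) (auto simp: fmeasurable_eq_sets)
  then show ?thesis using prob_le_1[of "E \<union> F"] assms by linarith
qed

text \<open>Carries deterministic implications over to events; each of the two premises is allowed
  half of the failure probability.\<close>

lemma (in prob_space) with_prob_to_1_conj_mono:
  assumes P: "with_prob_to_1 M P" and Q: "with_prob_to_1 M Q"
    and imp: "\<forall>\<^sub>F N in sequentially. \<forall>\<omega>\<in>space M. P N \<omega> \<longrightarrow> Q N \<omega> \<longrightarrow> R N \<omega>"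
  shows "with_prob_to_1 M R"
proof (rule with_prob_to_1I)
  fix e :: real assume "e > 0"
  then have e2: "e / 2 > 0" by simp
  from with_prob_to_1D[OF P e2] with_prob_to_1D[OF Q e2] imp
  show "\<forall>\<^sub>F N in sequentially. \<exists>E\<in>events. prob E \<ge> 1 - e \<and> (\<forall>\<omega>\<in>E. R N \<omega>)"
  proof eventually_elim
    case (elim N)
    then obtain E F where E: "E \<in> events" "prob E \<ge> 1 - e / 2" "\<forall>\<omega>\<in>E. P N \<omega>"
      and F: "F \<in> events" "prob F \<ge> 1 - e / 2" "\<forall>\<omega>\<in>F. Q N \<omega>" by blast
    have "prob (E \<inter> F) \<ge> 1 - e" using prob_Int_ge[OF E(1) F(1) E(2) F(2)] by simp
    moreover have "E \<subseteq> space M" by (rule sets.sets_into_space[OF E(1)])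
    moreover have "\<forall>\<omega>\<in>E \<inter> F. R N \<omega>" using E(3) F(3) elim(3) calculation(2) by blast
    ultimately show ?case using sets.Int[OF E(1) F(1)] by blast
  qed
qed

section \<open>Deterministic comparison of maximisers\<close>

text \<open>The supremum in \<open>op_norm_on\<close> says something only if the set is bounded
  above. Continuity at 0 and homogeneity give the bound \<open>2 / \<delta>\<close>, and scaling
  \<open>g\<close> to norm 1 does the rest.\<close>

lemma op_norm_on_bound:
  assumes V: "subspace V" and "continuous_on V A" "\<And>r f. f \<in> V \<Longrightarrow> A (r *\<^sub>R f) = r *\<^sub>R A f"
    and g: "g \<in> V"
  shows "norm (A g) \<le> op_norm_on V A * norm g"
proof (cases "g = 0")
  case True
  then show ?thesis using assms(3)[OF g, of 0] by simp
next
  case False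
  have V0: "0 \<in> V" by (rule subspace_0[OF V])
  have A0: "A 0 = 0" using assms(3)[OF V0, of 0] by simp
  obtain \<delta> where \<delta>: "\<delta> > 0" "\<And>f. f \<in> V \<Longrightarrow> dist f 0 < \<delta> \<Longrightarrow> dist (A f) (A 0) < 1"
    using assms(2) V0 unfolding continuous_on_iff by (metis zero_less_one)
  have "norm (A f) \<le> 2 / \<delta>" if f: "f \<in> V" "norm f \<le> 1" for f
  proof -
    have "dist ((\<delta> / 2) *\<^sub>R f) 0 < \<delta>" using f(2) \<delta>(1) mult_left_mono[of "norm f" 1 "\<delta> / 2"] by simp
    then have "norm (A ((\<delta> / 2) *\<^sub>R f)) < 1" using \<delta>(2)[OF subspace_scale[OF V f(1)]] A0 by simp
    then show ?thesis using \<delta>(1) assms(3)[OF f(1)] by (simp add: field_simps)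
  qed
  then have bdd: "bdd_above ((\<lambda>f. norm (A f)) ` {f \<in> V. norm f \<le> 1})" by (intro bdd_aboveI[of _ "2 / \<delta>"]) auto
  have "norm (A ((1 / norm g) *\<^sub>R g)) \<le> op_norm_on V A"
    unfolding op_norm_on_def using False subspace_scale[OF V g] by (intro cSUP_upper bdd) auto
  then show ?thesis using False assms(3)[OF g] by (simp add: field_simps)
qed

text \<open>Numerator and denominator are both homogeneous of degree 2. This allows a maximiser to
  be rescaled until its \<Gamma>X-product with \<open>a 1\<close> is 1.\<close>

lemma is_max_point_scaleR:
  assumes "c < d" and "is_max_point c d GE GX \<alpha> b" and "r \<noteq> 0"
    and hom: "\<And>r x. x \<in> l2_on {c..d} \<Longrightarrow> GE (r *\<^sub>R x) = r *\<^sub>R GE x" "\<And>r x. x \<in> l2_on {c..d} \<Longrightarrow> GX (r *\<^sub>R x) = r *\<^sub>R GX x"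
  shows "is_max_point c d GE GX \<alpha> (r *\<^sub>R b)"
proof -
  have b: "b \<in> sobolev2 c d" using assms(2) by (simp add: is_max_point_def)
  then have bV: "b \<in> l2_on {c..d}" using sobolev2_subset by blast
  have forms: "inner (GE (r *\<^sub>R b)) (r *\<^sub>R b) = r\<^sup>2 * inner (GE b) b"
    "inner (GX (r *\<^sub>R b)) (r *\<^sub>R b) = r\<^sup>2 * inner (GX b) b"
    by (rule quadratic_form_scaleR[OF hom(1) bV] quadratic_form_scaleR[OF hom(2) bV]; assumption)+
  have "penalized_quotient c d GE GX \<alpha> (r *\<^sub>R b)
      = (r\<^sup>2 * inner (GE b) b) / (r\<^sup>2 * (inner (GX b) b + \<alpha> * roughness c d b b))"
    unfolding penalized_quotient_def forms roughness_scaleR[OF \<open>c < d\<close> b] by (simp add: distrib_left mult_ac)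
  also have "\<dots> = penalized_quotient c d GE GX \<alpha> b"
    unfolding penalized_quotient_def using \<open>r \<noteq> 0\<close> by simp
  finally show ?thesis using assms(2) \<open>r \<noteq> 0\<close> sobolev2_scaleR[OF b] by (simp add: is_max_point_def)
qed

text \<open>
  A maximiser \<open>b\<close> of the perturbed quotient satisfies \<open>inner (GE b) b \<ge> m * inner (GX b) b\<close> with
  \<open>m\<close> close to \<open>\<mu>1\<close>. In the decomposition \<open>b = s *\<^sub>R a1 + w\<close> with \<open>w\<close> orthogonal to \<open>a1\<close> for the form
  of \<open>GX\<close>, this is incompatible with \<open>w\<close> large, as the form of \<open>GE\<close> is at most \<open>\<mu>2\<close> on \<open>w\<close>.
\<close>

lemma penalized_maximiser_near_eigenvector:
  fixes GE GX EN XN :: "l2 \<Rightarrow> l2"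
  assumes "c < d" and "\<alpha> > 0" and "\<rho> > 0" and \<theta>: "0 < \<theta>" "\<theta> < 1"
    and lin: "bounded_linear GE" "bounded_linear GX"
    and sym: "\<And>f g. inner (GE f) g = inner (GE g) f" "\<And>f g. inner (GX f) g = inner (GX g) f"
    and posdef: "\<And>g. g \<in> l2_on {c..d} \<Longrightarrow> g \<noteq> 0 \<Longrightarrow> inner (GX g) g > 0"
    and a1: "a1 \<in> sobolev2 c d" "inner (GX a1) a1 = 1" "GE a1 = \<mu>1 *\<^sub>R GX a1"
    and gap: "\<And>g. g \<in> l2_on {c..d} \<Longrightarrow> inner (GX g) a1 = 0 \<Longrightarrow> inner (GE g) g \<le> \<mu>2 * inner (GX g) g"
    and Q: "\<And>g. Q g = inner (GX g) g + \<alpha> * roughness c d g g"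
    and coercive: "\<And>g. g \<in> sobolev2 c d \<Longrightarrow> \<rho> * (norm g)\<^sup>2 \<le> Q g"
    and errE: "\<And>g. g \<in> sobolev2 c d \<Longrightarrow> \<bar>inner (EN g) g - inner (GE g) g\<bar> \<le> \<theta> * Q g"
    and errX: "\<And>g. g \<in> sobolev2 c d \<Longrightarrow> \<bar>inner (XN g) g - inner (GX g) g\<bar> \<le> \<theta> * Q g"
    and Qa1: "Q a1 \<le> 1 + \<theta>"
    and m: "m = (1 - \<theta>) * ((\<mu>1 - \<theta> * (1 + \<theta>)) / (1 + \<theta>)\<^sup>2) - \<theta>" "0 \<le> \<mu>2" "\<mu>2 < m"
    and EN: "continuous_on (l2_on {c..d}) EN" "\<And>r x. x \<in> l2_on {c..d} \<Longrightarrow> EN (r *\<^sub>R x) = r *\<^sub>R EN x"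
    and XN: "continuous_on (l2_on {c..d}) XN" "\<And>r x. x \<in> l2_on {c..d} \<Longrightarrow> XN (r *\<^sub>R x) = r *\<^sub>R XN x"
    and XN0: "\<And>x. x \<in> l2_on {c..d} \<Longrightarrow> 0 \<le> inner (XN x) x"
  shows "(\<exists>b. is_max_point c d EN XN \<alpha> b \<and> inner (GX b) a1 = 1) \<and>
    (\<forall>b. is_max_point c d EN XN \<alpha> b \<and> inner (GX b) a1 = 1 \<longrightarrow>
      inner (GX (b - a1)) (b - a1) \<le> (\<mu>1 - m) / (m - \<mu>2))"
proof -
  interpret GE: bounded_linear GE by (rule lin)
  interpret GX: bounded_linear GX by (rule lin)
  let ?S = "sobolev2 c d" and ?V = "l2_on {c..d}"
  have SV: "x \<in> ?S \<Longrightarrow> x \<in> ?V" for x using sobolev2_subset by blast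
  have Q0: "0 \<le> Q g" if "g \<in> ?S" for g
  proof -
    have "0 \<le> \<rho> * (norm g)\<^sup>2" using \<open>\<rho> > 0\<close> by simp
    then show ?thesis using coercive[OF that] by linarith
  qed
  have QN_ge: "(1 - \<theta>) * Q g \<le> inner (XN g) g + \<alpha> * roughness c d g g"
    and QN_le: "inner (XN g) g + \<alpha> * roughness c d g g \<le> (1 + \<theta>) * Q g" if "g \<in> ?S" for g
    using errX[OF that] Q[of g] by (simp_all add: algebra_simps abs_le_iff)
  have coerciveN: "((1 - \<theta>) * \<rho>) * (norm g)\<^sup>2 \<le> inner (XN g) g + \<alpha> * roughness c d g g" if "g \<in> ?S" for g
  proof -
    have "(1 - \<theta>) * (\<rho> * (norm g)\<^sup>2) \<le> (1 - \<theta>) * Q g"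
      using \<theta> by (intro mult_left_mono coercive[OF that]) auto
    also note QN_ge[OF that]
    finally show ?thesis by (simp only: mult.assoc)
  qed
  have QN_pos: "inner (XN g) g + \<alpha> * roughness c d g g > 0" if "g \<in> ?S" "g \<noteq> 0" for g
  proof -
    have "((1 - \<theta>) * \<rho>) * (norm g)\<^sup>2 > 0" using \<theta> \<open>\<rho> > 0\<close> that by simp
    then show ?thesis using coerciveN[OF that(1)] by linarith
  qed
  \<comment> \<open>\<open>\<gamma>0\<close> is a lower bound for the perturbed quotient at
    \<open>a1\<close>: with \<open>Q a1 \<le> 1 + \<theta>\<close> the numerator loses at most
    \<theta>(1 + \<theta>), and the denominator is at most the square of 1 + \<theta>. Replacing
    both forms at the maximiser by the true ones costs the factor 1 - \<theta> and the summand
    \<theta> in \<open>m\<close>.\<close>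
  define \<gamma>0 where "\<gamma>0 = (\<mu>1 - \<theta> * (1 + \<theta>)) / (1 + \<theta>)\<^sup>2"
  have m': "m = (1 - \<theta>) * \<gamma>0 - \<theta>" using m(1) by (simp add: \<gamma>0_def)
  have "0 < (1 - \<theta>) * \<gamma>0" using m m' \<theta> by linarith
  then have \<gamma>0: "\<gamma>0 > 0" using \<theta> by (simp add: zero_less_mult_iff)
  then have num0: "\<mu>1 - \<theta> * (1 + \<theta>) > 0" using \<theta> by (simp add: \<gamma>0_def zero_less_divide_iff)
  have a10: "a1 \<noteq> 0" using a1(2) GX.zero by auto
  have num: "\<mu>1 - \<theta> * (1 + \<theta>) \<le> inner (EN a1) a1"
  proof -
    have "\<theta> * Q a1 \<le> \<theta> * (1 + \<theta>)" using Qa1 \<theta> by (intro mult_left_mono) auto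
    moreover have "inner (GE a1) a1 = \<mu>1" using a1 by simp
    ultimately show ?thesis using errE[OF a1(1)] by (simp add: abs_le_iff)
  qed
  have quot: "\<gamma>0 \<le> penalized_quotient c d EN XN \<alpha> a1"
    unfolding \<gamma>0_def penalized_quotient_def
  proof (rule frac_le)
    have "(1 + \<theta>) * Q a1 \<le> (1 + \<theta>) * (1 + \<theta>)" using Qa1 \<theta> by (intro mult_left_mono) auto
    then show "inner (XN a1) a1 + \<alpha> * roughness c d a1 a1 \<le> (1 + \<theta>)\<^sup>2"
      using QN_le[OF a1(1)] by (simp add: power2_eq_square)
  qed (use num num0 QN_pos[OF a1(1) a10] in auto)
  have key: "(m - \<mu>2) * inner (GX (b - s *\<^sub>R a1)) (b - s *\<^sub>R a1) \<le> (\<mu>1 - m) * s\<^sup>2"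
    if b: "is_max_point c d EN XN \<alpha> b" and s: "s = inner (GX b) a1" for b s
  proof -
    have bS: "b \<in> ?S" and b0: "b \<noteq> 0"
      and max: "penalized_quotient c d EN XN \<alpha> a1 \<le> penalized_quotient c d EN XN \<alpha> b"
      using b a1(1) a10 by (auto simp: is_max_point_def)
    define w where "w = b - s *\<^sub>R a1"
    have bw: "b = s *\<^sub>R a1 + w" by (simp add: w_def)
    have wV: "w \<in> ?V" unfolding w_def
      by (intro subspace_diff subspace_scale subspace_l2_on SV bS a1)
    have wa: "inner (GX w) a1 = 0" using a1(2) s by (simp add: w_def GX.diff GX.scaleR inner_diff_left)
    have aw: "inner (GX a1) w = 0" using wa sym(2)[of a1 w] by simp
    \<comment> \<open>The eigenvector equation turns \<Gamma>X-orthogonality into orthogonality for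
      the form of \<open>GE\<close>, so neither form has a cross term.\<close>
    have wEa: "inner (GE w) a1 = 0" using aw a1(3) sym(1)[of w a1] by simp
    have GXb: "inner (GX b) b = s\<^sup>2 + inner (GX w) w"
      unfolding bw by (simp add: GX.add GX.scaleR inner_add_left inner_add_right wa aw a1(2) power2_eq_square)
    have GEb: "inner (GE b) b = \<mu>1 * s\<^sup>2 + inner (GE w) w"
      unfolding bw by (simp add: GE.add GE.scaleR inner_add_left inner_add_right wEa aw a1 power2_eq_square)
    have "\<gamma>0 * ((1 - \<theta>) * Q b) \<le> \<gamma>0 * (inner (XN b) b + \<alpha> * roughness c d b b)"
      using QN_ge[OF bS] \<gamma>0 by (intro mult_left_mono) auto
    also have "\<dots> \<le> inner (EN b) b"
      using order_trans[OF quot max] QN_pos[OF bS b0] unfolding penalized_quotient_def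
      by (simp add: pos_le_divide_eq)
    finally have "m * Q b \<le> inner (GE b) b"
      using errE[OF bS] by (simp add: m' algebra_simps abs_le_iff)
    moreover have "m * inner (GX b) b \<le> m * Q b"
    proof -
      have "0 \<le> \<alpha> * roughness c d b b" using \<open>\<alpha> > 0\<close> roughness_nonneg by simp
      then show ?thesis using m unfolding Q by (intro mult_left_mono) auto
    qed
    ultimately have "m * inner (GX b) b \<le> \<mu>1 * s\<^sup>2 + \<mu>2 * inner (GX w) w"
      using gap[OF wV wa] GEb by linarith
    then have "m * (s\<^sup>2 + inner (GX w) w) \<le> \<mu>1 * s\<^sup>2 + \<mu>2 * inner (GX w) w"
      by (simp only: GXb)
    then show ?thesis unfolding w_def[symmetric] by (simp add: algebra_simps)
  qed
  have "\<exists>b. is_max_point c d EN XN \<alpha> b \<and> inner (GX b) a1 = 1"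
  proof -
    obtain b where b: "is_max_point c d EN XN \<alpha> b"
      using is_max_point_exists[OF \<open>c < d\<close> \<open>\<alpha> > 0\<close> _ EN XN XN0 coerciveN a1(1)] \<theta> \<open>\<rho> > 0\<close> num num0 by auto
    have bV: "b \<in> ?V" "b \<noteq> 0" using b SV by (auto simp: is_max_point_def)
    \<comment> \<open>With \<open>s = 0\<close> the inequality \<open>key\<close> would give a
      nonpositive value of the form of \<open>GX\<close> at \<open>b\<close>, against positive
      definiteness.\<close>
    have s0: "inner (GX b) a1 \<noteq> 0"
    proof
      assume "inner (GX b) a1 = 0"
      then have "(m - \<mu>2) * inner (GX b) b \<le> 0" using key[OF b, of 0] by simp
      then show False using posdef[OF bV] m(3) by (simp add: mult_le_0_iff)
    qed
    have "is_max_point c d EN XN \<alpha> ((1 / inner (GX b) a1) *\<^sub>R b)"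
      using is_max_point_scaleR[OF \<open>c < d\<close> b _ EN(2) XN(2), of "1 / inner (GX b) a1"] s0 by auto
    moreover have "inner (GX ((1 / inner (GX b) a1) *\<^sub>R b)) a1 = 1" using s0 by (simp add: GX.scaleR)
    ultimately show ?thesis by blast
  qed
  moreover have "inner (GX (b - a1)) (b - a1) \<le> (\<mu>1 - m) / (m - \<mu>2)"
    if "is_max_point c d EN XN \<alpha> b" "inner (GX b) a1 = 1" for b
    using key[OF that(1), of 1] that(2) m(3) by (simp add: pos_le_divide_eq mult.commute)
  ultimately show ?thesis by blast
qed

text \<open>The repeated expression is the \<open>m\<close> of
  \<open>penalized_maximiser_near_eigenvector\<close>. It tends to \<open>\<mu>1\<close> as \<theta>
  decreases to 0, so the quotient tends to 0 and every small positive \<theta> will do.\<close>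

lemma ex_small_perturbation:
  fixes \<mu>1 \<mu>2 :: real
  assumes "\<mu>2 < \<mu>1" and "e > 0"
  shows "\<exists>\<theta>. 0 < \<theta> \<and> \<theta> < 1 \<and>
    \<mu>2 < (1 - \<theta>) * ((\<mu>1 - \<theta> * (1 + \<theta>)) / (1 + \<theta>)\<^sup>2) - \<theta> \<and>
    (\<mu>1 - ((1 - \<theta>) * ((\<mu>1 - \<theta> * (1 + \<theta>)) / (1 + \<theta>)\<^sup>2) - \<theta>)) /
      (((1 - \<theta>) * ((\<mu>1 - \<theta> * (1 + \<theta>)) / (1 + \<theta>)\<^sup>2) - \<theta>) - \<mu>2) < e"
proof -
  define m where "m \<theta> = (1 - \<theta>) * ((\<mu>1 - \<theta> * (1 + \<theta>)) / (1 + \<theta>)\<^sup>2) - \<theta>" for \<theta> :: real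
  have m: "(m \<longlongrightarrow> \<mu>1) (at_right 0)"
    unfolding m_def by (rule tendsto_eq_intros refl | simp)+
  have "((\<lambda>\<theta>. (\<mu>1 - m \<theta>) / (m \<theta> - \<mu>2)) \<longlongrightarrow> (\<mu>1 - \<mu>1) / (\<mu>1 - \<mu>2)) (at_right 0)"
    using \<open>\<mu>2 < \<mu>1\<close> by (intro tendsto_intros m) simp
  then have q: "((\<lambda>\<theta>. (\<mu>1 - m \<theta>) / (m \<theta> - \<mu>2)) \<longlongrightarrow> 0) (at_right 0)" by simp
  have "\<forall>\<^sub>F \<theta> in at_right 0. \<theta> < (1 :: real)" by (rule eventually_at_rightI[of 0 1]) auto
  moreover have "\<forall>\<^sub>F \<theta> in at_right 0. 0 < (\<theta> :: real)" by (rule eventually_at_right_less)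
  ultimately have "\<forall>\<^sub>F \<theta> in at_right 0. 0 < \<theta> \<and> \<theta> < 1 \<and> \<mu>2 < m \<theta> \<and> (\<mu>1 - m \<theta>) / (m \<theta> - \<mu>2) < e"
    using order_tendstoD(1)[OF m \<open>\<mu>2 < \<mu>1\<close>] order_tendstoD(2)[OF q \<open>e > 0\<close>]
    by eventually_elim auto
  from eventually_happens'[OF trivial_limit_at_right_real this] show ?thesis unfolding m_def .
qed

text \<open>Both sides are homogeneous of degree 2, so unit vectors suffice. Nonnegativity bounds
  the values from below and makes their \<open>INF\<close> a genuine lower bound.\<close>

lemma coercive_if_Inf_pos:
  assumes "c < d" and GX: "bounded_linear GX" and GX0: "\<And>g. 0 \<le> inner (GX g) g" and "\<beta> > 0"
    and pos: "(INF g\<in>{g \<in> sobolev2 c d. norm g = 1}. inner (GX g) g + \<beta> * roughness c d g g) > 0"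
  shows "\<exists>\<rho>>0. \<forall>g\<in>sobolev2 c d. \<rho> * (norm g)\<^sup>2 \<le> inner (GX g) g + \<beta> * roughness c d g g"
proof (intro exI conjI ballI)
  interpret GX: bounded_linear GX by (rule GX)
  let ?f = "\<lambda>g. inner (GX g) g + \<beta> * roughness c d g g"
  let ?\<rho> = "INF g\<in>{g \<in> sobolev2 c d. norm g = 1}. ?f g"
  show "?\<rho> > 0" by (rule pos)
  fix g assume g: "g \<in> sobolev2 c d"
  have f0: "0 \<le> ?f h" for h using GX0 roughness_nonneg \<open>\<beta> > 0\<close> by simp
  show "?\<rho> * (norm g)\<^sup>2 \<le> ?f g"
  proof (cases "g = 0")
    case True
    then show ?thesis using f0[of g] by simp
  next
    case False
    let ?h = "(1 / norm g) *\<^sub>R g"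
    have "?\<rho> \<le> ?f ?h"
    proof (rule cINF_lower)
      show "bdd_below (?f ` {g \<in> sobolev2 c d. norm g = 1})" using f0 by (intro bdd_belowI[of _ 0]) auto
      show "?h \<in> {g \<in> sobolev2 c d. norm g = 1}" using False sobolev2_scaleR[OF g] by simp
    qed
    also have "?f ?h = (1 / norm g)\<^sup>2 * ?f g"
      unfolding roughness_scaleR[OF \<open>c < d\<close> g]
      by (simp add: GX.scaleR power2_eq_square add_divide_distrib)
    finally show ?thesis using False by (simp add: power_divide pos_le_divide_eq)
  qed
qed

theorem theorem2:
  fixes M :: "'w measure" and c d :: real and q :: nat
    and X EXY :: "'w \<Rightarrow> l2" and Y \<epsilon> :: "'w \<Rightarrow> real"
    and f :: "(nat \<Rightarrow> real) \<Rightarrow> real \<Rightarrow> real"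
    and a u :: "nat \<Rightarrow> l2" and lam \<delta> \<alpha> :: "nat \<Rightarrow> real"
    and V S :: "l2 set" and \<sigma>Y :: "'w measure" and A :: "'w \<Rightarrow> nat \<Rightarrow> real"
    and \<Gamma>X \<Gamma>E :: "l2 \<Rightarrow> l2" and \<Gamma>XN \<Gamma>EN :: "nat \<Rightarrow> 'w \<Rightarrow> l2 \<Rightarrow> l2"
    and Xs :: "nat \<Rightarrow> 'w \<Rightarrow> l2" and Ys :: "nat \<Rightarrow> 'w \<Rightarrow> real"
    and est :: "nat \<Rightarrow> (nat \<Rightarrow> l2 \<times> real) \<Rightarrow> l2 \<Rightarrow> l2"
  assumes "prob_space M" and "c < d" and "q \<ge> 2"
    and V: "V = l2_on {c..d}" and S: "S = sobolev2 c d"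
    and X: "X \<in> borel_measurable M" "\<forall>\<omega>\<in>space M. X \<omega> \<in> V"
    and X_centered: "integrable M X" "(\<integral>\<omega>. X \<omega> \<partial>M) = 0"
    and Y: "Y \<in> borel_measurable M"
    and \<sigma>Y: "\<sigma>Y = vimage_algebra (space M) Y borel"
    and EXY: "is_cond_exp M \<sigma>Y X EXY"
    and \<Gamma>X: "\<Gamma>X = cov_op M X" and \<Gamma>E: "\<Gamma>E = cov_op M EXY"
    and \<Gamma>X_posdef: "\<forall>g\<in>V. g \<noteq> 0 \<longrightarrow> inner (\<Gamma>X g) g > 0"
    and eigenbasis: "\<forall>i. u i \<in> V" "\<forall>i. \<Gamma>X (u i) = \<delta> i *\<^sub>R u i"
      "\<forall>i j. inner (u i) (u j) = (if i = j then 1 else 0)"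
      "\<forall>g\<in>V. (\<forall>i. inner g (u i) = 0) \<longrightarrow> g = 0"
    and A: "A = (\<lambda>\<omega>. \<lambda>j\<in>{1..q}. inner (X \<omega>) (a j))"
    and eps: "integrable M \<epsilon>" "(\<integral>\<omega>. \<epsilon> \<omega> \<partial>M) = 0" 
      "prob_space.indep_set M (sets (vimage_algebra (space M) X borel))
         (sets (vimage_algebra (space M) \<epsilon> borel))"
    and model: "AE \<omega> in M. Y \<omega> = f (A \<omega>) (\<epsilon> \<omega>)"
    and summability: "(\<lambda>(i, j). 1 / (\<delta> i * \<delta> j) *
        (\<integral>\<omega>. real_cond_exp M \<sigma>Y (\<lambda>\<omega>. inner (X \<omega>) (u i)) \<omega> *
             real_cond_exp M \<sigma>Y (\<lambda>\<omega>. inner (X \<omega>) (u j)) \<omega> \<partial>M)\<^sup>2) summable_on UNIV"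
    and a: "\<forall>j\<in>{1..q}. a j \<in> V" "inj_on a {1..q}" "independent (a ` {1..q})"
      "\<forall>i\<in>{1..q}. \<forall>j\<in>{1..q}. inner (\<Gamma>X (a i)) (a j) = (if i = j then 1 else 0)"
      "\<forall>j\<in>{1..q}. \<Gamma>E (a j) = lam j *\<^sub>R \<Gamma>X (a j)"
    and lam: "\<forall>j\<in>{1..q}. lam j > 0" "\<forall>i\<in>{1..q}. \<forall>j\<in>{1..q}. i \<le> j \<longrightarrow> lam j \<le> lam i"
      "\<forall>\<mu>>0. \<forall>v\<in>V. \<Gamma>E v = \<mu> *\<^sub>R \<Gamma>X v \<longrightarrow> v \<in> span (a ` {1..q})"
    and Xs: "\<forall>n\<ge>1. Xs n \<in> borel_measurable M" "\<forall>n\<ge>1. \<forall>\<omega>\<in>space M. Xs n \<omega> \<in> V"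
    and Ys: "\<forall>n\<ge>1. Ys n \<in> borel_measurable M"
    and indep: "prob_space.indep_vars M (\<lambda>_. borel) (\<lambda>n \<omega>. (Xs n \<omega>, Ys n \<omega>)) {1..}"
    and ident: "\<forall>n\<ge>1. distr M borel (\<lambda>\<omega>. (Xs n \<omega>, Ys n \<omega>)) = distr M borel (\<lambda>\<omega>. (X \<omega>, Y \<omega>))"
    and \<Gamma>XN: "\<Gamma>XN = (\<lambda>N \<omega>. sample_cov_op N (\<lambda>n. Xs n \<omega>))"
    and \<Gamma>EN: "\<Gamma>EN = (\<lambda>N \<omega>. est N (\<lambda>n\<in>{1..N}. (Xs n \<omega>, Ys n \<omega>)))"
    and \<alpha>_pos: "\<forall>N\<ge>1. \<alpha> N > 0"
    and A1: "\<forall>g\<in>V. \<exists>v :: nat \<Rightarrow> real. AE \<omega> in M.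
        real_cond_exp M (vimage_algebra (space M) A (\<Pi>\<^sub>M j\<in>{1..q}. borel))
          (\<lambda>\<omega>. inner g (X \<omega>)) \<omega> = (\<Sum>j=1..q. v j * A \<omega> j)"
    and A2: "integrable M (\<lambda>\<omega>. norm (X \<omega>) ^ 4)"
    and A3: "\<forall>\<beta>>0. (INF g\<in>{g \<in> S. norm g = 1}. inner (\<Gamma>X g) g + \<beta> * roughness c d g g) > 0"
    and A4: "\<forall>N\<ge>1. \<forall>\<omega>\<in>space M. continuous_operator_on V (\<Gamma>EN N \<omega>)"
      "bigo_in_prob M (\<lambda>N \<omega>. op_norm_on V (\<lambda>g. \<Gamma>EN N \<omega> g - \<Gamma>E g)) (\<lambda>N. 1 / sqrt (real N))"
    and A5: "\<alpha> \<longlonglongrightarrow> 0" "filterlim (\<lambda>N. sqrt (real N) * \<alpha> N) at_top sequentially"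
    and A6: "\<forall>j\<in>{1..q}. a j \<in> S"
      "\<forall>g\<in>V. inner (\<Gamma>X g) (a 1) = 0 \<and> inner (\<Gamma>X g) g = 1 \<longrightarrow>
         inner (\<Gamma>E g) g \<le> inner (\<Gamma>E (a 2)) (a 2)"
      "inner (\<Gamma>E (a 2)) (a 2) = lam 2" "lam 2 < lam 1"
  shows "with_prob_to_1 M (\<lambda>N \<omega>. \<exists>b. is_max_point c d (\<Gamma>EN N \<omega>) (\<Gamma>XN N \<omega>) (\<alpha> N) b) \<and>
    with_prob_to_1 M (\<lambda>N \<omega>. \<exists>b. is_max_point c d (\<Gamma>EN N \<omega>) (\<Gamma>XN N \<omega>) (\<alpha> N) b \<and>
      inner (\<Gamma>X b) (a 1) = 1) \<and>
    (\<forall>aN :: nat \<Rightarrow> 'w \<Rightarrow> l2.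
      with_prob_to_1 M (\<lambda>N \<omega>. is_max_point c d (\<Gamma>EN N \<omega>) (\<Gamma>XN N \<omega>) (\<alpha> N) (aN N \<omega>) \<and>
        inner (\<Gamma>X (aN N \<omega>)) (a 1) = 1) \<longrightarrow>
      tends_in_prob M (\<lambda>N \<omega>. inner (\<Gamma>X (aN N \<omega> - a 1)) (aN N \<omega> - a 1)) 0)"
proof -
  interpret prob_space M by fact
  have V_sub: "subspace V" and V_closed: "closed V"
    unfolding V by (simp_all add: subspace_l2_on closed_l2_on)
  have SV: "g \<in> S \<Longrightarrow> g \<in> V" for g using sobolev2_subset unfolding S V by blast
  have X2: "integrable M (\<lambda>\<omega>. (norm (X \<omega>))\<^sup>2)"
  proof (rule square_integrable_imp_integrable)
    show "integrable M (\<lambda>\<omega>. ((norm (X \<omega>))\<^sup>2)\<^sup>2)" using A2 by (simp flip: power_mult)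
  qed (use X(1) in measurable)
  have sub: "subalgebra M \<sigma>Y"
    using Y unfolding \<sigma>Y subalgebra_def measurable_iff_sets by simp
  have EXY_meas: "EXY \<in> borel_measurable M"
    using EXY measurable_from_subalg[OF sub] by (auto simp: is_cond_exp_def)
  \<comment> \<open>The integrability of the tensors defining \<open>\<Gamma>E\<close>, and with it
    linearity and symmetry of \<open>\<Gamma>E\<close>, rests on this.\<close>
  have EXY2: "integrable M (\<lambda>\<omega>. (norm (EXY \<omega>))\<^sup>2)"
    by (rule cond_exp_square_integrable[OF finite_measure_axioms sub X(1) X_centered(1) X2 EXY])
  have lin: "bounded_linear \<Gamma>E" "bounded_linear \<Gamma>X"
    unfolding \<Gamma>E \<Gamma>X by (intro bounded_linear_cov_op EXY_meas EXY2 X(1) X2)+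
  have \<Gamma>X0: "0 \<le> inner (\<Gamma>X g) g" for g
    unfolding \<Gamma>X by (rule inner_cov_op_nonneg[OF X(1) X2])
  have fst_meas: "(fst :: l2 \<times> real \<Rightarrow> l2) \<in> borel_measurable borel"
    by (intro borel_measurable_continuous_onI continuous_intros)
  have indep_Xs: "indep_vars (\<lambda>_. borel) Xs {1..}"
    using indep_vars_compose2[OF indep, of "\<lambda>_. fst" "\<lambda>_. borel"] fst_meas by simp
  have ident_Xs: "distr M borel (Xs n) = distr M borel X" if n: "n \<ge> 1" for n
  proof -
    have "distr (distr M borel (\<lambda>\<omega>. (Xs n \<omega>, Ys n \<omega>))) borel fst
        = distr (distr M borel (\<lambda>\<omega>. (X \<omega>, Y \<omega>))) borel fst"
      using ident n by simp
    moreover have "(\<lambda>\<omega>. (Xs n \<omega>, Ys n \<omega>)) \<in> borel_measurable M" "(\<lambda>\<omega>. (X \<omega>, Y \<omega>)) \<in> borel_measurable M"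
      using Xs(1) Ys X(1) Y n by (auto intro: borel_measurable_Pair)
    ultimately show ?thesis by (simp add: distr_distr[OF fst_meas] comp_def)
  qed
  define Q where "Q N g = inner (\<Gamma>X g) g + \<alpha> N * roughness c d g g" for N g
  obtain \<rho> where \<rho>: "\<rho> > 0" "\<And>g. g \<in> S \<Longrightarrow> \<rho> * (norm g)\<^sup>2 \<le> inner (\<Gamma>X g) g + 1 * roughness c d g g"
    using coercive_if_Inf_pos[OF \<open>c < d\<close> lin(2) \<Gamma>X0 zero_less_one A3[rule_format, OF zero_less_one, unfolded S]]
    unfolding S by blast
  \<comment> \<open>For \<open>\<alpha> N \<le> 1\<close> the form with parameter
    \<open>\<alpha> N\<close> is at least \<open>\<alpha> N\<close> times the form with parameter 1,
    because the form of \<open>\<Gamma>X\<close> is nonnegative.\<close>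
  have coercive: "\<alpha> N * \<rho> * (norm g)\<^sup>2 \<le> Q N g" if "g \<in> S" "0 < \<alpha> N" "\<alpha> N \<le> 1" for N g
  proof -
    have "\<alpha> N * (\<rho> * (norm g)\<^sup>2) \<le> \<alpha> N * (inner (\<Gamma>X g) g + roughness c d g g)"
      using \<rho>(2)[OF that(1)] that by (intro mult_left_mono) auto
    also have "\<dots> \<le> Q N g"
      using mult_right_mono[OF that(3) \<Gamma>X0[of g]] by (simp add: Q_def distrib_left)
    finally show ?thesis by (simp add: mult.assoc)
  qed
  have N_large: "\<forall>\<^sub>F N in sequentially. N \<ge> 1 \<and> 0 < \<alpha> N \<and> \<alpha> N \<le> 1"
    using eventually_ge_at_top[of 1] order_tendstoD(2)[OF A5(1) zero_less_one]
    by eventually_elim (use \<alpha>_pos in auto)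
  define good where "good \<theta> N \<omega> \<longleftrightarrow> (\<forall>g\<in>S. \<bar>inner (\<Gamma>EN N \<omega> g) g - inner (\<Gamma>E g) g\<bar> \<le> \<theta> * Q N g \<and>
      \<bar>inner (\<Gamma>XN N \<omega> g) g - inner (\<Gamma>X g) g\<bar> \<le> \<theta> * Q N g)" for \<theta> N \<omega>
  have good: "with_prob_to_1 M (good \<theta>)" if "\<theta> > 0" for \<theta>
  proof (rule with_prob_to_1I)
    fix e :: real assume "e > 0"
    then have e2: "e / 2 > 0" by simp
    obtain K where K: "\<forall>\<^sub>F N in sequentially. \<exists>E\<in>events. prob E \<ge> 1 - e / 2 \<and>
        (\<forall>\<omega>\<in>E. \<bar>op_norm_on V (\<lambda>g. \<Gamma>EN N \<omega> g - \<Gamma>E g)\<bar> \<le> K * (1 / sqrt (real N)))"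
      using A4(2) e2 unfolding bigo_in_prob_def by blast
    have "\<exists>K\<ge>0. \<forall>N\<ge>1. \<exists>E\<in>events. prob E \<ge> 1 - e / 2 \<and> (\<forall>\<omega>\<in>E. \<forall>g\<in>V.
        \<bar>inner (sample_cov_op N (\<lambda>n. Xs n \<omega>) g - cov_op M X g) g\<bar> \<le> K / sqrt (real N) * (norm g)\<^sup>2)"
    proof (rule sample_cov_op_error[of u V X Xs])
      show "inner (u i) (u j) = (if i = j then 1 else 0)" "u i \<in> V" for i j using eigenbasis by auto
      show "g = 0" if "g \<in> V" "\<And>i. inner g (u i) = 0" for g using eigenbasis(4) that by blast
    qed (use V_sub V_closed X(1) X_centered A2 Xs indep_Xs ident_Xs e2 in auto)
    then obtain L where L: "\<And>N. N \<ge> 1 \<Longrightarrow> \<exists>E\<in>events. prob E \<ge> 1 - e / 2 \<and> (\<forall>\<omega>\<in>E. \<forall>g\<in>V.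
        \<bar>inner (\<Gamma>XN N \<omega> g - \<Gamma>X g) g\<bar> \<le> L / sqrt (real N) * (norm g)\<^sup>2)"
      unfolding \<Gamma>XN \<Gamma>X by blast
    \<comment> \<open>The threshold is chosen so that both error bounds, of order 1/sqrt N, fall
      below \<theta> times the coercivity constant \<open>\<alpha> N * \<rho>\<close>.\<close>
    have "\<forall>\<^sub>F N in sequentially. max K L / (\<theta> * \<rho>) \<le> sqrt (real N) * \<alpha> N"
      using A5(2) by (simp add: filterlim_at_top)
    with K N_large show "\<forall>\<^sub>F N in sequentially. \<exists>E\<in>events. prob E \<ge> 1 - e \<and> (\<forall>\<omega>\<in>E. good \<theta> N \<omega>)"
    proof eventually_elim
      case (elim N)
      then have N: "N \<ge> 1" and \<alpha>N: "0 < \<alpha> N" "\<alpha> N \<le> 1" by auto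
      have "max K L \<le> \<theta> * \<rho> * (sqrt (real N) * \<alpha> N)"
        using elim(3) \<rho>(1) \<open>\<theta> > 0\<close> by (simp add: pos_divide_le_eq mult_ac)
      then have rate: "max K L / sqrt (real N) \<le> \<theta> * (\<alpha> N * \<rho>)"
        using N by (simp add: pos_divide_le_eq mult_ac)
      have le_Q: "k / sqrt (real N) * (norm g)\<^sup>2 \<le> \<theta> * Q N g" if "g \<in> S" "k \<le> max K L" for g k
      proof -
        have "k / sqrt (real N) \<le> max K L / sqrt (real N)" using that(2) N by (intro divide_right_mono) auto
        then have "k / sqrt (real N) * (norm g)\<^sup>2 \<le> \<theta> * (\<alpha> N * \<rho>) * (norm g)\<^sup>2"
          using rate by (intro mult_right_mono) auto
        also have "\<dots> = \<theta> * (\<alpha> N * \<rho> * (norm g)\<^sup>2)" by simp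
        also have "\<dots> \<le> \<theta> * Q N g"
          using coercive[OF that(1) \<alpha>N] \<open>\<theta> > 0\<close> by (intro mult_left_mono) auto
        finally show ?thesis .
      qed
      obtain E where E: "E \<in> events" "prob E \<ge> 1 - e / 2"
        "\<And>\<omega>. \<omega> \<in> E \<Longrightarrow> \<bar>op_norm_on V (\<lambda>g. \<Gamma>EN N \<omega> g - \<Gamma>E g)\<bar> \<le> K * (1 / sqrt (real N))"
        using elim(1) by blast
      obtain F where F: "F \<in> events" "prob F \<ge> 1 - e / 2"
        "\<And>\<omega> g. \<omega> \<in> F \<Longrightarrow> g \<in> V \<Longrightarrow> \<bar>inner (\<Gamma>XN N \<omega> g - \<Gamma>X g) g\<bar> \<le> L / sqrt (real N) * (norm g)\<^sup>2"
        using L[OF N] by blast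
      have "good \<theta> N \<omega>" if \<omega>: "\<omega> \<in> E \<inter> F" for \<omega>
        unfolding good_def
      proof (intro ballI conjI)
        fix g assume g: "g \<in> S"
        have \<omega>M: "\<omega> \<in> space M" using \<omega> sets.sets_into_space[OF E(1)] by blast
        let ?D = "\<lambda>g. \<Gamma>EN N \<omega> g - \<Gamma>E g"
        have "continuous_on V ?D" "\<And>r f. f \<in> V \<Longrightarrow> ?D (r *\<^sub>R f) = r *\<^sub>R ?D f"
          using A4(1) N \<omega>M linear_continuous_on[OF lin(1), of V] bounded_linear.linear[OF lin(1)]
          unfolding continuous_operator_on_def
          by (auto intro: continuous_on_diff simp: linear_scale scaleR_diff_right)
        from op_norm_on_bound[OF V_sub this SV[OF g]]
        have 1: "norm (?D g) \<le> op_norm_on V ?D * norm g" .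
        have "\<bar>inner (\<Gamma>EN N \<omega> g) g - inner (\<Gamma>E g) g\<bar> \<le> norm (?D g) * norm g"
          using Cauchy_Schwarz_ineq2[of "?D g" g] by (simp add: inner_diff_left)
        also have "\<dots> \<le> op_norm_on V ?D * norm g * norm g" using 1 by (rule mult_right_mono) simp
        also have "\<dots> \<le> K / sqrt (real N) * (norm g)\<^sup>2"
          using E(3)[of \<omega>] \<omega> unfolding power2_eq_square mult.assoc by (intro mult_right_mono) auto
        also have "\<dots> \<le> \<theta> * Q N g" by (rule le_Q[OF g]) simp
        finally show "\<bar>inner (\<Gamma>EN N \<omega> g) g - inner (\<Gamma>E g) g\<bar> \<le> \<theta> * Q N g" .
        have "\<bar>inner (\<Gamma>XN N \<omega> g) g - inner (\<Gamma>X g) g\<bar> \<le> L / sqrt (real N) * (norm g)\<^sup>2"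
          using F(3)[of \<omega> g] \<omega> SV[OF g] by (simp add: inner_diff_left)
        also have "\<dots> \<le> \<theta> * Q N g" by (rule le_Q[OF g]) simp
        finally show "\<bar>inner (\<Gamma>XN N \<omega> g) g - inner (\<Gamma>X g) g\<bar> \<le> \<theta> * Q N g" .
      qed
      moreover have "prob (E \<inter> F) \<ge> 1 - e" using prob_Int_ge[OF E(1) F(1) E(2) F(2)] by simp
      ultimately show ?case using sets.Int[OF E(1) F(1)] by blast
    qed
  qed
  have q1: "1 \<in> {1..q}" "2 \<in> {1..q}" using \<open>q \<ge> 2\<close> by auto
  have a1: "a 1 \<in> S" "inner (\<Gamma>X (a 1)) (a 1) = 1" "\<Gamma>E (a 1) = lam 1 *\<^sub>R \<Gamma>X (a 1)"
    using A6(1) a(4,5) q1 by auto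
  \<comment> \<open>(A6) speaks of vectors normalised for \<open>\<Gamma>X\<close>; dividing by the
    root of the form, positive for nonzero \<open>g\<close>, extends it to all of them.\<close>
  have gap: "inner (\<Gamma>E g) g \<le> lam 2 * inner (\<Gamma>X g) g" if g: "g \<in> V" "inner (\<Gamma>X g) (a 1) = 0" for g
  proof (cases "g = 0")
    case True
    then show ?thesis by simp
  next
    case False
    let ?n = "inner (\<Gamma>X g) g"
    let ?h = "(1 / sqrt ?n) *\<^sub>R g"
    interpret \<Gamma>E: bounded_linear \<Gamma>E by (rule lin)
    interpret \<Gamma>X: bounded_linear \<Gamma>X by (rule lin)
    have n: "?n > 0" using \<Gamma>X_posdef g(1) False by blast
    have r: "(1 / sqrt ?n) * (1 / sqrt ?n) = 1 / ?n" using n by simp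
    have "inner (\<Gamma>X ?h) (a 1) = 0" using g(2) by (simp add: \<Gamma>X.scaleR)
    moreover have "inner (\<Gamma>X ?h) ?h = (1 / sqrt ?n) * (1 / sqrt ?n) * ?n"
      by (simp add: \<Gamma>X.scaleR)
    then have "inner (\<Gamma>X ?h) ?h = 1" unfolding r using n by simp
    ultimately have "inner (\<Gamma>E ?h) ?h \<le> lam 2"
      using A6(2,3) subspace_scale[OF V_sub g(1)] by metis
    moreover have "inner (\<Gamma>E ?h) ?h = (1 / sqrt ?n) * (1 / sqrt ?n) * inner (\<Gamma>E g) g"
      by (simp add: \<Gamma>E.scaleR)
    then have "inner (\<Gamma>E ?h) ?h = inner (\<Gamma>E g) g / ?n" unfolding r by simp
    ultimately have "inner (\<Gamma>E g) g / ?n \<le> lam 2" by linarith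
    then show ?thesis using n by (simp add: pos_divide_le_eq)
  qed
  \<comment> \<open>All randomness is confined to \<open>good\<close>. The statement holds at each
    \<omega> and for all normalised maximisers there, so it applies to any family
    \<open>aN\<close>.\<close>
  have near: "\<exists>\<theta>>0. \<forall>\<^sub>F N in sequentially. \<forall>\<omega>\<in>space M. good \<theta> N \<omega> \<longrightarrow>
      (\<exists>b. is_max_point c d (\<Gamma>EN N \<omega>) (\<Gamma>XN N \<omega>) (\<alpha> N) b \<and> inner (\<Gamma>X b) (a 1) = 1) \<and>
      (\<forall>b. is_max_point c d (\<Gamma>EN N \<omega>) (\<Gamma>XN N \<omega>) (\<alpha> N) b \<and> inner (\<Gamma>X b) (a 1) = 1 \<longrightarrow>
        inner (\<Gamma>X (b - a 1)) (b - a 1) < e)" if "e > 0" for e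
  proof -
    obtain \<theta> where \<theta>: "0 < \<theta>" "\<theta> < 1"
      and m: "lam 2 < (1 - \<theta>) * ((lam 1 - \<theta> * (1 + \<theta>)) / (1 + \<theta>)\<^sup>2) - \<theta>"
      and me: "(lam 1 - ((1 - \<theta>) * ((lam 1 - \<theta> * (1 + \<theta>)) / (1 + \<theta>)\<^sup>2) - \<theta>)) /
        (((1 - \<theta>) * ((lam 1 - \<theta> * (1 + \<theta>)) / (1 + \<theta>)\<^sup>2) - \<theta>) - lam 2) < e"
      using ex_small_perturbation[OF A6(4) \<open>e > 0\<close>] by blast
    \<comment> \<open>The roughness of \<open>a 1\<close> is a fixed number, so the penalty at
      \<open>a 1\<close> disappears with \<alpha>.\<close>
    have "(\<lambda>N. Q N (a 1)) \<longlonglongrightarrow> 1 + 0 * roughness c d (a 1) (a 1)"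
      unfolding Q_def a1(2) by (intro tendsto_intros A5(1))
    then have "\<forall>\<^sub>F N in sequentially. Q N (a 1) < 1 + \<theta>"
      using \<theta> by (intro order_tendstoD) auto
    with N_large show ?thesis
    proof (intro exI[of _ \<theta>] conjI \<theta>(1), eventually_elim, intro ballI impI)
      fix N \<omega> assume N: "N \<ge> 1 \<and> 0 < \<alpha> N \<and> \<alpha> N \<le> 1" and QN: "Q N (a 1) < 1 + \<theta>"
        and \<omega>: "\<omega> \<in> space M" and g: "good \<theta> N \<omega>"
      have GXN: "bounded_linear (\<Gamma>XN N \<omega>)" unfolding \<Gamma>XN by (rule bounded_linear_sample_cov_op)
      have GEN: "continuous_operator_on V (\<Gamma>EN N \<omega>)" using A4(1) N \<omega> by blast
      have \<alpha>\<rho>: "0 < \<alpha> N * \<rho>" using N \<rho>(1) by simp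
      let ?m = "(1 - \<theta>) * ((lam 1 - \<theta> * (1 + \<theta>)) / (1 + \<theta>)\<^sup>2) - \<theta>"
      have "(\<exists>b. is_max_point c d (\<Gamma>EN N \<omega>) (\<Gamma>XN N \<omega>) (\<alpha> N) b \<and> inner (\<Gamma>X b) (a 1) = 1) \<and>
        (\<forall>b. is_max_point c d (\<Gamma>EN N \<omega>) (\<Gamma>XN N \<omega>) (\<alpha> N) b \<and> inner (\<Gamma>X b) (a 1) = 1 \<longrightarrow>
          inner (\<Gamma>X (b - a 1)) (b - a 1) \<le> (lam 1 - ?m) / (?m - lam 2))"
      proof (rule penalized_maximiser_near_eigenvector)
        show "c < d" "0 < \<alpha> N" "0 < \<alpha> N * \<rho>" "0 < \<theta>" "\<theta> < 1" by (use \<open>c < d\<close> N \<alpha>\<rho> \<theta> in auto)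
        show "bounded_linear \<Gamma>E" "bounded_linear \<Gamma>X" by (rule lin)+
        show "inner (\<Gamma>E f) g = inner (\<Gamma>E g) f" "inner (\<Gamma>X f) g = inner (\<Gamma>X g) f" for f g
          unfolding \<Gamma>E \<Gamma>X by (rule inner_cov_op_commute[OF EXY_meas EXY2] inner_cov_op_commute[OF X(1) X2])+
        show "0 < inner (\<Gamma>X g) g" if "g \<in> l2_on {c..d}" "g \<noteq> 0" for g
          using \<Gamma>X_posdef that unfolding V by blast
        show "a 1 \<in> sobolev2 c d" "inner (\<Gamma>X (a 1)) (a 1) = 1" "\<Gamma>E (a 1) = lam 1 *\<^sub>R \<Gamma>X (a 1)"
          using a1 unfolding S by blast+
        show "inner (\<Gamma>E g) g \<le> lam 2 * inner (\<Gamma>X g) g" if "g \<in> l2_on {c..d}" "inner (\<Gamma>X g) (a 1) = 0" for g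
          using gap that unfolding V by blast
        show "Q N g = inner (\<Gamma>X g) g + \<alpha> N * roughness c d g g" for g by (simp add: Q_def)
        show "\<alpha> N * \<rho> * (norm g)\<^sup>2 \<le> Q N g" if "g \<in> sobolev2 c d" for g
          using coercive[of g N] that N unfolding S by blast
        show "\<bar>inner (\<Gamma>EN N \<omega> g) g - inner (\<Gamma>E g) g\<bar> \<le> \<theta> * Q N g"
          "\<bar>inner (\<Gamma>XN N \<omega> g) g - inner (\<Gamma>X g) g\<bar> \<le> \<theta> * Q N g" if "g \<in> sobolev2 c d" for g
          using g that unfolding good_def S by blast+
        show "Q N (a 1) \<le> 1 + \<theta>" using QN by simp
        show "0 \<le> lam 2" using lam(1) q1 by (simp add: less_imp_le)
        show "lam 2 < ?m" by (rule m)
        show "continuous_on (l2_on {c..d}) (\<Gamma>EN N \<omega>)"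
          "\<And>r x. x \<in> l2_on {c..d} \<Longrightarrow> \<Gamma>EN N \<omega> (r *\<^sub>R x) = r *\<^sub>R \<Gamma>EN N \<omega> x"
          using GEN unfolding continuous_operator_on_def V by blast+
        show "continuous_on (l2_on {c..d}) (\<Gamma>XN N \<omega>)" by (rule linear_continuous_on[OF GXN])
        show "\<Gamma>XN N \<omega> (r *\<^sub>R x) = r *\<^sub>R \<Gamma>XN N \<omega> x" for r x
          by (rule linear_scale[OF bounded_linear.linear[OF GXN]])
        show "0 \<le> inner (\<Gamma>XN N \<omega> x) x" for x unfolding \<Gamma>XN by (rule inner_sample_cov_op_nonneg)
      qed (rule refl)
      then       show "(\<exists>b. is_max_point c d (\<Gamma>EN N \<omega>) (\<Gamma>XN N \<omega>) (\<alpha> N) b \<and> inner (\<Gamma>X b) (a 1) = 1) \<and>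
        (\<forall>b. is_max_point c d (\<Gamma>EN N \<omega>) (\<Gamma>XN N \<omega>) (\<alpha> N) b \<and> inner (\<Gamma>X b) (a 1) = 1 \<longrightarrow>
          inner (\<Gamma>X (b - a 1)) (b - a 1) < e)"
        using me by (blast intro: le_less_trans)
    qed
  qed
  have ex: "with_prob_to_1 M (\<lambda>N \<omega>. \<exists>b. is_max_point c d (\<Gamma>EN N \<omega>) (\<Gamma>XN N \<omega>) (\<alpha> N) b \<and>
      inner (\<Gamma>X b) (a 1) = 1)"
  proof -
    obtain \<theta> where \<theta>: "\<theta> > 0" and ev: "\<forall>\<^sub>F N in sequentially. \<forall>\<omega>\<in>space M. good \<theta> N \<omega> \<longrightarrow>
        (\<exists>b. is_max_point c d (\<Gamma>EN N \<omega>) (\<Gamma>XN N \<omega>) (\<alpha> N) b \<and> inner (\<Gamma>X b) (a 1) = 1) \<and>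
        (\<forall>b. is_max_point c d (\<Gamma>EN N \<omega>) (\<Gamma>XN N \<omega>) (\<alpha> N) b \<and> inner (\<Gamma>X b) (a 1) = 1 \<longrightarrow>
          inner (\<Gamma>X (b - a 1)) (b - a 1) < 1)"
      using near[OF zero_less_one] by blast
    \<comment> \<open>A single event is enough here, so it is given to the rule for two events
      twice.\<close>
    show ?thesis
      by (rule with_prob_to_1_conj_mono[OF good[OF \<theta>] good[OF \<theta>]]) (use ev in \<open>eventually_elim, blast\<close>)
  qed
  moreover have "with_prob_to_1 M (\<lambda>N \<omega>. \<exists>b. is_max_point c d (\<Gamma>EN N \<omega>) (\<Gamma>XN N \<omega>) (\<alpha> N) b)"
    by (rule with_prob_to_1_conj_mono[OF ex ex]) (auto intro!: always_eventually)
  moreover have "tends_in_prob M (\<lambda>N \<omega>. inner (\<Gamma>X (aN N \<omega> - a 1)) (aN N \<omega> - a 1)) 0"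
    if aN: "with_prob_to_1 M (\<lambda>N \<omega>. is_max_point c d (\<Gamma>EN N \<omega>) (\<Gamma>XN N \<omega>) (\<alpha> N) (aN N \<omega>) \<and>
      inner (\<Gamma>X (aN N \<omega>)) (a 1) = 1)" for aN
    unfolding tends_in_prob_def
  proof (intro allI impI)
    fix e :: real assume "e > 0"
    obtain \<theta> where \<theta>: "\<theta> > 0" and ev: "\<forall>\<^sub>F N in sequentially. \<forall>\<omega>\<in>space M. good \<theta> N \<omega> \<longrightarrow>
        (\<exists>b. is_max_point c d (\<Gamma>EN N \<omega>) (\<Gamma>XN N \<omega>) (\<alpha> N) b \<and> inner (\<Gamma>X b) (a 1) = 1) \<and>
        (\<forall>b. is_max_point c d (\<Gamma>EN N \<omega>) (\<Gamma>XN N \<omega>) (\<alpha> N) b \<and> inner (\<Gamma>X b) (a 1) = 1 \<longrightarrow>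
          inner (\<Gamma>X (b - a 1)) (b - a 1) < e)"
      using near[OF \<open>e > 0\<close>] by blast
    show "with_prob_to_1 M (\<lambda>N \<omega>. \<bar>inner (\<Gamma>X (aN N \<omega> - a 1)) (aN N \<omega> - a 1) - 0\<bar> < e)"
      by (rule with_prob_to_1_conj_mono[OF good[OF \<theta>] aN])
        (use ev in \<open>eventually_elim, simp add: \<Gamma>X0\<close>)
  qed
  ultimately show ?thesis by blast
qed

end
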